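(* Let $E$ be a finite directed graph without sinks in which every loop has an exit. Then the normalizer of $\mathrm{Aut}_{\mathcal D_E}(C^*(E))$ in $\mathrm{Aut}(C^*(E))$ coincides with $\mathrm{Aut}(C^*(E),\mathcal D_E)$. If, in addition, the center of $C^*(E)$ is trivial, then $\mathrm{Aut}_{\mathcal D_E}(C^*(E))$ is a maximal abelian subgroup of $\mathrm{Aut}(C^*(E))$.
   Context: A directed graph $E=(E^0,E^1,r,s)$ has vertex set $E^0$, edge set $E^1$, and range and source maps $r,s:E^1\to E^0$; it is finite if $E^0$ and $E^1$ are finite. $C^*(E)$ is the universal $C^*$-algebra generated by mutually orthogonal projections $P_v$ ($v\in E^0$) and partial isometries $S_e$ ($e\in E^1$) with $S_e^*S_e=P_{r(e)}$, $S_e^*S_f=0$ for $e\ne f$, $S_eS_e^*\le P_{s(e)}$, and $P_v=\sum_{s(e)=v}S_eS_e^*$ whenever $v$ emits finitely many and at least one edge. A path of length $k\ge1$ is $\mu=(\mu_1,\ldots,\mu_k)$ with $\mu_j\in E^1$ and $r(\mu_j)=s(\mu_{j+1})$; vertices are the paths of length $0$; put $s(\mu)=s(\mu_1)$, $r(\mu)=r(\mu_k)$, $S_\mu=S_{\mu_1}\cdots S_{\mu_k}$, $S_v=P_v$, and $P_\mu=S_\mu S_\mu^*$. A sink is a vertex emitting no edges. A loop is a path $\mu$ of length at least $1$ with $s(\mu)=r(\mu)$; it has an exit if some $s(\mu_j)$ emits at least two distinct edges. $\mathcal D_E$ (the diagonal) is the $C^*$-subalgebra of $C^*(E)$ generated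 by all $P_\mu$. $\mathrm{Aut}_{\mathcal D_E}(C^*(E))$ is the group of automorphisms of $C^*(E)$ which fix $\mathcal D_E$ pointwise, and $\mathrm{Aut}(C^*(E),\mathcal D_E)$ is the group of automorphisms $\alpha$ of $C^*(E)$ with $\alpha(\mathcal D_E)=\mathcal D_E$. The center is trivial if it equals $\mathbb C1$. *)

theory Defs
  imports
    "HOL-Analysis.Analysis"
    "HOL-Algebra.Group_Action"
    "HOL-Algebra.FiniteProduct"
    "Graph_Theory.Arc_Walk"
begin

section \<open>C*-algebras\<close>

text \<open>No unit is assumed, and the zero algebra is allowed.\<close>

class cstar_algebra = real_normed_algebra + banach +
  fixes scaleC :: "complex \<Rightarrow> 'a \<Rightarrow> 'a" (infixr "*\<^sub>C" 75)
    and adj :: "'a \<Rightarrow> 'a"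
  assumes scaleC_add_right: "c *\<^sub>C (x + y) = c *\<^sub>C x + c *\<^sub>C y"
    and scaleC_add_left: "(c + d) *\<^sub>C x = c *\<^sub>C x + d *\<^sub>C x"
    and scaleC_scaleC: "c *\<^sub>C d *\<^sub>C x = (c * d) *\<^sub>C x"
    and scaleR_scaleC: "r *\<^sub>R x = complex_of_real r *\<^sub>C x"
    and mult_scaleC_left: "(c *\<^sub>C x) * y = c *\<^sub>C (x * y)"
    and mult_scaleC_right: "x * (c *\<^sub>C y) = c *\<^sub>C (x * y)"
    and norm_scaleC: "norm (c *\<^sub>C x) = cmod c * norm x"
    and adj_adj: "adj (adj x) = x"
    and adj_add: "adj (x + y) = adj x + adj y"
    and adj_scaleC: "adj (c *\<^sub>C x) = cnj c *\<^sub>C adj x"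
    and adj_mult: "adj (x * y) = adj y * adj x"
    and norm_adj_mult: "norm (adj x * x) = (norm x)\<^sup>2"

text \<open>
  The universal property of a graph algebra quantifies over C*-algebras, and one cannot
  quantify over types inside a formula.  So C*-algebras are also given as structures with
  an explicit carrier; a type of class \<open>cstar_algebra\<close> is such a structure with
  carrier \<open>UNIV\<close>.
\<close>

record 'b cstar_struct = "'b partial_object" +
  cadd :: "'b \<Rightarrow> 'b \<Rightarrow> 'b"
  czero :: 'b
  cmult :: "'b \<Rightarrow> 'b \<Rightarrow> 'b"
  cscale :: "complex \<Rightarrow> 'b \<Rightarrow> 'b"
  cadj :: "'b \<Rightarrow> 'b"
  cnorm :: "'b \<Rightarrow> real"

definition add_group :: "'b cstar_struct \<Rightarrow> 'b monoid" where
  "add_group B = \<lparr>carrier = carrier B, monoid.mult = cadd B, one = czero B\<rparr>"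

definition cdist :: "'b cstar_struct \<Rightarrow> 'b \<Rightarrow> 'b \<Rightarrow> real" where
  "cdist B x y = cnorm B (cadd B x (cscale B (- 1) y))"

locale cstar_structure =
  fixes B :: "'b cstar_struct"
  assumes add_group: "comm_group (add_group B)"
    and cmult_closed: "\<lbrakk>x \<in> carrier B; y \<in> carrier B\<rbrakk> \<Longrightarrow> cmult B x y \<in> carrier B"
    and cmult_assoc: "\<lbrakk>x \<in> carrier B; y \<in> carrier B; z \<in> carrier B\<rbrakk>
      \<Longrightarrow> cmult B (cmult B x y) z = cmult B x (cmult B y z)"
    and cmult_cadd_left: "\<lbrakk>x \<in> carrier B; y \<in> carrier B; z \<in> carrier B\<rbrakk>
      \<Longrightarrow> cmult B (cadd B x y) z = cadd B (cmult B x z) (cmult B y z)"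
    and cmult_cadd_right: "\<lbrakk>x \<in> carrier B; y \<in> carrier B; z \<in> carrier B\<rbrakk>
      \<Longrightarrow> cmult B x (cadd B y z) = cadd B (cmult B x y) (cmult B x z)"
    and cscale_closed: "x \<in> carrier B \<Longrightarrow> cscale B c x \<in> carrier B"
    and cscale_cadd_right: "\<lbrakk>x \<in> carrier B; y \<in> carrier B\<rbrakk>
      \<Longrightarrow> cscale B c (cadd B x y) = cadd B (cscale B c x) (cscale B c y)"
    and cscale_cadd_left: "x \<in> carrier B
      \<Longrightarrow> cscale B (c + d) x = cadd B (cscale B c x) (cscale B d x)"
    and cscale_cscale: "x \<in> carrier B \<Longrightarrow> cscale B c (cscale B d x) = cscale B (c * d) x"
    and cscale_one: "x \<in> carrier B \<Longrightarrow> cscale B 1 x = x"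
    and cmult_cscale_left: "\<lbrakk>x \<in> carrier B; y \<in> carrier B\<rbrakk>
      \<Longrightarrow> cmult B (cscale B c x) y = cscale B c (cmult B x y)"
    and cmult_cscale_right: "\<lbrakk>x \<in> carrier B; y \<in> carrier B\<rbrakk>
      \<Longrightarrow> cmult B x (cscale B c y) = cscale B c (cmult B x y)"
    and cadj_closed: "x \<in> carrier B \<Longrightarrow> cadj B x \<in> carrier B"
    and cadj_cadj: "x \<in> carrier B \<Longrightarrow> cadj B (cadj B x) = x"
    and cadj_cadd: "\<lbrakk>x \<in> carrier B; y \<in> carrier B\<rbrakk>
      \<Longrightarrow> cadj B (cadd B x y) = cadd B (cadj B x) (cadj B y)"
    and cadj_cscale: "x \<in> carrier B \<Longrightarrow> cadj B (cscale B c x) = cscale B (cnj c) (cadj B x)"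
    and cadj_cmult: "\<lbrakk>x \<in> carrier B; y \<in> carrier B\<rbrakk>
      \<Longrightarrow> cadj B (cmult B x y) = cmult B (cadj B y) (cadj B x)"
    and cnorm_eq_0: "x \<in> carrier B \<Longrightarrow> cnorm B x = 0 \<longleftrightarrow> x = czero B"
    and cnorm_cadd: "\<lbrakk>x \<in> carrier B; y \<in> carrier B\<rbrakk>
      \<Longrightarrow> cnorm B (cadd B x y) \<le> cnorm B x + cnorm B y"
    and cnorm_cscale: "x \<in> carrier B \<Longrightarrow> cnorm B (cscale B c x) = cmod c * cnorm B x"
    and cnorm_cmult: "\<lbrakk>x \<in> carrier B; y \<in> carrier B\<rbrakk>
      \<Longrightarrow> cnorm B (cmult B x y) \<le> cnorm B x * cnorm B y"
    and cnorm_cadj_cmult: "x \<in> carrier B \<Longrightarrow> cnorm B (cmult B (cadj B x) x) = (cnorm B x)\<^sup>2"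
    and complete: "\<lbrakk>\<And>n. u n \<in> carrier B;
        \<And>e. e > 0 \<Longrightarrow> \<exists>N. \<forall>m\<ge>N. \<forall>n\<ge>N. cdist B (u m) (u n) < e\<rbrakk>
      \<Longrightarrow> \<exists>x\<in>carrier B. (\<lambda>n. cdist B (u n) x) \<longlonglongrightarrow> 0"

definition type_struct :: "'a::cstar_algebra cstar_struct" where
  "type_struct = \<lparr>carrier = UNIV, cadd = (+), czero = 0, cmult = (*), cscale = scaleC,
     cadj = adj, cnorm = norm\<rparr>"

definition star_hom :: "'a cstar_struct \<Rightarrow> 'b cstar_struct \<Rightarrow> ('a \<Rightarrow> 'b) \<Rightarrow> bool" where
  "star_hom A B \<phi> \<longleftrightarrow> \<phi> \<in> carrier A \<rightarrow> carrier B \<and>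
     (\<forall>x\<in>carrier A. \<forall>y\<in>carrier A. \<phi> (cadd A x y) = cadd B (\<phi> x) (\<phi> y)) \<and>
     (\<forall>x\<in>carrier A. \<forall>y\<in>carrier A. \<phi> (cmult A x y) = cmult B (\<phi> x) (\<phi> y)) \<and>
     (\<forall>c. \<forall>x\<in>carrier A. \<phi> (cscale A c x) = cscale B c (\<phi> x)) \<and>
     (\<forall>x\<in>carrier A. \<phi> (cadj A x) = cadj B (\<phi> x))"

text \<open>\<open>x \<le> y\<close> in \<open>B\<close>: the difference \<open>y - x\<close> is positive, i.e. of the form \<open>b\<^sup>* b\<close>.\<close>

definition cle :: "'b cstar_struct \<Rightarrow> 'b \<Rightarrow> 'b \<Rightarrow> bool" where
  "cle B x y \<longleftrightarrow> (\<exists>b\<in>carrier B. y = cadd B x (cmult B (cadj B b) b))"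

definition projection :: "'b cstar_struct \<Rightarrow> 'b \<Rightarrow> bool" where
  "projection B p \<longleftrightarrow> p \<in> carrier B \<and> cadj B p = p \<and> cmult B p p = p"

definition partial_isometry :: "'b cstar_struct \<Rightarrow> 'b \<Rightarrow> bool" where
  "partial_isometry B s \<longleftrightarrow> s \<in> carrier B \<and> cmult B (cmult B s (cadj B s)) s = s"

definition cstar_subalgebra :: "'a::cstar_algebra set \<Rightarrow> bool" where
  "cstar_subalgebra X \<longleftrightarrow> closed X \<and> 0 \<in> X \<and>
     (\<forall>x\<in>X. \<forall>y\<in>X. x + y \<in> X) \<and> (\<forall>x\<in>X. \<forall>y\<in>X. x * y \<in> X) \<and>
     (\<forall>c. \<forall>x\<in>X. c *\<^sub>C x \<in> X) \<and> (\<forall>x\<in>X. adj x \<in> X)"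

definition cstar_generated :: "'a::cstar_algebra set \<Rightarrow> 'a set" where
  "cstar_generated G = cstar_subalgebra hull G"

definition algebra_center :: "'a::cstar_algebra set" where
  "algebra_center = {x. \<forall>y. x * y = y * x}"

definition trivial_center :: "'a::cstar_algebra itself \<Rightarrow> bool" where
  "trivial_center _ \<longleftrightarrow> (\<exists>u::'a. (\<forall>x. u * x = x \<and> x * u = x) \<and>
     algebra_center = range (\<lambda>c. c *\<^sub>C u))"


section \<open>Graph algebras\<close>

text \<open>
  In \<open>pre_digraph\<close>, the source map is \<open>tail\<close> and the range map is \<open>head\<close>.
\<close>

definition CK_family ::
  "('v, 'e) pre_digraph \<Rightarrow> 'b cstar_struct \<Rightarrow> ('v \<Rightarrow> 'b) \<Rightarrow> ('e \<Rightarrow> 'b) \<Rightarrow> bool" where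
  "CK_family E B P S \<longleftrightarrow>
     (\<forall>v\<in>verts E. projection B (P v)) \<and>
     (\<forall>v\<in>verts E. \<forall>w\<in>verts E. v \<noteq> w \<longrightarrow> cmult B (P v) (P w) = czero B) \<and>
     (\<forall>e\<in>arcs E. partial_isometry B (S e)) \<and>
     (\<forall>e\<in>arcs E. cmult B (cadj B (S e)) (S e) = P (head E e)) \<and>
     (\<forall>e\<in>arcs E. \<forall>f\<in>arcs E. e \<noteq> f \<longrightarrow> cmult B (cadj B (S e)) (S f) = czero B) \<and>
     (\<forall>e\<in>arcs E. cle B (cmult B (S e) (cadj B (S e))) (P (tail E e))) \<and>
     (\<forall>v\<in>verts E. finite (out_arcs E v) \<and> out_arcs E v \<noteq> {} \<longrightarrow>
        P v = finprod (add_group B) (\<lambda>e. cmult B (S e) (cadj B (S e))) (out_arcs E v))"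

text \<open>
  The type \<open>'a\<close>, with the family \<open>P\<close>, \<open>S\<close>, is the universal C*-algebra \<open>C*(E)\<close>
  of the graph \<open>E\<close>.  The test algebras \<open>B\<close> have their carriers in the fixed type
  \<open>nat \<Rightarrow> real\<close>.  For countable \<open>E\<close> this is no restriction, since an algebra generated by
  countably many elements is separable, hence has at most as many elements as that type:
  see \<open>graph_cstar_algebra_universal\<close> below.
\<close>

definition graph_cstar_algebra ::
  "('v, 'e) pre_digraph \<Rightarrow> ('v \<Rightarrow> 'a::cstar_algebra) \<Rightarrow> ('e \<Rightarrow> 'a) \<Rightarrow> bool" where
  "graph_cstar_algebra E P S \<longleftrightarrow>
     CK_family E type_struct P S \<and>
     cstar_generated (P ` verts E \<union> S ` arcs E) = UNIV \<and>
     (\<forall>(B :: (nat \<Rightarrow> real) cstar_struct) Q T. cstar_structure B \<and> CK_family E B Q T \<longrightarrow>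
        (\<exists>\<phi>. star_hom type_struct B \<phi> \<and> (\<forall>v\<in>verts E. \<phi> (P v) = Q v) \<and>
             (\<forall>e\<in>arcs E. \<phi> (S e) = T e)))"

text \<open>\<open>path_op P S v \<mu>\<close> is \<open>S\<^sub>\<mu>\<close> for a path \<open>\<mu>\<close> with source \<open>v\<close>.\<close>

fun path_op :: "('v \<Rightarrow> 'a::cstar_algebra) \<Rightarrow> ('e \<Rightarrow> 'a) \<Rightarrow> 'v \<Rightarrow> 'e list \<Rightarrow> 'a" where
  "path_op P S v [] = P v"
| "path_op P S v [e] = S e"
| "path_op P S v (e # f # \<mu>) = S e * path_op P S v (f # \<mu>)"

definition diagonal ::
  "('v, 'e) pre_digraph \<Rightarrow> ('v \<Rightarrow> 'a::cstar_algebra) \<Rightarrow> ('e \<Rightarrow> 'a) \<Rightarrow> 'a set" where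
  "diagonal E P S = cstar_generated
     {path_op P S v \<mu> * adj (path_op P S v \<mu>) | v \<mu> w. pre_digraph.awalk E v \<mu> w}"

definition no_sinks :: "('v, 'e) pre_digraph \<Rightarrow> bool" where
  "no_sinks E \<longleftrightarrow> (\<forall>v\<in>verts E. out_arcs E v \<noteq> {})"

definition every_loop_has_exit :: "('v, 'e) pre_digraph \<Rightarrow> bool" where
  "every_loop_has_exit E \<longleftrightarrow> (\<forall>\<mu>. wf_digraph.closed_w E \<mu> \<longrightarrow>
     (\<exists>e\<in>set \<mu>. \<exists>f\<in>out_arcs E (tail E e). \<exists>g\<in>out_arcs E (tail E e). f \<noteq> g))"


section \<open>Automorphism groups\<close>

definition cstar_Aut :: "('a::cstar_algebra \<Rightarrow> 'a) monoid" where
  "cstar_Aut = \<lparr>carrier = {\<alpha>. bij \<alpha> \<and> star_hom type_struct type_struct \<alpha>},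
     monoid.mult = (\<circ>), one = id\<rparr>"

definition Aut_fixing :: "'a::cstar_algebra set \<Rightarrow> ('a \<Rightarrow> 'a) set" where
  "Aut_fixing X = {\<alpha> \<in> carrier cstar_Aut. \<forall>x\<in>X. \<alpha> x = x}"

definition Aut_preserving :: "'a::cstar_algebra set \<Rightarrow> ('a \<Rightarrow> 'a) set" where
  "Aut_preserving X = {\<alpha> \<in> carrier cstar_Aut. \<alpha> ` X = X}"

definition abelian_subgroup :: "'g set \<Rightarrow> ('g, 'm) monoid_scheme \<Rightarrow> bool" where
  "abelian_subgroup H G \<longleftrightarrow> subgroup H G \<and> comm_group (G\<lparr>carrier := H\<rparr>)"

definition maximal_abelian_subgroup :: "'g set \<Rightarrow> ('g, 'm) monoid_scheme \<Rightarrow> bool" where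
  "maximal_abelian_subgroup H G \<longleftrightarrow> abelian_subgroup H G \<and>
     (\<forall>K. abelian_subgroup K G \<and> H \<subseteq> K \<longrightarrow> K = H)"

lemma group_cstar_Aut: "group (cstar_Aut :: ('a::cstar_algebra \<Rightarrow> 'a) monoid)"
proof (rule groupI)
  fix \<alpha> :: "'a \<Rightarrow> 'a" assume "\<alpha> \<in> carrier cstar_Aut"
  then have b: "bij \<alpha>" and h: "star_hom type_struct type_struct \<alpha>" by (auto simp: cstar_Aut_def)
  let ?\<beta> = "inv_into UNIV \<alpha>"
  have s: "\<alpha> (?\<beta> x) = x" "?\<beta> (\<alpha> x) = x" for x
    using b by (auto simp: bij_is_surj surj_f_inv_f bij_is_inj)
  have ap: "\<alpha> x = \<alpha> y \<Longrightarrow> x = y" for x y using b by (metis s(2))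
  have "star_hom type_struct type_struct ?\<beta>"
    using h unfolding star_hom_def type_struct_def
    by (simp add: s) (intro conjI allI; rule ap; simp add: s)
  then show "\<exists>\<beta>\<in>carrier cstar_Aut. \<beta> \<otimes>\<^bsub>cstar_Aut\<^esub> \<alpha> = \<one>\<^bsub>cstar_Aut\<^esub>"
    using b by (intro bexI[of _ ?\<beta>])
      (auto simp: cstar_Aut_def bij_imp_bij_inv bij_is_inj fun_eq_iff)
qed (auto simp: cstar_Aut_def star_hom_def type_struct_def fun_eq_iff intro: bij_comp)

lemma cstar_structure_type_struct: "cstar_structure (type_struct :: 'a::cstar_algebra cstar_struct)"
proof -
  have one: "1 *\<^sub>C x = x" for x :: 'a using scaleR_scaleC[of 1 x] by simp
  have m1: "(-1) *\<^sub>C x = - x" for x :: 'a using scaleR_scaleC[of "-1" x] by simp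
  have ex: "\<exists>y. x + y = 0" for x :: 'a by (rule exI[of _ "- x"]) simp
  have g: "comm_group (add_group (type_struct :: 'a cstar_struct))"
    by (rule comm_groupI) (auto simp: add_group_def type_struct_def algebra_simps ex)
  show ?thesis
  proof (rule cstar_structure.intro, goal_cases)
    case 1 show ?case by (rule g)
  next
    case (23 u)
    then have "Cauchy u"
      by (auto simp: Cauchy_def cdist_def type_struct_def m1 dist_norm)
    then obtain x where "u \<longlonglongrightarrow> x" by (auto simp: Cauchy_convergent_iff convergent_def)
    then have "(\<lambda>n. dist (u n) x) \<longlonglongrightarrow> 0" by (rule tendsto_dist_iff[THEN iffD1])
    then show ?case by (auto simp: cdist_def type_struct_def m1 dist_norm)
  qed (simp_all add: type_struct_def mult.assoc distrib_left distrib_right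
      scaleC_add_right scaleC_add_left scaleC_scaleC one mult_scaleC_left
      mult_scaleC_right norm_scaleC adj_adj adj_add adj_scaleC adj_mult
      norm_adj_mult norm_triangle_ineq norm_mult_ineq)
qed


section \<open>Test algebras over arbitrary types\<close>

text \<open>
  Let \<open>B\<close> be a C*-algebra over any type, and let \<open>g\<close> enumerate a family in \<open>B\<close>.  The
  *-polynomials in that family with coefficients in \<open>\<rat> + i\<rat>\<close> form a countable dense subset of
  the C*-algebra it generates.  Mapping an element to its distances from these
  *-polynomials gives a copy of the generated algebra with carrier in \<open>nat \<Rightarrow> real\<close>.
\<close>

datatype gterm = GGen nat | GAdd gterm gterm | GMul gterm gterm | GScl rat rat gterm | GAdj gterm

instance gterm :: countable by countable_datatype

primrec geval :: "'b cstar_struct \<Rightarrow> (nat \<Rightarrow> 'b) \<Rightarrow> gterm \<Rightarrow> 'b" where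
  "geval B g (GGen n) = g n"
| "geval B g (GAdd s t) = cadd B (geval B g s) (geval B g t)"
| "geval B g (GMul s t) = cmult B (geval B g s) (geval B g t)"
| "geval B g (GScl p q t) = cscale B (Complex (of_rat p) (of_rat q)) (geval B g t)"
| "geval B g (GAdj t) = cadj B (geval B g t)"

lemma rat_complex_dense:
  assumes "e > 0" shows "\<exists>p q. cmod (c - Complex (of_rat p) (of_rat q)) < e"
proof -
  obtain p where p: "Re c < of_rat p" "of_rat p < Re c + e / 2"
    using of_rat_dense[of "Re c" "Re c + e / 2"] assms by auto
  obtain q where q: "Im c < of_rat q" "of_rat q < Im c + e / 2"
    using of_rat_dense[of "Im c" "Im c + e / 2"] assms by auto
  have "cmod (c - Complex (of_rat p) (of_rat q)) \<le> \<bar>Re c - of_rat p\<bar> + \<bar>Im c - of_rat q\<bar>"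
    using cmod_le[of "c - Complex (of_rat p) (of_rat q)"] by simp
  also have "\<dots> < e" using p q by simp
  finally show ?thesis by blast
qed

context cstar_structure
begin

lemma cadd_closed: "\<lbrakk>x \<in> carrier B; y \<in> carrier B\<rbrakk> \<Longrightarrow> cadd B x y \<in> carrier B"
  and czero_closed: "czero B \<in> carrier B"
  and cadd_assoc: "\<lbrakk>x \<in> carrier B; y \<in> carrier B; z \<in> carrier B\<rbrakk>
    \<Longrightarrow> cadd B (cadd B x y) z = cadd B x (cadd B y z)"
  and cadd_commute: "\<lbrakk>x \<in> carrier B; y \<in> carrier B\<rbrakk> \<Longrightarrow> cadd B x y = cadd B y x"
  and cadd_czero: "x \<in> carrier B \<Longrightarrow> cadd B x (czero B) = x"
  and cadd_cancel: "\<lbrakk>x \<in> carrier B; y \<in> carrier B; z \<in> carrier B; cadd B x y = cadd B x z\<rbrakk> \<Longrightarrow> y = z"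
proof -
  interpret G: comm_group "add_group B" by (rule add_group)
  show "\<lbrakk>x \<in> carrier B; y \<in> carrier B\<rbrakk> \<Longrightarrow> cadd B x y \<in> carrier B"
    using G.m_closed[of x y] by (simp add: add_group_def)
  show "czero B \<in> carrier B" using G.one_closed by (simp add: add_group_def)
  show "\<lbrakk>x \<in> carrier B; y \<in> carrier B; z \<in> carrier B\<rbrakk>
    \<Longrightarrow> cadd B (cadd B x y) z = cadd B x (cadd B y z)"
    using G.m_assoc[of x y z] by (simp add: add_group_def)
  show "\<lbrakk>x \<in> carrier B; y \<in> carrier B\<rbrakk> \<Longrightarrow> cadd B x y = cadd B y x"
    using G.m_comm[of x y] by (simp add: add_group_def)
  show "x \<in> carrier B \<Longrightarrow> cadd B x (czero B) = x" using G.r_one[of x] by (simp add: add_group_def)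
  show "\<lbrakk>x \<in> carrier B; y \<in> carrier B; z \<in> carrier B; cadd B x y = cadd B x z\<rbrakk> \<Longrightarrow> y = z"
    using G.Units_l_cancel[of x y z] unfolding G.Units_eq by (simp add: add_group_def)
qed

lemma cadd_lcomm: "\<lbrakk>x \<in> carrier B; y \<in> carrier B; z \<in> carrier B\<rbrakk>
    \<Longrightarrow> cadd B x (cadd B y z) = cadd B y (cadd B x z)"
  by (metis cadd_assoc cadd_commute)

lemmas cadd_ac = cadd_assoc cadd_commute cadd_lcomm
lemmas closed = cadd_closed czero_closed cmult_closed cscale_closed cadj_closed

lemma cscale_0: "x \<in> carrier B \<Longrightarrow> cscale B 0 x = czero B"
  by (rule cadd_cancel[of "cscale B 0 x"])
    (use cscale_cadd_left[of x 0 0] in \<open>auto simp: closed cadd_czero\<close>)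

lemma cadd_neg: "x \<in> carrier B \<Longrightarrow> cadd B x (cscale B (- 1) x) = czero B"
  using cscale_cadd_left[of x 1 "- 1"] by (simp add: cscale_one cscale_0)

lemma neg_cancel: "\<lbrakk>y \<in> carrier B; z \<in> carrier B\<rbrakk> \<Longrightarrow> cadd B y (cadd B (cscale B (- 1) y) z) = z"
  by (metis cadd_assoc cadd_neg cadd_czero cadd_commute czero_closed cscale_closed)

lemma cnorm_nonneg: "x \<in> carrier B \<Longrightarrow> 0 \<le> cnorm B x"
  using cnorm_cadd[of x "cscale B (- 1) x"] cnorm_eq_0[of "czero B"]
  by (simp add: closed cnorm_cscale cadd_neg)

lemma cdist_nonneg: "\<lbrakk>x \<in> carrier B; y \<in> carrier B\<rbrakk> \<Longrightarrow> 0 \<le> cdist B x y"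
  by (simp add: cdist_def closed cnorm_nonneg)

lemma cdist_eq_0: "\<lbrakk>x \<in> carrier B; y \<in> carrier B; cdist B x y = 0\<rbrakk> \<Longrightarrow> x = y"
proof -
  assume a: "x \<in> carrier B" "y \<in> carrier B" "cdist B x y = 0"
  then have "cadd B x (cscale B (- 1) y) = czero B"
    by (simp add: cdist_def closed cnorm_eq_0)
  then have "cadd B (cscale B (- 1) y) x = cadd B (cscale B (- 1) y) y"
    using a cadd_neg[of y] by (simp add: cadd_commute closed)
  then show "x = y" using a by (metis cadd_cancel cscale_closed)
qed

lemma cdist_triangle:
  assumes "x \<in> carrier B" "y \<in> carrier B" "z \<in> carrier B"
  shows "cdist B x z \<le> cdist B x y + cdist B y z"
proof -
  have "cadd B x (cscale B (- 1) z) =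
      cadd B (cadd B x (cscale B (- 1) y)) (cadd B y (cscale B (- 1) z))"
    using assms neg_cancel[of y "cscale B (-1) z"]
    by (simp add: cadd_assoc closed cadd_lcomm[of "cscale B (-1) y"])
  then show ?thesis unfolding cdist_def using assms by (metis cnorm_cadd closed)
qed

lemma cdist_cscale: "\<lbrakk>x \<in> carrier B; y \<in> carrier B\<rbrakk>
    \<Longrightarrow> cdist B (cscale B c x) (cscale B c y) = cmod c * cdist B x y"
  unfolding cdist_def
  by (simp add: cnorm_cscale[symmetric] closed cscale_cadd_right cscale_cscale)

lemma cdist_commute: "\<lbrakk>x \<in> carrier B; y \<in> carrier B\<rbrakk> \<Longrightarrow> cdist B x y = cdist B y x"
proof -
  assume a: "x \<in> carrier B" "y \<in> carrier B"
  then have "cadd B y (cscale B (- 1) x) = cscale B (- 1) (cadd B x (cscale B (- 1) y))"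
    by (simp add: cscale_cadd_right closed cscale_cscale cscale_one cadd_commute)
  then show ?thesis unfolding cdist_def using a by (simp add: cnorm_cscale closed)
qed

lemma cdist_cscale_left: "x \<in> carrier B
    \<Longrightarrow> cdist B (cscale B c x) (cscale B d x) = cmod (c - d) * cnorm B x"
  unfolding cdist_def using cscale_cadd_left[of x c "- d"]
  by (simp add: cnorm_cscale[symmetric] closed cscale_cscale)

lemma cdist_cadd:
  assumes "x \<in> carrier B" "y \<in> carrier B" "k \<in> carrier B" "l \<in> carrier B"
  shows "cdist B (cadd B x y) (cadd B k l) \<le> cdist B x k + cdist B y l"
proof -
  have "cadd B (cadd B x y) (cscale B (- 1) (cadd B k l)) =
      cadd B (cadd B x (cscale B (- 1) k)) (cadd B y (cscale B (- 1) l))"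
    using assms by (simp add: cscale_cadd_right closed cadd_ac)
  then show ?thesis unfolding cdist_def using assms by (metis cnorm_cadd closed)
qed

lemma cdist_cmult:
  assumes "x \<in> carrier B" "y \<in> carrier B" "k \<in> carrier B" "l \<in> carrier B"
  shows "cdist B (cmult B x y) (cmult B k l) \<le> cdist B x k * cnorm B y + cnorm B k * cdist B y l"
proof -
  have "cdist B (cmult B x y) (cmult B k y) = cnorm B (cmult B (cadd B x (cscale B (- 1) k)) y)"
    using assms by (simp add: cdist_def cmult_cadd_left cmult_cscale_left closed)
  also have "\<dots> \<le> cdist B x k * cnorm B y"
    unfolding cdist_def using assms by (intro cnorm_cmult closed)
  finally have 1: "cdist B (cmult B x y) (cmult B k y) \<le> cdist B x k * cnorm B y" .
  have "cdist B (cmult B k y) (cmult B k l) = cnorm B (cmult B k (cadd B y (cscale B (- 1) l)))"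
    using assms by (simp add: cdist_def cmult_cadd_right cmult_cscale_right closed)
  also have "\<dots> \<le> cnorm B k * cdist B y l"
    unfolding cdist_def using assms by (intro cnorm_cmult closed)
  finally show ?thesis
    using 1 cdist_triangle[of "cmult B x y" "cmult B k y" "cmult B k l"] assms by (simp add: closed)
qed

lemma cnorm_cadj: "x \<in> carrier B \<Longrightarrow> cnorm B (cadj B x) = cnorm B x"
proof -
  have *: "cnorm B x \<le> cnorm B (cadj B x)" if x: "x \<in> carrier B" for x
  proof (cases "cnorm B x = 0")
    case True then show ?thesis using x by (simp add: cnorm_nonneg closed)
  next
    case False
    have "cnorm B x * cnorm B x \<le> cnorm B (cadj B x) * cnorm B x"
      using cnorm_cmult[of "cadj B x" x] cnorm_cadj_cmult[of x] x by (simp add: closed power2_eq_square)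
    then show ?thesis using False cnorm_nonneg[OF x] by (simp add: mult_le_cancel_right)
  qed
  assume "x \<in> carrier B"
  then show ?thesis using *[of x] *[of "cadj B x"] by (simp add: closed cadj_cadj)
qed

lemma cdist_cadj: "\<lbrakk>x \<in> carrier B; y \<in> carrier B\<rbrakk> \<Longrightarrow> cdist B (cadj B x) (cadj B y) = cdist B x y"
proof -
  assume a: "x \<in> carrier B" "y \<in> carrier B"
  have "cdist B (cadj B x) (cadj B y) = cnorm B (cadj B (cadd B x (cscale B (- 1) y)))"
    using a by (simp add: cdist_def closed cadj_cadd cadj_cscale)
  then show ?thesis using a by (simp add: cdist_def closed cnorm_cadj)
qed

lemma cmult_czero: "x \<in> carrier B \<Longrightarrow> cmult B (czero B) x = czero B"
    "x \<in> carrier B \<Longrightarrow> cmult B x (czero B) = czero B"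
  by (metis cscale_0 cmult_cscale_left cmult_cscale_right cmult_closed czero_closed)+

lemma cmult_finprod_delta:
  assumes "finite F" "z \<in> carrier B" "w \<in> carrier B"
    and "\<And>i. i \<in> F \<Longrightarrow> f i \<in> carrier B"
    and "\<And>i. i \<in> F \<Longrightarrow> cmult B (f i) z = (if i = e then w else czero B)"
  shows "finprod (add_group B) f F \<in> carrier B \<and>
    cmult B (finprod (add_group B) f F) z = (if e \<in> F then w else czero B)"
proof -
  interpret G: comm_group "add_group B" by (rule add_group)
  show ?thesis using assms(1,4,5)
  proof (induction F rule: finite_induct)
    case empty
    have "finprod (add_group B) f {} = czero B"
      unfolding G.finprod_empty by (simp add: add_group_def)
    then show ?case using assms(2) by (simp add: cmult_czero czero_closed)
  next
    case (insert i F)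
    have f: "f \<in> F \<rightarrow> carrier (add_group B)" "f i \<in> carrier (add_group B)"
      using insert.prems by (auto simp: add_group_def)
    have m: "x \<otimes>\<^bsub>add_group B\<^esub> y = cadd B x y" for x y by (simp add: add_group_def)
    have IH: "finprod (add_group B) f F \<in> carrier B"
        "cmult B (finprod (add_group B) f F) z = (if e \<in> F then w else czero B)"
      using insert.IH insert.prems by auto
    show ?case
      unfolding G.finprod_insert[OF insert.hyps(1,2) f] m
      using insert.prems insert.hyps IH assms(2,3)
      by (auto simp: closed cmult_cadd_left cadd_czero cadd_commute[of "czero B"])
  qed
qed

lemma CK_difference:
  assumes E: "fin_digraph E" and CK: "CK_family E B Q T" and e: "e \<in> arcs E"
  defines "s \<equiv> cmult B (T e) (cadj B (T e))" and "p \<equiv> Q (tail E e)"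
  defines "b \<equiv> cadd B p (cscale B (- 1) s)"
  shows "p = cadd B s (cmult B (cadj B b) b)"
proof -
  interpret E: fin_digraph E by (rule E)
  have T: "T i \<in> carrier B" if "i \<in> arcs E" for i
    using CK that by (auto simp: CK_family_def partial_isometry_def)
  have out: "out_arcs E (tail E e) \<subseteq> arcs E" "e \<in> out_arcs E (tail E e)"
    using e by (auto simp: out_arcs_def)
  then have "finite (out_arcs E (tail E e))" using finite_subset E.finite_arcs by blast
  moreover from this have p: "p = finprod (add_group B) (\<lambda>i. cmult B (T i) (cadj B (T i))) (out_arcs E (tail E e))"
    using CK out(2) E.tail_in_verts[OF e] unfolding CK_family_def p_def by blast
  moreover have pp: "cadj B p = p" "cmult B p p = p" "p \<in> carrier B"
    using CK e by (auto simp: CK_family_def projection_def p_def)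
  moreover have s: "s \<in> carrier B" using T[OF e] by (simp add: s_def closed)
  moreover have "cmult B (cmult B (T i) (cadj B (T i))) s = (if i = e then s else czero B)"
    if i: "i \<in> arcs E" for i
  proof -
    have "cmult B (cmult B (T i) (cadj B (T i))) s =
        cmult B (cmult B (T i) (cmult B (cadj B (T i)) (T e))) (cadj B (T e))"
      using T[OF i] T[OF e] by (simp add: s_def cmult_assoc closed)
    moreover have "cmult B (T e) (cmult B (cadj B (T e)) (T e)) = T e"
      using CK e T[OF e] cmult_assoc[of "T e" "cadj B (T e)" "T e"]
      by (simp add: CK_family_def partial_isometry_def closed)
    ultimately show ?thesis
      using CK i e T[OF i] T[OF e] by (auto simp: CK_family_def s_def cmult_czero closed)
  qed
  ultimately have ps: "cmult B p s = s"
    using cmult_finprod_delta[of "out_arcs E (tail E e)" s s "\<lambda>i. cmult B (T i) (cadj B (T i))" e]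
      out T by (auto simp: subset_eq closed)
  have ss: "cadj B s = s" using T[OF e] by (simp add: s_def cadj_cmult cadj_cadj closed)
  have sp: "cmult B s p = s" using arg_cong[OF ps, of "cadj B"] s pp ss by (simp add: cadj_cmult)
  have s2: "cmult B s s = s"
  proof -
    have "cmult B s s = cmult B (cmult B (cmult B (T e) (cadj B (T e))) (T e)) (cadj B (T e))"
      using T[OF e] by (simp add: s_def cmult_assoc closed)
    also have "\<dots> = s" using CK e by (simp add: CK_family_def partial_isometry_def s_def)
    finally show ?thesis .
  qed
  have b: "b \<in> carrier B" "cadj B b = b"
    using pp s ss by (simp_all add: b_def closed cadj_cadd cadj_cscale)
  have "cmult B p b = b" using pp s ps by (simp add: b_def cmult_cadd_right cmult_cscale_right closed)
  moreover have "cmult B s b = czero B"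
    using pp s sp s2 by (simp add: b_def cmult_cadd_right cmult_cscale_right closed cadd_neg)
  moreover have "cmult B b b = cadd B (cmult B p b) (cscale B (- 1) (cmult B s b))"
    using pp s b(1) by (subst (1) b_def) (simp add: cmult_cadd_left cmult_cscale_left closed)
  moreover have "cscale B (- 1) (czero B) = czero B"
    using cadd_neg[OF czero_closed] by (metis cadd_commute cadd_czero cscale_closed czero_closed)
  ultimately have "cmult B (cadj B b) b = b" using b by (simp add: cadd_czero)
  then show ?thesis
    using pp s neg_cancel[of s p] by (simp add: b_def cadd_commute[of p] closed)
qed

definition gen_closure :: "(nat \<Rightarrow> 'b) \<Rightarrow> 'b set" where
  "gen_closure g = {x \<in> carrier B. \<forall>e>0. \<exists>t. cdist B x (geval B g t) < e}"

lemma geval_closed: "range g \<subseteq> carrier B \<Longrightarrow> geval B g t \<in> carrier B"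
  by (induction t) (auto simp: closed)

context
  fixes g :: "nat \<Rightarrow> 'b" assumes g: "range g \<subseteq> carrier B"
begin

lemma gen_closureD: "x \<in> gen_closure g \<Longrightarrow> e > 0 \<Longrightarrow> \<exists>t. cdist B x (geval B g t) < e"
  and gen_closure_carrier: "x \<in> gen_closure g \<Longrightarrow> x \<in> carrier B"
  by (auto simp: gen_closure_def)

lemma cdist_self: "x \<in> carrier B \<Longrightarrow> cdist B x x = 0"
  by (simp add: cdist_def cadd_neg cnorm_eq_0 closed)

lemma gen_closure_gen: "g n \<in> gen_closure g"
proof -
  have "cdist B (g n) (geval B g (GGen n)) = 0" using g by (auto intro: cdist_self)
  then show ?thesis using g unfolding gen_closure_def by (auto intro!: exI[of _ "GGen n"])
qed

lemma gen_closure_cadd: assumes "x \<in> gen_closure g" "y \<in> gen_closure g"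
  shows "cadd B x y \<in> gen_closure g"
proof -
  have "\<exists>t. cdist B (cadd B x y) (geval B g t) < e" if "e > 0" for e
  proof -
    have "e / 2 > 0" using that by simp
    then obtain s t where "cdist B x (geval B g s) < e / 2" "cdist B y (geval B g t) < e / 2"
      using gen_closureD[OF assms(1)] gen_closureD[OF assms(2)] by blast
    then have "cdist B (cadd B x y) (geval B g (GAdd s t)) < e"
      using cdist_cadd[of x y "geval B g s" "geval B g t"] assms
      by (simp add: gen_closure_carrier geval_closed[OF g])
    then show ?thesis by blast
  qed
  then show ?thesis using assms by (simp add: gen_closure_def closed)
qed

lemma gen_closure_cadj: assumes "x \<in> gen_closure g" shows "cadj B x \<in> gen_closure g"
proof -
  have "\<exists>t. cdist B (cadj B x) (geval B g t) < e" if e: "e > 0" for e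
  proof -
    obtain s where "cdist B x (geval B g s) < e" using assms e gen_closureD by meson
    then have "cdist B (cadj B x) (geval B g (GAdj s)) < e"
      using assms by (simp add: gen_closure_carrier geval_closed[OF g] cdist_cadj)
    then show ?thesis by blast
  qed
  then show ?thesis using assms by (simp add: gen_closure_def closed)
qed

lemma gen_closure_cmult: assumes "x \<in> gen_closure g" "y \<in> gen_closure g"
  shows "cmult B x y \<in> gen_closure g"
proof -
  have xy: "x \<in> carrier B" "y \<in> carrier B" using assms gen_closure_carrier by auto
  have "\<exists>t. cdist B (cmult B x y) (geval B g t) < e" if e: "e > 0" for e
  proof -
    have p: "cnorm B y + 1 > 0" using cnorm_nonneg[OF xy(2)] by simp
    obtain s where s: "cdist B x (geval B g s) < e / 2 / (cnorm B y + 1)"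
      using gen_closureD[OF assms(1), of "e / 2 / (cnorm B y + 1)"] p e by auto
    let ?k = "geval B g s"
    have k: "?k \<in> carrier B" using geval_closed[OF g] .
    have q: "cnorm B ?k + 1 > 0" using cnorm_nonneg[OF k] by simp
    obtain t where t: "cdist B y (geval B g t) < e / 2 / (cnorm B ?k + 1)"
      using gen_closureD[OF assms(2), of "e / 2 / (cnorm B ?k + 1)"] q e by auto
    let ?l = "geval B g t"
    have l: "?l \<in> carrier B" using geval_closed[OF g] .
    have "cdist B x ?k * cnorm B y \<le> cdist B x ?k * (cnorm B y + 1)"
      using cdist_nonneg[OF xy(1) k] by (simp add: mult_left_mono)
    also have "\<dots> < e / 2" using s p by (simp add: pos_less_divide_eq algebra_simps)
    finally have 1: "cdist B x ?k * cnorm B y < e / 2" .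
    have "cnorm B ?k * cdist B y ?l \<le> (cnorm B ?k + 1) * cdist B y ?l"
      using cdist_nonneg[OF xy(2) l] by (simp add: mult_right_mono)
    also have "\<dots> < e / 2" using t q by (simp add: pos_less_divide_eq algebra_simps)
    finally have "cdist B (cmult B x y) (geval B g (GMul s t)) < e"
      using 1 cdist_cmult[OF xy k l] by simp
    then show ?thesis by blast
  qed
  then show ?thesis using xy by (simp add: gen_closure_def closed)
qed

lemma gen_closure_cscale: assumes "x \<in> gen_closure g"
  shows "cscale B c x \<in> gen_closure g"
proof -
  have x: "x \<in> carrier B" using assms gen_closure_carrier by auto
  have "\<exists>t. cdist B (cscale B c x) (geval B g t) < e" if e: "e > 0" for e
  proof -
    have p: "cmod c + 1 > 0" using norm_ge_zero[of c] by linarith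
    obtain s where s: "cdist B x (geval B g s) < e / 2 / (cmod c + 1)"
      using gen_closureD[OF assms(1), of "e / 2 / (cmod c + 1)"] p e by auto
    let ?k = "geval B g s"
    have k: "?k \<in> carrier B" using geval_closed[OF g] .
    have q: "cnorm B ?k + 1 > 0" using cnorm_nonneg[OF k] by simp
    obtain a b where t: "cmod (c - Complex (of_rat a) (of_rat b)) < e / 2 / (cnorm B ?k + 1)"
      using rat_complex_dense[of "e / 2 / (cnorm B ?k + 1)" c] q e by auto
    let ?d = "Complex (of_rat a) (of_rat b)"
    have "cmod c * cdist B x ?k \<le> (cmod c + 1) * cdist B x ?k"
      using cdist_nonneg[OF x k] by (simp add: mult_right_mono)
    also have "\<dots> < e / 2" using s p by (simp add: pos_less_divide_eq algebra_simps)
    finally have 1: "cdist B (cscale B c x) (cscale B c ?k) < e / 2" using x k by (simp add: cdist_cscale)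
    have "cmod (c - ?d) * cnorm B ?k \<le> cmod (c - ?d) * (cnorm B ?k + 1)"
      by (simp add: mult_left_mono)
    also have "\<dots> < e / 2" using t q by (simp add: pos_less_divide_eq algebra_simps)
    finally have "cdist B (cscale B c ?k) (cscale B ?d ?k) < e / 2" using k by (simp add: cdist_cscale_left)
    then have "cdist B (cscale B c x) (geval B g (GScl a b s)) < e"
      using 1 cdist_triangle[of "cscale B c x" "cscale B c ?k" "cscale B ?d ?k"] x k by (simp add: closed)
    then show ?thesis by blast
  qed
  then show ?thesis using x by (simp add: gen_closure_def closed)
qed

lemma gen_closure_czero: "czero B \<in> gen_closure g"
  using gen_closure_cscale[OF gen_closure_gen[of 0], of 0] g by (simp add: cscale_0 image_subset_iff)

lemma gen_closure_limit:
  assumes u: "\<And>n::nat. u n \<in> gen_closure g" and x: "x \<in> carrier B" and lim: "(\<lambda>n. cdist B (u n) x) \<longlonglongrightarrow> 0"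
  shows "x \<in> gen_closure g"
proof -
  have "\<exists>t. cdist B x (geval B g t) < e" if e: "e > 0" for e
  proof -
    obtain n where n: "cdist B (u n) x < e / 2"
      using order_tendstoD(2)[OF lim, of "e / 2"] e by (auto simp: eventually_sequentially)
    obtain t where "cdist B (u n) (geval B g t) < e / 2" using gen_closureD[OF u, of "e / 2"] e by auto
    then have "cdist B x (geval B g t) < e"
      using n cdist_triangle[of x "u n" "geval B g t"] x u[of n] geval_closed[OF g, of t]
      by (simp add: cdist_commute[of x "u n"] gen_closure_carrier)
    then show ?thesis by blast
  qed
  then show ?thesis using x by (simp add: gen_closure_def)
qed

definition ccode :: "'b \<Rightarrow> nat \<Rightarrow> real" where
  "ccode x = (\<lambda>n. cdist B x (geval B g (from_nat n)))"

lemma inj_code: "inj_on ccode (gen_closure g)"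
proof (rule inj_onI)
  fix x y assume a: "x \<in> gen_closure g" "y \<in> gen_closure g" "ccode x = ccode y"
  have xy: "x \<in> carrier B" "y \<in> carrier B" using a gen_closure_carrier by auto
  have "cdist B x y \<le> e" if "e > 0" for e
  proof -
    obtain t where t: "cdist B x (geval B g t) < e / 2" using gen_closureD[OF a(1), of "e / 2"] \<open>e > 0\<close> by auto
    have "cdist B y (geval B g t) < e / 2"
      using t fun_cong[OF a(3), of "to_nat t"] by (simp add: ccode_def)
    then show ?thesis
      using t cdist_triangle[of x "geval B g t" y] cdist_commute[of y "geval B g t"] xy
        geval_closed[OF g, of t] by simp
  qed
  then have "cdist B x y \<le> 0" by (meson dense_ge)
  then show "x = y" using xy cdist_nonneg cdist_eq_0 by (metis order_antisym)
qed

definition ccopy :: "(nat \<Rightarrow> real) cstar_struct" where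
  "ccopy = (let d = inv_into (gen_closure g) ccode in
    \<lparr>carrier = ccode ` gen_closure g,
     cadd = \<lambda>u v. ccode (cadd B (d u) (d v)),
     czero = ccode (czero B),
     cmult = \<lambda>u v. ccode (cmult B (d u) (d v)),
     cscale = \<lambda>c u. ccode (cscale B c (d u)),
     cadj = \<lambda>u. ccode (cadj B (d u)),
     cnorm = \<lambda>u. cnorm B (d u)\<rparr>)"

lemma decode: "x \<in> gen_closure g \<Longrightarrow> inv_into (gen_closure g) ccode (ccode x) = x"
  using inj_code by simp

lemmas gen_closure_ops = gen_closure_cadd gen_closure_cmult gen_closure_cscale gen_closure_cadj
  gen_closure_czero

lemma copy_ops:
  "carrier ccopy = ccode ` gen_closure g"
  "czero ccopy = ccode (czero B)"
  "\<lbrakk>x \<in> gen_closure g; y \<in> gen_closure g\<rbrakk> \<Longrightarrow> cadd ccopy (ccode x) (ccode y) = ccode (cadd B x y)"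
  "\<lbrakk>x \<in> gen_closure g; y \<in> gen_closure g\<rbrakk> \<Longrightarrow> cmult ccopy (ccode x) (ccode y) = ccode (cmult B x y)"
  "x \<in> gen_closure g \<Longrightarrow> cscale ccopy c (ccode x) = ccode (cscale B c x)"
  "x \<in> gen_closure g \<Longrightarrow> cadj ccopy (ccode x) = ccode (cadj B x)"
  "x \<in> gen_closure g \<Longrightarrow> cnorm ccopy (ccode x) = cnorm B x"
  by (simp_all add: ccopy_def decode Let_def)

lemma copy_cdist: "\<lbrakk>x \<in> gen_closure g; y \<in> gen_closure g\<rbrakk> \<Longrightarrow> cdist ccopy (ccode x) (ccode y) = cdist B x y"
  by (simp add: cdist_def copy_ops gen_closure_ops)

lemma code_eq: "\<lbrakk>x \<in> gen_closure g; y \<in> gen_closure g\<rbrakk> \<Longrightarrow> ccode x = ccode y \<longleftrightarrow> x = y"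
  using inj_code by (auto dest: inj_onD)

lemma cstar_structure_copy: "cstar_structure ccopy"
proof -
  have ex: "\<exists>y\<in>gen_closure g. ccode (cadd B y x) = ccode (czero B)" if "x \<in> gen_closure g" for x
    using that
    by (intro bexI[of _ "cscale B (- 1) x"])
      (auto simp: cadd_neg cadd_commute closed gen_closure_carrier gen_closure_ops)
  have grp: "comm_group (add_group ccopy)"
  proof (rule comm_groupI, goal_cases)
    case (6 x) then show ?case using ex by (auto simp: add_group_def copy_ops)
  next
    case (5 x) then show ?case
      by (auto simp: add_group_def copy_ops gen_closure_ops
          cadd_commute[of "czero B"] cadd_czero gen_closure_carrier closed)
  next
    case (4 x y) then show ?case
      by (auto simp: add_group_def copy_ops cadd_commute gen_closure_carrier)
  qed (auto simp: add_group_def copy_ops gen_closure_ops cadd_assoc gen_closure_carrier)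
  show ?thesis
  proof (rule cstar_structure.intro, goal_cases)
    case 1 show ?case by (rule grp)
  next
    case (23 u)
    obtain v where v: "\<And>n. v n \<in> gen_closure g" "\<And>n. u n = ccode (v n)"
      using 23(1) by (simp add: copy_ops image_iff) metis
    have "\<exists>x\<in>carrier B. (\<lambda>n. cdist B (v n) x) \<longlonglongrightarrow> 0"
      using v 23(2) by (intro complete) (auto simp: copy_cdist gen_closure_carrier)
    then obtain x where x: "x \<in> carrier B" "(\<lambda>n. cdist B (v n) x) \<longlonglongrightarrow> 0" by blast
    then have "x \<in> gen_closure g" using v gen_closure_limit by blast
    then show ?case using x v by (auto simp: copy_ops copy_cdist)
  next
    case (8 x c d) then show ?case
      by (auto simp: copy_ops gen_closure_ops gen_closure_carrier cscale_cadd_left)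
  next
    case (18 x) then show ?case
      by (auto simp: copy_ops gen_closure_ops gen_closure_carrier cnorm_eq_0 code_eq)
  qed (auto simp: copy_ops gen_closure_ops gen_closure_carrier cmult_assoc cmult_cadd_left
      cmult_cadd_right cscale_cadd_right cscale_cscale cscale_one cmult_cscale_left
      cmult_cscale_right cadj_cadj cadj_cadd cadj_cscale cadj_cmult cnorm_cadd cnorm_cscale
      cnorm_cmult cnorm_cadj_cmult)
qed

lemma gen_closure_finprod:
  assumes "finite I" "\<And>i. i \<in> I \<Longrightarrow> f i \<in> gen_closure g"
  shows "finprod (add_group B) f I \<in> gen_closure g \<and>
    finprod (add_group ccopy) (\<lambda>i. ccode (f i)) I = ccode (finprod (add_group B) f I)"
proof -
  interpret G: comm_group "add_group B" by (rule add_group)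
  interpret C: comm_group "add_group ccopy" by (rule cstar_structure.add_group[OF cstar_structure_copy])
  show ?thesis using assms
  proof (induction I rule: finite_induct)
    case empty
    have "finprod (add_group B) f {} = czero B" "finprod (add_group ccopy) (\<lambda>i. ccode (f i)) {} = czero ccopy"
      unfolding G.finprod_empty C.finprod_empty by (simp_all add: add_group_def)
    then show ?case by (simp add: gen_closure_czero copy_ops)
  next
    case (insert i I)
    have f: "f \<in> I \<rightarrow> carrier (add_group B)" "f i \<in> carrier (add_group B)"
      using insert.prems gen_closure_carrier by (auto simp: add_group_def)
    have cf: "(\<lambda>i. ccode (f i)) \<in> I \<rightarrow> carrier (add_group ccopy)" "ccode (f i) \<in> carrier (add_group ccopy)"
      using insert.prems by (auto simp: add_group_def copy_ops)
    have m: "x \<otimes>\<^bsub>add_group B\<^esub> y = cadd B x y" "u \<otimes>\<^bsub>add_group ccopy\<^esub> v = cadd ccopy u v" for x y u v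
      by (auto simp: add_group_def)
    show ?case
      unfolding G.finprod_insert[OF insert.hyps(1,2) f] C.finprod_insert[OF insert.hyps(1,2) cf] m
      using insert by (simp add: copy_ops gen_closure_cadd)
  qed
qed

lemma CK_family_copy:
  assumes E: "fin_digraph E" and CK: "CK_family E B Q T"
    and Q: "\<And>v. v \<in> verts E \<Longrightarrow> Q v \<in> range g" and T: "\<And>e. e \<in> arcs E \<Longrightarrow> T e \<in> range g"
  shows "CK_family E ccopy (\<lambda>v. ccode (Q v)) (\<lambda>e. ccode (T e))"
proof -
  interpret E: fin_digraph E by (rule E)
  have q: "v \<in> verts E \<Longrightarrow> Q v \<in> gen_closure g" for v using Q gen_closure_gen by force
  have t: "e \<in> arcs E \<Longrightarrow> T e \<in> gen_closure g" for e using T gen_closure_gen by force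
  have le: "cle ccopy (ccode (cmult B (T e) (cadj B (T e)))) (ccode (Q (tail E e)))"
    if e: "e \<in> arcs E" for e
  proof -
    let ?s = "cmult B (T e) (cadj B (T e))" and ?p = "Q (tail E e)"
    let ?b = "cadd B ?p (cscale B (- 1) ?s)"
    have m: "?p \<in> gen_closure g" "?s \<in> gen_closure g" "?b \<in> gen_closure g"
      using e q t by (auto simp: gen_closure_ops)
    have "?p = cadd B ?s (cmult B (cadj B ?b) ?b)" by (rule CK_difference[OF E CK e])
    then have "ccode ?p = cadd ccopy (ccode ?s) (cmult ccopy (cadj ccopy (ccode ?b)) (ccode ?b))"
      using m by (simp add: copy_ops gen_closure_ops)
    then show ?thesis unfolding cle_def using m(3) by (auto simp: copy_ops)
  qed
  have sum: "finprod (add_group ccopy) (\<lambda>e. cmult ccopy (ccode (T e)) (cadj ccopy (ccode (T e)))) F =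
      ccode (finprod (add_group B) (\<lambda>e. cmult B (T e) (cadj B (T e))) F)"
    if F: "finite F" "F \<subseteq> arcs E" for F
  proof -
    interpret C: comm_group "add_group ccopy"
      by (rule cstar_structure.add_group[OF cstar_structure_copy])
    have "finprod (add_group ccopy) (\<lambda>e. cmult ccopy (ccode (T e)) (cadj ccopy (ccode (T e)))) F =
      finprod (add_group ccopy) (\<lambda>e. ccode (cmult B (T e) (cadj B (T e)))) F"
      using F(2) t by (intro C.finprod_cong')
        (auto simp: copy_ops gen_closure_ops add_group_def subset_eq)
    moreover have "i \<in> F \<Longrightarrow> cmult B (T i) (cadj B (T i)) \<in> gen_closure g" for i
      using F t by (auto simp: gen_closure_ops)
    ultimately show ?thesis
      using gen_closure_finprod[OF F(1), of "\<lambda>e. cmult B (T e) (cadj B (T e))"] by simp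
  qed
  have out: "out_arcs E v \<subseteq> arcs E" for v by (auto simp: out_arcs_def)
  show ?thesis
    using CK le out unfolding CK_family_def
    by (simp add: projection_def partial_isometry_def copy_ops q t gen_closure_ops sum)
qed

lemma ccode_hom:
  assumes A: "cstar_structure A" and assms: "star_hom A ccopy \<phi>"
  shows "\<exists>\<psi>. star_hom A B \<psi> \<and>
    (\<forall>x\<in>carrier A. \<psi> x \<in> gen_closure g \<and> \<phi> x = ccode (\<psi> x))"
proof -
  have "\<forall>x\<in>carrier A. \<exists>y. y \<in> gen_closure g \<and> \<phi> x = ccode y"
    using assms by (auto simp: star_hom_def copy_ops)
  then obtain \<psi> where p: "\<And>x. x \<in> carrier A \<Longrightarrow> \<psi> x \<in> gen_closure g"
      "\<And>x. x \<in> carrier A \<Longrightarrow> \<phi> x = ccode (\<psi> x)"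
    by metis
  have h: "\<And>x y. \<lbrakk>x \<in> carrier A; y \<in> carrier A\<rbrakk> \<Longrightarrow> \<phi> (cadd A x y) = cadd ccopy (\<phi> x) (\<phi> y)"
    "\<And>x y. \<lbrakk>x \<in> carrier A; y \<in> carrier A\<rbrakk> \<Longrightarrow> \<phi> (cmult A x y) = cmult ccopy (\<phi> x) (\<phi> y)"
    "\<And>c x. x \<in> carrier A \<Longrightarrow> \<phi> (cscale A c x) = cscale ccopy c (\<phi> x)"
    "\<And>x. x \<in> carrier A \<Longrightarrow> \<phi> (cadj A x) = cadj ccopy (\<phi> x)"
    using assms by (auto simp: star_hom_def)
  have "star_hom A B \<psi>"
    unfolding star_hom_def
  proof (intro conjI ballI allI)
    show "\<psi> \<in> carrier A \<rightarrow> carrier B" using p(1) gen_closure_carrier by auto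
  next
    fix x y assume xy: "x \<in> carrier A" "y \<in> carrier A"
    have c: "cadd A x y \<in> carrier A" "cmult A x y \<in> carrier A"
      using A xy by (auto simp: cstar_structure.cadd_closed cstar_structure.cmult_closed)
    have "ccode (\<psi> (cadd A x y)) = ccode (cadd B (\<psi> x) (\<psi> y))"
      using h(1) xy c by (simp add: p(2)[symmetric]) (simp add: p copy_ops)
    then show "\<psi> (cadd A x y) = cadd B (\<psi> x) (\<psi> y)"
      using p xy c by (simp add: code_eq gen_closure_ops)
    have "ccode (\<psi> (cmult A x y)) = ccode (cmult B (\<psi> x) (\<psi> y))"
      using h(2) xy c by (simp add: p(2)[symmetric]) (simp add: p copy_ops)
    then show "\<psi> (cmult A x y) = cmult B (\<psi> x) (\<psi> y)"
      using p xy c by (simp add: code_eq gen_closure_ops)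
  next
    fix x k assume x: "x \<in> carrier A"
    have c: "cscale A k x \<in> carrier A" "cadj A x \<in> carrier A"
      using A x by (auto simp: cstar_structure.cscale_closed cstar_structure.cadj_closed)
    have "ccode (\<psi> (cscale A k x)) = ccode (cscale B k (\<psi> x))"
      using h(3) x c by (simp add: p(2)[symmetric]) (simp add: p copy_ops)
    then show "\<psi> (cscale A k x) = cscale B k (\<psi> x)"
      using p x c by (simp add: code_eq gen_closure_ops)
    have "ccode (\<psi> (cadj A x)) = ccode (cadj B (\<psi> x))"
      using h(4) x c by (simp add: p(2)[symmetric]) (simp add: p copy_ops)
    then show "\<psi> (cadj A x) = cadj B (\<psi> x)"
      using p x c by (simp add: code_eq gen_closure_ops)
  qed
  then show ?thesis using p by blast
qed

end
end

text \<open>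
  For a finite graph, the universal property holds with test algebras over an arbitrary type.
\<close>

lemma graph_cstar_algebra_universal:
  fixes C :: "'b cstar_struct"
    and P :: "'v \<Rightarrow> 'a::cstar_algebra" and S :: "'e \<Rightarrow> 'a"
  assumes E: "fin_digraph E" and U: "graph_cstar_algebra E P S"
    and C: "cstar_structure C" and CK: "CK_family E C Q T"
  shows "\<exists>\<phi>. star_hom type_struct C \<phi> \<and> (\<forall>v\<in>verts E. \<phi> (P v) = Q v) \<and>
    (\<forall>e\<in>arcs E. \<phi> (S e) = T e)"
proof -
  interpret E: fin_digraph E by (rule E)
  interpret C: cstar_structure C by (rule C)
  define X where "X = insert (czero C) (Q ` verts E \<union> T ` arcs E)"
  define g where "g = from_nat_into X"
  have r: "range g = X" unfolding g_def by (rule range_from_nat_into) (auto simp: X_def countable_finite)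
  have g: "range g \<subseteq> carrier C"
    unfolding r X_def using CK C.czero_closed
    by (auto simp: CK_family_def projection_def partial_isometry_def)
  have QT: "v \<in> verts E \<Longrightarrow> Q v \<in> range g" "e \<in> arcs E \<Longrightarrow> T e \<in> range g" for v e
    by (auto simp: r X_def)
  have cl: "v \<in> verts E \<Longrightarrow> Q v \<in> C.gen_closure g" "e \<in> arcs E \<Longrightarrow> T e \<in> C.gen_closure g" for v e
    using QT C.gen_closure_gen[OF g] by force+
  obtain \<phi> where \<phi>: "star_hom type_struct (C.ccopy g) \<phi>"
      "\<And>v. v \<in> verts E \<Longrightarrow> \<phi> (P v) = C.ccode g (Q v)"
      "\<And>e. e \<in> arcs E \<Longrightarrow> \<phi> (S e) = C.ccode g (T e)"
    using U[unfolded graph_cstar_algebra_def, THEN conjunct2, THEN conjunct2, rule_format,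
        OF conjI, OF C.cstar_structure_copy[OF g] C.CK_family_copy[OF g E CK QT]] by blast
  obtain \<psi> where "star_hom type_struct C \<psi>"
      "\<And>x::'a. \<psi> x \<in> C.gen_closure g \<and> \<phi> x = C.ccode g (\<psi> x)"
    using C.ccode_hom[OF g cstar_structure_type_struct \<phi>(1)] by (auto simp: type_struct_def)
  then show ?thesis using \<phi>(2,3) C.code_eq[OF g _ cl(1)] C.code_eq[OF g _ cl(2)]
    by (intro exI[of _ \<psi>]) simp
qed

end

theory Submission
  imports Defs "HOL-Library.Sublist" "HOL-Computational_Algebra.Polynomial"
begin

text \<open>
  Write \<open>D\<close> for the diagonal.  The heart of the matter is that \<open>D\<close> is maximal abelian: an element
  commuting with \<open>D\<close> lies in \<open>D\<close> (\<open>diagonal_maximal_abelian\<close>).  For a path projection \<open>q\<close>, conjugation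
  by the unitary \<open>1 - q + \<i> q\<close> fixes \<open>D\<close> pointwise, because \<open>D\<close> is commutative, and an element that is
  fixed by all these conjugations commutes with \<open>D\<close>.  Hence \<open>D\<close> is exactly the set of common fixed
  points of the automorphisms that fix it pointwise.  An automorphism normalizing a group permutes the
  common fixed points of that group, which gives the statement on the normalizer.

  If \<open>\<alpha>\<close> fixes \<open>D\<close>, then \<open>\<alpha>(S\<^sub>e) S\<^sub>e\<^sup>*\<close> commutes with \<open>D\<close>, so \<open>\<alpha>\<close> multiplies every \<open>S\<^sub>e\<close> by an element
  of \<open>D\<close>, and two such automorphisms commute.  If \<open>\<beta>\<close> commutes with all the conjugations by
  \<open>w = 1 - q + \<i> q\<close>, then \<open>w\<^sup>* \<beta>(w)\<close> is central, so \<open>\<beta>(w) = c w\<close> for a scalar \<open>c\<close> when the center is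
  trivial.  If \<open>q\<close> is not \<open>0\<close> or \<open>1\<close>, then \<open>w\<close> has spectrum \<open>{1, \<i>}\<close>, which multiplication by \<open>c \<noteq> 1\<close>
  does not map to itself.  Hence \<open>c = 1\<close>, and \<open>\<beta>\<close> fixes \<open>q\<close>.

  For the maximality of \<open>D\<close>, let \<open>y\<close> commute with \<open>D\<close>, and approximate \<open>y\<close> up to \<open>\<epsilon>\<close> by a finite
  combination of elements \<open>S\<^sub>\<mu> S\<^sub>\<nu>\<^sup>*\<close>.  Compression with \<open>S\<^sub>\<lambda>\<close>, for a path \<open>\<lambda>\<close> at least twice as long as
  all \<open>\<mu>\<close> and \<open>\<nu>\<close>, turns \<open>S\<^sub>\<mu> S\<^sub>\<nu>\<^sup>*\<close> into \<open>0\<close>, a vertex projection, or some \<open>S\<^sub>\<kappa>\<close> or \<open>S\<^sub>\<kappa>\<^sup>*\<close>, where \<open>\<kappa>\<close>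
  is a loop whose length is a period of the end of \<open>\<lambda>\<close>.  Such loops commute as words, so they are
  powers of one loop \<open>\<rho>\<close>, and \<open>S\<^sub>\<lambda>\<^sup>* y S\<^sub>\<lambda>\<close> is within \<open>\<epsilon>\<close> of a scalar plus a combination \<open>z\<close> of
  powers \<open>W\<^sup>k\<close> and \<open>W\<^sup>*\<^sup>k\<close> with \<open>k \<ge> 1\<close>, where \<open>W = S\<^sub>\<rho>\<close>.  As \<open>\<rho>\<close> has an exit, \<open>W\<close> is a proper
  isometry of its corner.  The compression of \<open>y\<close> commutes with the projections
  \<open>W\<^sup>k W\<^sup>*\<^sup>k - W\<^sup>k\<^sup>+\<^sup>1 W\<^sup>*\<^sup>k\<^sup>+\<^sup>1\<close>, and the diagonal entries of \<open>z\<close> with respect to these vanish, so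
  \<open>z\<close> is small on each finite truncation.  It is then small altogether (\<open>norm_offdiag_le\<close>), because for
  a proper isometry the Toeplitz representation determines the norm.  Hence \<open>S\<^sub>\<lambda>\<^sup>* y S\<^sub>\<lambda>\<close> is close to a
  scalar \<open>t\<^sub>\<lambda>\<close> and \<open>y\<close> is close to \<open>\<Sum>\<^sub>\<lambda> t\<^sub>\<lambda> P\<^sub>\<lambda>\<close>.

  Norms of sums are estimated throughout by repeated squaring: \<open>\<parallel>z\<parallel>\<close> to the power \<open>2\<^sup>k\<^sup>+\<^sup>1\<close> is the
  norm of the \<open>2\<^sup>k\<close>-th power of \<open>z\<^sup>* z\<close>, so a factor growing linearly in \<open>2\<^sup>k\<close> is harmless.

  That an exit makes \<open>W\<close> proper rests on all vertex projections of \<open>C\<^sup>*(E)\<close> being nonzero.  This is where the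
  universal property enters: the operators that shift infinite paths form a family on a Hilbert space
  whose vertex projections are nonzero.
\<close>

section \<open>Norm estimates in C*-algebras\<close>

lemma scaleC_0_left [simp]: "0 *\<^sub>C x = (0::'a::cstar_algebra)"
  using scaleR_scaleC[of 0 x] by simp

lemma scaleC_1 [simp]: "1 *\<^sub>C x = (x::'a::cstar_algebra)"
  using scaleR_scaleC[of 1 x] by simp

lemma scaleC_0_right [simp]: "c *\<^sub>C 0 = (0::'a::cstar_algebra)"
  using scaleC_scaleC[of c 0 0] by simp

lemma scaleC_minus_left: "(- c) *\<^sub>C x = - (c *\<^sub>C x)" for x :: "'a::cstar_algebra"
  using scaleC_add_left[of "- c" c x] by (simp add: eq_neg_iff_add_eq_0)

lemma scaleC_minus_right: "c *\<^sub>C (- x) = - (c *\<^sub>C x)" for x :: "'a::cstar_algebra"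
  using scaleC_add_right[of c "- x" x] by (simp add: eq_neg_iff_add_eq_0)

lemma scaleC_diff_right: "c *\<^sub>C (x - y) = c *\<^sub>C x - c *\<^sub>C y" for x y :: "'a::cstar_algebra"
  using scaleC_add_right[of c x "- y"] by (simp add: scaleC_minus_right)

lemma scaleC_diff_left: "(c - d) *\<^sub>C x = c *\<^sub>C x - d *\<^sub>C x" for x :: "'a::cstar_algebra"
  using scaleC_add_left[of c "- d" x] by (simp add: scaleC_minus_left)

lemma scaleC_sum_right: "c *\<^sub>C sum f I = (\<Sum>i\<in>I. c *\<^sub>C f i)" for f :: "_ \<Rightarrow> 'a::cstar_algebra"
  by (induction I rule: infinite_finite_induct) (auto simp: scaleC_add_right)

lemma scaleC_left_cancel: "c \<noteq> 0 \<Longrightarrow> c *\<^sub>C x = c *\<^sub>C y \<longleftrightarrow> x = y"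
  for x y :: "'a::cstar_algebra"
proof -
  assume "c \<noteq> 0"
  then have "inverse c *\<^sub>C c *\<^sub>C z = z" for z :: 'a by (simp add: scaleC_scaleC)
  then show ?thesis by metis
qed

lemma adj_0 [simp]: "adj 0 = (0::'a::cstar_algebra)"
  using adj_scaleC[of 0 "0::'a"] by simp

lemma adj_minus: "adj (- x) = - adj x" for x :: "'a::cstar_algebra"
  using adj_add[of "- x" x] by (simp add: eq_neg_iff_add_eq_0)

lemma adj_diff: "adj (x - y) = adj x - adj y" for x y :: "'a::cstar_algebra"
  using adj_add[of x "- y"] by (simp add: adj_minus)

lemma adj_sum: "adj (sum f I) = (\<Sum>i\<in>I. adj (f i))" for f :: "_ \<Rightarrow> 'a::cstar_algebra"
  by (induction I rule: infinite_finite_induct) (auto simp: adj_add)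

lemma adj_scaleR: "adj (r *\<^sub>R x) = r *\<^sub>R adj x" for x :: "'a::cstar_algebra"
  by (simp add: scaleR_scaleC adj_scaleC)

lemma scaleC_scaleR_commute: "c *\<^sub>C r *\<^sub>R x = r *\<^sub>R c *\<^sub>C x" for x :: "'a::cstar_algebra"
  by (simp add: scaleR_scaleC scaleC_scaleC mult.commute)

declare adj_adj [simp]

lemma norm_adj [simp]: "norm (adj x) = norm (x::'a::cstar_algebra)"
proof -
  interpret cstar_structure "type_struct :: 'a cstar_struct" by (rule cstar_structure_type_struct)
  show ?thesis using cnorm_cadj[of x] by (simp add: type_struct_def)
qed

lemma bounded_linear_adj: "bounded_linear (adj :: 'a::cstar_algebra \<Rightarrow> 'a)"
  by (rule bounded_linear_intro[of _ 1]) (simp_all add: adj_add adj_scaleR)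

lemma bounded_linear_scaleC: "bounded_linear (\<lambda>x::'a::cstar_algebra. c *\<^sub>C x)"
  by (rule bounded_linear_intro[of _ "cmod c"])
    (simp_all add: scaleC_add_right scaleC_scaleR_commute norm_scaleC mult.commute)

lemma norm_projection_le_1: 
  fixes p :: "'a::cstar_algebra" assumes "adj p = p" "p * p = p" shows "norm p \<le> 1"
  using norm_adj_mult[of p] assms by (auto simp: power2_eq_square)

lemma norm_projection_eq_1: 
  fixes p :: "'a::cstar_algebra" assumes "adj p = p" "p * p = p" "p \<noteq> 0" shows "norm p = 1"
  using norm_adj_mult[of p] assms by (simp add: power2_eq_square)

text \<open>Iterated squaring replaces powers, since there need not be a unit.\<close>

definition square_iter :: "nat \<Rightarrow> 'a::cstar_algebra \<Rightarrow> 'a" where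
  "square_iter k = ((\<lambda>y. y * y) ^^ k)"

lemma square_iter_simps [simp]:
  "square_iter 0 x = x" "square_iter (Suc k) x = square_iter k x * square_iter k x"
  by (simp_all add: square_iter_def)

lemma adj_square_iter: "adj h = h \<Longrightarrow> adj (square_iter k h) = square_iter k h"
  by (induction k) (auto simp: adj_mult)

lemma norm_square_iter: "adj h = h \<Longrightarrow> norm (square_iter k h) = norm h ^ 2 ^ k"
proof (induction k)
  case (Suc k)
  have "norm (square_iter (Suc k) h) = (norm (square_iter k h))\<^sup>2"
    using norm_adj_mult[of "square_iter k h"] Suc by (simp add: adj_square_iter)
  then show ?case using Suc by (simp add: power_mult[symmetric] mult.commute)
qed auto

text \<open>Powers outgrow linear factors, so such factors drop out of an estimate between the \<open>2\<^sup>k\<close>-th powers of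
  two numbers.  This is the spectral radius argument behind all norm bounds below.\<close>

lemma le_if_power_le_linear_growth:
  fixes a b C D :: real
  assumes b: "0 < b" and le: "\<And>k. a ^ 2 ^ k \<le> (C * 2 ^ k + D) * b ^ 2 ^ k"
  shows "a \<le> b"
proof (rule ccontr)
  assume "\<not> a \<le> b"
  then have r: "1 < a / b" (is "1 < ?r") using b by simp
  have sub: "filterlim (\<lambda>k. (2::nat) ^ k) sequentially sequentially"
    by (rule filterlim_subseq) (auto simp: strict_mono_def)
  have "(\<lambda>n. of_nat n / ?r ^ n) \<longlonglongrightarrow> 0" using r by (intro lim_n_over_pown) (simp only: real_norm_def abs_if, simp)
  moreover have "(\<lambda>n. inverse (?r ^ n)) \<longlonglongrightarrow> 0" using r by (rule LIMSEQ_inverse_realpow_zero)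
  ultimately have "(\<lambda>n. C * (of_nat n / ?r ^ n) + D * inverse (?r ^ n)) \<longlonglongrightarrow> C * 0 + D * 0"
    by (intro tendsto_intros)
  from filterlim_compose[OF this sub]
  have "(\<lambda>k. C * (real (2 ^ k) / ?r ^ 2 ^ k) + D * inverse (?r ^ 2 ^ k)) \<longlonglongrightarrow> 0" by simp
  then have "eventually (\<lambda>k. C * (real (2 ^ k) / ?r ^ 2 ^ k) + D * inverse (?r ^ 2 ^ k) < 1) sequentially"
    by (rule order_tendstoD) simp
  then obtain k where k: "C * (real (2 ^ k) / ?r ^ 2 ^ k) + D * inverse (?r ^ 2 ^ k) < 1"
    by (auto simp: eventually_sequentially)
  have "C * (real (2 ^ k) / ?r ^ 2 ^ k) + D * inverse (?r ^ 2 ^ k) = (C * 2 ^ k + D) / ?r ^ 2 ^ k"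
    by (simp add: divide_inverse distrib_right)
  with k have "C * 2 ^ k + D < ?r ^ 2 ^ k" using r by (simp add: pos_divide_less_eq)
  then have "(C * 2 ^ k + D) * b ^ 2 ^ k < a ^ 2 ^ k" using b by (simp add: power_divide field_simps)
  then show False using le[of k] by simp
qed

lemma sum_mult_orthogonal:
  fixes x y :: "'i \<Rightarrow> 'a::cstar_algebra"
  assumes "finite I" "\<And>i j. \<lbrakk>i \<in> I; j \<in> I; i \<noteq> j\<rbrakk> \<Longrightarrow> x i * y j = 0"
  shows "(\<Sum>i\<in>I. x i) * (\<Sum>i\<in>I. y i) = (\<Sum>i\<in>I. x i * y i)"
  unfolding sum_product
proof (rule sum.cong)
  fix i assume i: "i \<in> I"
  have "(\<Sum>j\<in>I. x i * y j) = x i * y i + (\<Sum>j\<in>I - {i}. x i * y j)"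
    by (rule sum.remove[OF assms(1) i])
  also have "(\<Sum>j\<in>I - {i}. x i * y j) = 0"
    using i assms(2) by (intro sum.neutral) blast
  finally show "(\<Sum>j\<in>I. x i * y j) = x i * y i" by simp
qed simp

text \<open>Squaring \<open>x\<^sup>* x\<close> for an orthogonal sum \<open>x\<close> acts termwise, so the \<open>2\<^sup>k\<close>-th powers of both sides differ
  at most by the number of terms.\<close>

lemma norm_sum_orthogonal_le:
  fixes x :: "'i \<Rightarrow> 'a::cstar_algebra"
  assumes I: "finite I" and b: "0 < b" and le: "\<And>i. i \<in> I \<Longrightarrow> norm (x i) \<le> b"
    and o1: "\<And>i j. \<lbrakk>i \<in> I; j \<in> I; i \<noteq> j\<rbrakk> \<Longrightarrow> adj (x i) * x j = 0"
    and o2: "\<And>i j. \<lbrakk>i \<in> I; j \<in> I; i \<noteq> j\<rbrakk> \<Longrightarrow> x i * adj (x j) = 0"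
  shows "norm (\<Sum>i\<in>I. x i) \<le> b"
proof -
  define y where "y = (\<Sum>i\<in>I. x i)"
  define h where "h i = adj (x i) * x i" for i
  have y: "adj y * y = (\<Sum>i\<in>I. h i)"
    unfolding y_def h_def adj_sum using I o1 by (intro sum_mult_orthogonal) auto
  have hh: "h i * h j = 0" if "i \<in> I" "j \<in> I" "i \<noteq> j" for i j
    using o2[of i j] that unfolding h_def by (metis mult.assoc mult_zero_left mult_zero_right)
  have sq0: "square_iter k (h i) * square_iter k (h j) = 0" if "i \<in> I" "j \<in> I" "i \<noteq> j" for i j k
  proof (induction k)
    case (Suc k)
    have "square_iter (Suc k) (h i) * square_iter (Suc k) (h j) =
      square_iter k (h i) * (square_iter k (h i) * square_iter k (h j)) * square_iter k (h j)"
      by (simp add: mult.assoc)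
    then show ?case using Suc by simp
  qed (use that hh in auto)
  have sq: "square_iter k (\<Sum>i\<in>I. h i) = (\<Sum>i\<in>I. square_iter k (h i))" for k
    by (induction k) (auto simp: sum_mult_orthogonal[OF I sq0])
  have sa: "adj (h i) = h i" for i by (simp add: h_def adj_mult)
  have "((norm y)\<^sup>2) ^ 2 ^ k \<le> (0 * 2 ^ k + card I) * (b\<^sup>2) ^ 2 ^ k" for k
  proof -
    have "((norm y)\<^sup>2) ^ 2 ^ k = norm (square_iter k (adj y * y))"
      by (simp add: norm_square_iter adj_mult norm_adj_mult)
    also have "\<dots> \<le> (\<Sum>i\<in>I. norm (square_iter k (h i)))" unfolding y sq by (rule norm_sum)
    also have "\<dots> = (\<Sum>i\<in>I. ((norm (x i))\<^sup>2) ^ 2 ^ k)"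
      by (simp add: norm_square_iter sa) (simp add: h_def norm_adj_mult)
    also have "\<dots> \<le> (\<Sum>i\<in>I. (b\<^sup>2) ^ 2 ^ k)" using le by (intro sum_mono power_mono) auto
    finally show ?thesis by simp
  qed
  then have "(norm y)\<^sup>2 \<le> b\<^sup>2" using b by (intro le_if_power_le_linear_growth[of "b\<^sup>2" _ 0 "card I"]) auto
  then show ?thesis using b by (simp add: y_def power2_le_iff_abs_le)
qed

lemma sum_in_cstar_subalgebra:
  "cstar_subalgebra X \<Longrightarrow> (\<And>i. i \<in> I \<Longrightarrow> f i \<in> X) \<Longrightarrow> sum f I \<in> X"
  by (induction I rule: infinite_finite_induct) (auto simp: cstar_subalgebra_def)

lemma subset_cstar_generated: "G \<subseteq> cstar_generated G"
  by (simp add: cstar_generated_def hull_subset)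

lemma cstar_generated_minimal: "G \<subseteq> X \<Longrightarrow> cstar_subalgebra X \<Longrightarrow> cstar_generated G \<subseteq> X"
  by (simp add: cstar_generated_def hull_minimal)

lemma cstar_subalgebra_Inter:
  "(\<And>X. X \<in> F \<Longrightarrow> cstar_subalgebra X) \<Longrightarrow> cstar_subalgebra (\<Inter>F)"
  unfolding cstar_subalgebra_def by (auto intro: closed_Inter)

lemma cstar_subalgebra_generated: "cstar_subalgebra (cstar_generated G)"
  unfolding cstar_generated_def by (rule hull_in, rule cstar_subalgebra_Inter) blast

lemma cstar_subalgebra_commutant:
  fixes G :: "'a::cstar_algebra set"
  assumes G: "\<And>g. g \<in> G \<Longrightarrow> adj g \<in> G"
  shows "cstar_subalgebra {x. \<forall>g\<in>G. x * g = g * x}"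
proof -
  have "closed {x. x * g = g * x}" for g :: 'a
    by (intro closed_Collect_eq continuous_intros)
  then have "closed (\<Inter>g\<in>G. {x. x * g = g * x})" by (intro closed_INT) auto
  moreover have "(\<Inter>g\<in>G. {x. x * g = g * x}) = {x. \<forall>g\<in>G. x * g = g * x}" by auto
  ultimately have cl: "closed {x. \<forall>g\<in>G. x * g = g * x}" by simp
  have ad: "adj x * g = g * adj x" if "x * adj g = adj g * x" for x g :: 'a
    using arg_cong[OF that, of adj] by (simp add: adj_mult)
  have mu: "x * y * g = g * (x * y)" if "x * g = g * x" "y * g = g * y" for x y g :: 'a
  proof -
    have "x * y * g = x * g * y" using that(2) by (simp add: mult.assoc)
    then show ?thesis using that(1) by (simp add: mult.assoc)
  qed
  show ?thesis unfolding cstar_subalgebra_def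
  proof (intro conjI ballI allI)
    fix x assume x: "x \<in> {x. \<forall>g\<in>G. x * g = g * x}"
    show "adj x \<in> {x. \<forall>g\<in>G. x * g = g * x}" using x G by (intro CollectI ballI ad) blast
    fix c show "c *\<^sub>C x \<in> {x. \<forall>g\<in>G. x * g = g * x}"
      using x by (auto simp: mult_scaleC_left mult_scaleC_right)
    fix y assume y: "y \<in> {x. \<forall>g\<in>G. x * g = g * x}"
    show "x + y \<in> {x. \<forall>g\<in>G. x * g = g * x}" using x y by (auto simp: distrib_left distrib_right)
    show "x * y \<in> {x. \<forall>g\<in>G. x * g = g * x}" using x y by (intro CollectI ballI mu) blast+
  qed (use cl in auto)
qed

section \<open>Automorphisms\<close>

lemma star_hom_type_struct:
  "star_hom type_struct type_struct \<alpha> \<longleftrightarrow> (\<forall>x y. \<alpha> (x + y) = \<alpha> x + \<alpha> y) \<and>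
     (\<forall>x y. \<alpha> (x * y) = \<alpha> x * \<alpha> y) \<and> (\<forall>c x. \<alpha> (c *\<^sub>C x) = c *\<^sub>C \<alpha> x) \<and> (\<forall>x. \<alpha> (adj x) = adj (\<alpha> x))"
  for \<alpha> :: "'a::cstar_algebra \<Rightarrow> 'b::cstar_algebra"
  by (auto simp: star_hom_def type_struct_def)

locale star_aut =
  fixes \<alpha> :: "'a::cstar_algebra \<Rightarrow> 'a"
  assumes bij: "bij \<alpha>"
    and add: "\<alpha> (x + y) = \<alpha> x + \<alpha> y"
    and mult: "\<alpha> (x * y) = \<alpha> x * \<alpha> y"
    and scaleC: "\<alpha> (c *\<^sub>C x) = c *\<^sub>C \<alpha> x"
    and adj: "\<alpha> (adj x) = adj (\<alpha> x)"
begin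

lemma zero [simp]: "\<alpha> 0 = 0" using scaleC[of 0 0] by simp

lemma minus: "\<alpha> (- x) = - \<alpha> x"
  using scaleC[of "-1" x] by (simp add: scaleC_minus_left)

lemma diff: "\<alpha> (x - y) = \<alpha> x - \<alpha> y" using add[of x "- y"] by (simp add: minus)

lemma scaleR: "\<alpha> (r *\<^sub>R x) = r *\<^sub>R \<alpha> x" by (simp add: scaleR_scaleC scaleC)

lemma surjE: obtains y where "x = \<alpha> y" using bij_is_surj[OF bij] unfolding surj_def by blast

end

lemma cstar_Aut_iff: "\<alpha> \<in> carrier cstar_Aut \<longleftrightarrow> star_aut \<alpha>"
  by (auto simp: cstar_Aut_def star_hom_type_struct star_aut_def)

text \<open>The element \<open>1 - s\<close> is a square root of \<open>1 - h\<^sup>2\<close>.  The stated equation avoids the unit and makes \<open>s\<close>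
  the fixed point of \<open>s \<mapsto> (h\<^sup>2 + s\<^sup>2) / 2\<close>, which is a contraction of the ball of radius \<open>1 / 2\<close>.\<close>

lemma sqrt_one_minus_square:
  fixes h :: "'a::cstar_algebra"
  assumes h: "norm h \<le> 1 / 2" "adj h = h"
  obtains s where "adj s = s" "s * h = h * s" "2 *\<^sub>R s = h * h + s * s"
proof -
  define X where "X = {s. norm s \<le> 1 / 2 \<and> adj s = s \<and> s * h = h * s}"
  define f where "f s = (1 / 2) *\<^sub>R (h * h + s * s)" for s
  have hh: "norm (h * h) \<le> 1 / 4"
    using norm_mult_ineq[of h h] mult_mono[OF h(1) h(1)] by simp
  have "closed X" unfolding X_def
    by (intro closed_Collect_conj closed_Collect_le closed_Collect_eq continuous_intros
        linear_continuous_on bounded_linear_adj)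
  then have "complete X" by (simp add: complete_eq_closed)
  moreover have "X \<noteq> {}" by (auto simp: X_def intro!: exI[of _ 0])
  moreover have "f ` X \<subseteq> X"
  proof (rule image_subsetI)
    fix s assume s: "s \<in> X"
    then have "norm (s * s) \<le> 1 / 4"
      using norm_mult_ineq[of s s] mult_mono[of "norm s" "1/2" "norm s" "1/2"] by (simp add: X_def)
    then have "norm (h * h + s * s) \<le> 1 / 2" using norm_triangle_ineq[of "h * h" "s * s"] hh by simp
    then have "norm (f s) \<le> 1 / 2" by (simp add: f_def)
    moreover have "f s * h = h * f s"
    proof -
      have c: "s * h = h * s" using s by (simp add: X_def)
      have "s * s * h = s * h * s" by (metis c mult.assoc)
      also have "\<dots> = h * (s * s)" by (simp only: c mult.assoc[symmetric])
      finally show ?thesis by (simp add: f_def distrib_left distrib_right) (simp add: mult.assoc)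
    qed
    ultimately show "f s \<in> X" using s h by (simp add: X_def f_def adj_scaleR adj_add adj_mult)
  qed
  moreover have "dist (f s) (f t) \<le> 1 / 2 * dist s t" if "s \<in> X" "t \<in> X" for s t
  proof -
    have "f s - f t = (1 / 2) *\<^sub>R (s * (s - t) + (s - t) * t)"
      by (simp add: f_def algebra_simps)
    then have "norm (f s - f t) \<le> (1 / 2) * (norm (s * (s - t)) + norm ((s - t) * t))"
      using norm_triangle_ineq[of "s * (s - t)" "(s - t) * t"] by simp
    also have "\<dots> \<le> (1 / 2) * (norm s * norm (s - t) + norm (s - t) * norm t)"
      by (intro mult_left_mono add_mono norm_mult_ineq) auto
    also have "\<dots> \<le> (1 / 2) * (1/2 * norm (s - t) + norm (s - t) * (1/2))"
      using that by (intro mult_left_mono add_mono mult_mono) (auto simp: X_def)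
    finally show ?thesis by (simp add: dist_norm)
  qed
  ultimately have "\<exists>!s\<in>X. f s = s" by (intro Banach_fix[of X "1/2"]) auto
  then obtain s where "s \<in> X" "f s = s" by auto
  moreover have "2 *\<^sub>R f s = h * h + s * s" by (simp add: f_def)
  ultimately show ?thesis using that by (auto simp: X_def)
qed

text \<open>A *-homomorphism preserves algebraic identities.  So \<open>h\<^sup>2 + c\<^sup>2 = 1\<close> for commuting self-adjoint \<open>h\<close> and
  \<open>c\<close> makes \<open>\<alpha>(h) + \<i> \<alpha>(c)\<close> unitary, and \<open>\<alpha>(h)\<close> is its real part.\<close>

lemma (in star_aut) norm_selfadjoint_le_1:
  assumes u: "\<And>x::'a. u * x = x \<and> x * u = x" and h: "norm h \<le> 1 / 2" "adj h = h"
  shows "norm (\<alpha> h) \<le> 1"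
proof -
  obtain s where s: "adj s = s" "s * h = h * s" "2 *\<^sub>R s = h * h + s * s"
    using sqrt_one_minus_square[OF h] .
  have au: "adj u = u" using u[of "adj u"] u[of u] by (metis adj_adj adj_mult)
  have \<alpha>u: "\<alpha> u = u"
  proof -
    obtain y where y: "u = \<alpha> y" using surjE .
    have "\<alpha> u = \<alpha> u * \<alpha> y" using u[of "\<alpha> u"] y by simp
    also have "\<dots> = u" using u[of y] by (simp add: y mult[symmetric])
    finally show ?thesis .
  qed
  define k where "k = \<alpha> h"
  define l where "l = \<alpha> (u - s)"
  have "(u - s) * (u - s) = u - (2 *\<^sub>R s - s * s)" using u by (simp add: algebra_simps scaleR_2)
  then have c2: "h * h + (u - s) * (u - s) = u" by (simp add: s(3))
  have hc: "h * (u - s) = (u - s) * h" using u s(2) by (simp add: algebra_simps)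
  have kl: "k * k + l * l = u" using arg_cong[OF c2, of \<alpha>] by (simp add: k_def l_def add mult \<alpha>u)
  have kl': "k * l = l * k" using arg_cong[OF hc, of \<alpha>] by (simp add: k_def l_def mult)
  have sa: "adj k = k" "adj l = l" using h s au by (simp_all add: k_def l_def adj[symmetric] adj_diff)
  define w where "w = k + \<i> *\<^sub>C l"
  have aw: "adj w = k - \<i> *\<^sub>C l" using sa by (simp add: w_def adj_add adj_scaleC scaleC_minus_left)
  have "adj w * w = k * k + \<i> *\<^sub>C (k * l) - \<i> *\<^sub>C (l * k) - (\<i> * \<i>) *\<^sub>C (l * l)"
    unfolding aw by (simp add: w_def algebra_simps mult_scaleC_left mult_scaleC_right scaleC_scaleC
        scaleC_diff_right scaleC_add_right)
  then have "adj w * w = u" using kl kl' by (simp add: scaleC_minus_left)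
  then have "(norm w)\<^sup>2 = norm u" using norm_adj_mult[of w] by simp
  moreover have "norm u \<le> 1" using u au by (intro norm_projection_le_1) auto
  ultimately have w: "norm w \<le> 1" using power_le_one_iff[of "norm w" 2] by simp
  have "2 *\<^sub>R k = w + adj w" unfolding aw by (simp add: w_def scaleR_2)
  then have "norm (2 *\<^sub>R k) \<le> norm w + norm (adj w)" using norm_triangle_ineq[of w "adj w"] by simp
  then show ?thesis using w by (simp add: k_def)
qed

text \<open>Continuity makes the set where two automorphisms agree a C*-subalgebra, so that they can be compared
  on generators.\<close>

lemma (in star_aut) bounded_linear:
  assumes u: "\<And>x::'a. u * x = x \<and> x * u = x"
  shows "bounded_linear \<alpha>"
proof (rule bounded_linear_intro[of _ 2])
  fix x
  have *: "norm (\<alpha> y) \<le> 1" if "norm y \<le> 1 / 2" for y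
  proof -
    have "norm (adj y * y) \<le> 1 / 2" unfolding norm_adj_mult
      using power_mono[OF that, of 2] by (simp add: power2_eq_square)
    then have "norm (\<alpha> (adj y * y)) \<le> 1" by (rule norm_selfadjoint_le_1[OF u]) (simp add: adj_mult)
    then have "(norm (\<alpha> y))\<^sup>2 \<le> 1" by (simp add: mult adj norm_adj_mult)
    then show ?thesis using power_le_one_iff[of "norm (\<alpha> y)" 2] by simp
  qed
  show "norm (\<alpha> x) \<le> norm x * 2"
  proof (cases "x = 0")
    case False
    have "norm (\<alpha> ((1 / (2 * norm x)) *\<^sub>R x)) \<le> 1" using False by (intro *) simp
    then show ?thesis using False by (simp add: scaleR field_simps)
  qed simp
qed (simp_all add: add scaleR)

section \<open>The Hilbert space of square-summable families\<close>

typedef 'i ell2 = "{f :: 'i \<Rightarrow> complex. (\<lambda>i. (cmod (f i))\<^sup>2) summable_on UNIV}"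
  morphisms coord Abs_ell2
  by (rule exI[of _ "\<lambda>_. 0"]) simp

setup_lifting type_definition_ell2

lemma summable_inner:
  assumes "(\<lambda>i. (cmod (f i))\<^sup>2) summable_on UNIV" "(\<lambda>i. (cmod (g i))\<^sup>2) summable_on UNIV"
  shows "(\<lambda>i. inner (f i) (g i)) summable_on UNIV"
proof -
  have "(\<lambda>i. (cmod (f i))\<^sup>2 + (cmod (g i))\<^sup>2) summable_on UNIV"
    using assms by (rule summable_on_add)
  then have "(\<lambda>i. norm (inner (f i) (g i))) summable_on UNIV"
  proof (rule summable_on_comparison_test)
    fix i
    have "norm (inner (f i) (g i)) \<le> cmod (f i) * cmod (g i)" by (simp add: Cauchy_Schwarz_ineq2)
    also have "\<dots> \<le> (cmod (f i))\<^sup>2 + (cmod (g i))\<^sup>2"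
      using sum_squares_bound[of "cmod (f i)" "cmod (g i)"]
        mult_nonneg_nonneg[OF norm_ge_zero[of "f i"] norm_ge_zero[of "g i"]] by linarith
    finally show "norm (inner (f i) (g i)) \<le> (cmod (f i))\<^sup>2 + (cmod (g i))\<^sup>2" .
  qed simp
  then show ?thesis by (rule abs_summable_summable)
qed

lemma summable_square_add:
  assumes f: "(\<lambda>i. (cmod (f i))\<^sup>2) summable_on UNIV" and g: "(\<lambda>i. (cmod (g i))\<^sup>2) summable_on UNIV"
  shows "(\<lambda>i. (cmod (f i + g i))\<^sup>2) summable_on UNIV"
proof -
  have "(\<lambda>i. (cmod (f i))\<^sup>2 + (cmod (g i))\<^sup>2 + 2 * inner (f i) (g i)) summable_on UNIV"
    using f g summable_inner[OF f g] by (intro summable_on_add summable_on_cmult_right)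
  moreover have "(cmod (f i + g i))\<^sup>2 = (cmod (f i))\<^sup>2 + (cmod (g i))\<^sup>2 + 2 * inner (f i) (g i)" for i
    by (simp add: power2_norm_eq_inner inner_add_left inner_add_right inner_commute)
  ultimately show ?thesis by simp
qed

text \<open>The inner product is the real part of the complex one, so that \<open>ell2\<close> is a real Hilbert space; its
  complex structure is \<open>mult_i\<close> below.\<close>

instantiation ell2 :: (type) real_inner
begin

lift_definition zero_ell2 :: "'a ell2" is "\<lambda>_. 0" by simp
lift_definition plus_ell2 :: "'a ell2 \<Rightarrow> 'a ell2 \<Rightarrow> 'a ell2" is "\<lambda>f g i. f i + g i"
  by (rule summable_square_add)
lift_definition uminus_ell2 :: "'a ell2 \<Rightarrow> 'a ell2" is "\<lambda>f i. - f i" by simp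
lift_definition minus_ell2 :: "'a ell2 \<Rightarrow> 'a ell2 \<Rightarrow> 'a ell2" is "\<lambda>f g i. f i - g i"
  using summable_square_add[of _ "\<lambda>i. - g i" for g] by fastforce
lift_definition scaleR_ell2 :: "real \<Rightarrow> 'a ell2 \<Rightarrow> 'a ell2" is "\<lambda>r f i. r *\<^sub>R f i"
  by (auto simp: norm_mult power_mult_distrib intro!: summable_on_cmult_right)
lift_definition inner_ell2 :: "'a ell2 \<Rightarrow> 'a ell2 \<Rightarrow> real" is "\<lambda>f g. \<Sum>\<^sub>\<infinity>i. inner (f i) (g i)" .

definition norm_ell2 :: "'a ell2 \<Rightarrow> real" where "norm_ell2 x = sqrt (inner x x)"
definition dist_ell2 :: "'a ell2 \<Rightarrow> 'a ell2 \<Rightarrow> real" where "dist_ell2 x y = norm (x - y)"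
definition sgn_ell2 :: "'a ell2 \<Rightarrow> 'a ell2" where "sgn_ell2 x = inverse (norm x) *\<^sub>R x"
definition uniformity_ell2 :: "('a ell2 \<times> 'a ell2) filter" where
  "uniformity_ell2 = (INF e\<in>{0<..}. principal {(x, y). dist x y < e})"
definition open_ell2 :: "'a ell2 set \<Rightarrow> bool" where
  "open_ell2 U = (\<forall>x\<in>U. eventually (\<lambda>(x', y). x' = x \<longrightarrow> y \<in> U) uniformity)"

instance
proof
  fix x y z :: "'a ell2" and r :: real
  show "inner (x + y) z = inner x z + inner y z"
    by transfer (simp add: inner_add_left infsum_add summable_inner)
  show "inner (r *\<^sub>R x) y = r * inner x y"
    by transfer (simp add: infsum_cmult_right')
  show "0 \<le> inner x x" by transfer (simp add: infsum_nonneg)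
  show "inner x x = 0 \<longleftrightarrow> x = 0"
  proof
    show "inner x x = 0 \<Longrightarrow> x = 0"
    proof (transfer, rule ext)
      fix f :: "'a \<Rightarrow> complex" and i
      assume f: "(\<lambda>i. (cmod (f i))\<^sup>2) summable_on UNIV" and 0: "(\<Sum>\<^sub>\<infinity>i. inner (f i) (f i)) = 0"
      have "inner (f i) (f i) = 0"
        using 0 f by (intro nonneg_infsum_le_0D[of "\<lambda>i. inner (f i) (f i)" UNIV])
          (auto simp: power2_norm_eq_inner)
      then show "f i = 0" by simp
    qed
  qed (transfer, simp)
  show "x + y + z = x + (y + z)" "x + y = y + x" "0 + x = x" "- x + x = 0" "x - y = x + - y"
    "r *\<^sub>R (x + y) = r *\<^sub>R x + r *\<^sub>R y" "1 *\<^sub>R x = x" "inner x y = inner y x"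
    by (transfer, simp add: algebra_simps inner_commute)+
  fix s show "(r + s) *\<^sub>R x = r *\<^sub>R x + s *\<^sub>R x" "r *\<^sub>R s *\<^sub>R x = (r * s) *\<^sub>R x"
    by (transfer, simp add: algebra_simps)+
qed (simp_all add: dist_ell2_def norm_ell2_def sgn_ell2_def uniformity_ell2_def open_ell2_def)

end

lemma coord_simps [simp]:
  "coord (0 :: 'i ell2) i = 0" "coord (x + y) i = coord x i + coord y i"
  "coord (x - y) i = coord x i - coord y i" "coord (r *\<^sub>R x) i = r *\<^sub>R coord x i"
  for x y :: "'i ell2"
  by (simp_all add: zero_ell2.rep_eq plus_ell2.rep_eq minus_ell2.rep_eq scaleR_ell2.rep_eq)

lemma ell2_eqI: "(\<And>i. coord x i = coord y i) \<Longrightarrow> x = y"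
  by (simp add: coord_inject[symmetric] fun_eq_iff)

lemma summable_coord: "(\<lambda>i. (cmod (coord x i))\<^sup>2) summable_on UNIV"
  using coord[of x] by simp

lemma norm_ell2_square: "(norm x)\<^sup>2 = (\<Sum>\<^sub>\<infinity>i. (cmod (coord x i))\<^sup>2)" for x :: "'i ell2"
  by (simp add: power2_norm_eq_inner inner_ell2.rep_eq)

lemma sum_coord_le: "finite F \<Longrightarrow> (\<Sum>i\<in>F. (cmod (coord x i))\<^sup>2) \<le> (norm x)\<^sup>2"
  unfolding norm_ell2_square by (intro finite_sum_le_infsum summable_coord) auto

lemma summable_square_if_bounded:
  assumes "\<And>F. finite F \<Longrightarrow> (\<Sum>i\<in>F. (cmod (f i))\<^sup>2) \<le> C"
  shows "(\<lambda>i. (cmod (f i))\<^sup>2) summable_on UNIV"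
  using assms by (intro nonneg_bdd_above_summable_on) (auto simp: bdd_above_def)

lemma norm_le_if_sum_coord_le:
  assumes "0 \<le> C" "\<And>F. finite F \<Longrightarrow> (\<Sum>i\<in>F. (cmod (coord x i))\<^sup>2) \<le> C\<^sup>2"
  shows "norm x \<le> C"
proof (rule power2_le_imp_le)
  show "(norm x)\<^sup>2 \<le> C\<^sup>2"
    unfolding norm_ell2_square using assms(2) by (intro infsum_le_finite_sums summable_coord)
qed fact

instance ell2 :: (type) banach
proof
  fix X :: "nat \<Rightarrow> 'a ell2" assume X: "Cauchy X"
  have "cmod (coord x i) \<le> norm x" for x :: "'a ell2" and i
    using sum_coord_le[of "{i}" x] by (simp add: power2_le_iff_abs_le)
  from this[of "X m - X n" for m n] have "Cauchy (\<lambda>n. coord (X n) i)" for i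
    using X unfolding Cauchy_def dist_norm by (simp, meson le_less_trans)
  then have "\<exists>l. (\<lambda>n. coord (X n) i) \<longlonglongrightarrow> l" for i
    by (simp add: Cauchy_convergent_iff convergent_def)
  then obtain f where f: "\<And>i. (\<lambda>n. coord (X n) i) \<longlonglongrightarrow> f i" by metis
  obtain B where B: "\<And>n. norm (X n) \<le> B"
    using Cauchy_Bseq[OF X] by (auto simp: Bseq_def)
  have "(\<Sum>i\<in>F. (cmod (f i))\<^sup>2) \<le> B\<^sup>2" if F: "finite F" for F
  proof (rule LIMSEQ_le_const2)
    show "(\<lambda>n. \<Sum>i\<in>F. (cmod (coord (X n) i))\<^sup>2) \<longlonglongrightarrow> (\<Sum>i\<in>F. (cmod (f i))\<^sup>2)"
      by (intro tendsto_intros f)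
    have "(norm (X n))\<^sup>2 \<le> B\<^sup>2" for n using B by (intro power_mono) auto
    then show "\<exists>N. \<forall>n\<ge>N. (\<Sum>i\<in>F. (cmod (coord (X n) i))\<^sup>2) \<le> B\<^sup>2"
      using sum_coord_le[OF F] order_trans by blast
  qed
  then have sf: "(\<lambda>i. (cmod (f i))\<^sup>2) summable_on UNIV" by (rule summable_square_if_bounded)
  define x where "x = Abs_ell2 f"
  have x: "coord x = f" using sf by (simp add: x_def Abs_ell2_inverse)
  have "X \<longlonglongrightarrow> x"
    unfolding LIMSEQ_def
  proof (intro allI impI)
    fix e :: real assume e: "e > 0"
    then obtain N where N: "\<And>m n. m \<ge> N \<Longrightarrow> n \<ge> N \<Longrightarrow> norm (X m - X n) < e / 2"
      using X unfolding Cauchy_def dist_norm by (meson half_gt_zero)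
    have "norm (X m - x) \<le> e / 2" if m: "m \<ge> N" for m
    proof (rule norm_le_if_sum_coord_le)
      fix F :: "'a set" assume F: "finite F"
      show "(\<Sum>i\<in>F. (cmod (coord (X m - x) i))\<^sup>2) \<le> (e / 2)\<^sup>2"
      proof (rule LIMSEQ_le_const2)
        show "(\<lambda>n. \<Sum>i\<in>F. (cmod (coord (X m - X n) i))\<^sup>2) \<longlonglongrightarrow> (\<Sum>i\<in>F. (cmod (coord (X m - x) i))\<^sup>2)"
          unfolding coord_simps x by (intro tendsto_intros f)
        have "(norm (X m - X n))\<^sup>2 \<le> (e / 2)\<^sup>2" if "n \<ge> N" for n
          using N[OF m that] by (intro power_mono) auto
        then show "\<exists>N. \<forall>n\<ge>N. (\<Sum>i\<in>F. (cmod (coord (X m - X n) i))\<^sup>2) \<le> (e / 2)\<^sup>2"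
          using sum_coord_le[OF F] order_trans by blast
      qed
    qed (use e in auto)
    then show "\<exists>N. \<forall>n\<ge>N. dist (X n) x < e" using e unfolding dist_norm by fastforce
  qed
  then show "convergent X" by (auto simp: convergent_def)
qed

section \<open>Adjointable operators\<close>

lift_definition mult_i :: "'i ell2 \<Rightarrow> 'i ell2" is "\<lambda>f i. \<i> * f i" by (simp add: norm_mult)

lemma coord_mult_i [simp]: "coord (mult_i x) i = \<i> * coord x i" by (simp add: mult_i.rep_eq)

lemma inner_mult_i: "inner (mult_i x) y = - inner x (mult_i y)"
  by transfer (simp add: inner_complex_def infsum_uminus[symmetric] algebra_simps)

lemma mult_i_mult_i: "mult_i (mult_i x) = - x"
  by (rule ell2_eqI) (simp add: uminus_ell2.rep_eq)

lemma bounded_linear_mult_i: "bounded_linear mult_i"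
  by (rule bounded_linear_intro[of _ 1])
    (auto intro!: ell2_eqI simp: algebra_simps norm_eq_sqrt_inner inner_mult_i mult_i_mult_i)

text \<open>
  An operator is a pair of a map and its adjoint, so that adjoints need no representation
  theorem.  Complex linearity is the condition that both maps commute with \<open>mult_i\<close>.
\<close>

type_synonym 'i oper = "('i ell2 \<Rightarrow>\<^sub>L 'i ell2) \<times> ('i ell2 \<Rightarrow>\<^sub>L 'i ell2)"

definition oper_struct :: "'i oper cstar_struct" where
  "oper_struct = (let J = Blinfun mult_i in
    \<lparr>carrier = {(T :: 'i ell2 \<Rightarrow>\<^sub>L 'i ell2, T' :: 'i ell2 \<Rightarrow>\<^sub>L 'i ell2). (\<forall>x y. inner (T x) y = inner x (T' y)) \<and>
        (\<forall>x. T (mult_i x) = mult_i (T x)) \<and> (\<forall>x. T' (mult_i x) = mult_i (T' x))},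
     cadd = (+), czero = 0,
     cmult = \<lambda>(T, T') (U, U'). (T o\<^sub>L U, U' o\<^sub>L T'),
     cscale = \<lambda>c (T, T'). (Re c *\<^sub>R T + Im c *\<^sub>R (J o\<^sub>L T), Re c *\<^sub>R T' - Im c *\<^sub>R (J o\<^sub>L T')),
     cadj = \<lambda>(T, T'). (T', T), cnorm = \<lambda>(T, T'). norm T\<rparr>)"

lemma Blinfun_mult_i [simp]: "blinfun_apply (Blinfun mult_i) = mult_i"
  by (simp add: bounded_linear_mult_i bounded_linear_Blinfun_apply)

lemma oper_carrierI:
  fixes T T' :: "'i ell2 \<Rightarrow>\<^sub>L 'i ell2"
  assumes "\<And>x y. inner (blinfun_apply T x) y = inner x (blinfun_apply T' y)" 
    "\<And>x. T (mult_i x) = mult_i (T x)" "\<And>x. T' (mult_i x) = mult_i (T' x)"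
  shows "(T, T') \<in> carrier oper_struct"
  using assms by (auto simp: oper_struct_def Let_def)

lemma norm_scale_oper:
  fixes T T' :: "'i ell2 \<Rightarrow>\<^sub>L 'i ell2"
  assumes "\<And>x. blinfun_apply T (mult_i x) = mult_i (T x)"
  shows "norm (a *\<^sub>R T + b *\<^sub>R (Blinfun mult_i o\<^sub>L T)) = cmod (Complex a b) * norm T"
proof -
  let ?c = "Complex a b" and ?U = "a *\<^sub>R T + b *\<^sub>R (Blinfun mult_i o\<^sub>L T)"
  have app: "norm (?U x) = cmod ?c * norm (T x)" for x
  proof -
    have z: "inner (T x) (mult_i (T x)) = 0" using inner_mult_i[of "T x" "T x"] by (simp add: inner_commute)
    have s: "inner (mult_i (T x)) (mult_i (T x)) = inner (T x) (T x)"
      by (simp add: inner_mult_i mult_i_mult_i)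
    \<comment> \<open>The vectors \<open>T x\<close> and \<open>\<i> T x\<close> are orthogonal of equal norm.\<close>
    have "(norm (?U x))\<^sup>2 = (a\<^sup>2 + b\<^sup>2) * (norm (T x))\<^sup>2"
      unfolding power2_norm_eq_inner
      by (simp add: blinfun.bilinear_simps inner_add_left inner_add_right z s inner_commute[of "mult_i (T x)" "T x"]
          power2_eq_square algebra_simps)
    then have "(norm (?U x))\<^sup>2 = (cmod ?c * norm (T x))\<^sup>2" by (simp add: cmod_power2 power_mult_distrib)
    then show ?thesis by (simp add: power2_eq_iff_nonneg)
  qed
  show ?thesis
  proof (cases "?c = 0")
    case True then show ?thesis by (simp add: complex_eq_iff)
  next
    case False
    have "norm ?U \<le> cmod ?c * norm T"
    proof (rule norm_blinfun_bound)
      fix x show "norm (?U x) \<le> cmod ?c * norm T * norm x"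
        using mult_left_mono[OF norm_blinfun[of T x], of "cmod ?c"] by (simp add: app mult.assoc)
    qed simp
    moreover have "norm T \<le> norm ?U / cmod ?c"
    proof (rule norm_blinfun_bound)
      fix x show "norm (T x) \<le> norm ?U / cmod ?c * norm x"
        using norm_blinfun[of ?U x] False by (simp only: app) (simp add: field_simps)
    qed simp
    ultimately show ?thesis using False by (simp add: field_simps)
  qed
qed

lemma norm_adjoint_le:
  fixes T T' :: "'i ell2 \<Rightarrow>\<^sub>L 'i ell2"
  assumes "\<And>x y. inner (blinfun_apply T x) y = inner x (blinfun_apply T' y)"
  shows "norm T' \<le> norm T"
proof (rule norm_blinfun_bound)
  fix y
  have "norm (T' y) * norm (T' y) = inner (T (T' y)) y"
    using assms[of "T' y" y] by (simp add: power2_norm_eq_inner[symmetric] power2_eq_square)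
  also have "\<dots> \<le> norm T * norm (T' y) * norm y"
    using norm_cauchy_schwarz[of "T (T' y)" y] mult_right_mono[OF norm_blinfun[of T "T' y"], of "norm y"]
    by simp
  finally have "norm (T' y) * norm (T' y) \<le> norm (T' y) * (norm T * norm y)" by (simp add: mult_ac)
  then show "norm (T' y) \<le> norm T * norm y"
    by (cases "norm (T' y) = 0") (simp_all add: mult_le_cancel_left)
qed simp

lemma norm_adjoint_mult:
  fixes T T' :: "'i ell2 \<Rightarrow>\<^sub>L 'i ell2"
  assumes a: "\<And>x y. inner (blinfun_apply T x) y = inner x (blinfun_apply T' y)"
  shows "norm (T' o\<^sub>L T) = (norm T)\<^sup>2"
proof (rule antisym)
  have "norm (T' o\<^sub>L T) \<le> norm T' * norm T" by (rule norm_blinfun_compose)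
  also have "\<dots> \<le> norm T * norm T" using norm_adjoint_le[OF a] by (rule mult_right_mono) simp
  finally show "norm (T' o\<^sub>L T) \<le> (norm T)\<^sup>2" by (simp add: power2_eq_square)
  have "norm T \<le> sqrt (norm (T' o\<^sub>L T))"
  proof (rule norm_blinfun_bound)
    fix x
    have "(norm (T x))\<^sup>2 = inner x ((T' o\<^sub>L T) x)" by (simp add: power2_norm_eq_inner a)
    also have "\<dots> \<le> norm x * norm ((T' o\<^sub>L T) x)" by (rule norm_cauchy_schwarz)
    also have "\<dots> \<le> norm x * (norm (T' o\<^sub>L T) * norm x)"
      by (intro mult_left_mono norm_blinfun) simp
    finally have "(norm (T x))\<^sup>2 \<le> (sqrt (norm (T' o\<^sub>L T)) * norm x)\<^sup>2"
      by (simp add: power_mult_distrib power2_eq_square mult_ac)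
    then show "norm (T x) \<le> sqrt (norm (T' o\<^sub>L T)) * norm x" by (rule power2_le_imp_le) simp
  qed simp
  then show "(norm T)\<^sup>2 \<le> norm (T' o\<^sub>L T)" by (metis norm_ge_zero power_mono real_sqrt_pow2)
qed

lemma oper_diff: "cdist oper_struct (T, T') (U, U') = norm (T - U)"
  by (simp add: cdist_def oper_struct_def Let_def)

lemma cstar_structure_oper: "cstar_structure (oper_struct :: 'i oper cstar_struct)"
proof -
  have mi: "mult_i (x + y) = mult_i x + mult_i y" "mult_i (x - y) = mult_i x - mult_i y"
    "mult_i (r *\<^sub>R x) = r *\<^sub>R mult_i x" "mult_i 0 = 0" "mult_i (- x) = - mult_i x" for x y :: "'i ell2" and r
    by (auto simp: linear_simps[OF bounded_linear_mult_i])
  note bl = blinfun.bilinear_simps mi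
  have neg: "\<exists>U\<in>carrier oper_struct. U + T = 0" if "T \<in> carrier oper_struct" for T :: "'i oper"
    using that by (intro bexI[of _ "- T"]) (auto simp: oper_struct_def Let_def bl)
  have grp: "comm_group (add_group (oper_struct :: 'i oper cstar_struct))"
  proof (rule comm_groupI, goal_cases)
    case (6 x)
    then show ?case using neg[of x] by (auto simp: add_group_def oper_struct_def Let_def)
  qed (auto simp: add_group_def oper_struct_def Let_def bl inner_add_left inner_add_right add_ac zero_prod_def)
  show ?thesis
  proof (rule cstar_structure.intro, goal_cases)
    case 1 show ?case by (rule grp)
  next
    case (23 u)
    define T where "T n = fst (u n)" for n
    define T' where "T' n = snd (u n)" for n
    have u: "u n = (T n, T' n)" for n by (simp add: T_def T'_def)
    have adj: "inner (T n x) y = inner x (T' n y)" and com: "T n (mult_i x) = mult_i (T n x)"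
      "T' n (mult_i x) = mult_i (T' n x)" for n x y
      using 23(1)[of n] by (auto simp: u oper_struct_def Let_def)
    have C: "Cauchy T" using 23(2) by (simp add: Cauchy_def dist_norm u oper_diff)
    have "norm (T' m - T' n) \<le> norm (T m - T n)" for m n
      by (rule norm_adjoint_le) (simp add: bl inner_diff_left inner_diff_right adj)
    then have "Cauchy T'" using C unfolding Cauchy_def dist_norm by (meson le_less_trans)
    then obtain L L' where L: "T \<longlonglongrightarrow> L" "T' \<longlonglongrightarrow> L'"
      using C by (auto simp: Cauchy_convergent_iff convergent_def)
    have lx: "(\<lambda>n. T n x) \<longlonglongrightarrow> L x" "(\<lambda>n. T' n x) \<longlonglongrightarrow> L' x" for x
      using L by (auto intro!: tendsto_intros)
    have "inner (L x) y = inner x (L' y)" for x y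
    proof (rule LIMSEQ_unique)
      show "(\<lambda>n. inner (T n x) y) \<longlonglongrightarrow> inner (L x) y" by (intro tendsto_intros lx)
      show "(\<lambda>n. inner (T n x) y) \<longlonglongrightarrow> inner x (L' y)" unfolding adj by (intro tendsto_intros lx)
    qed
    moreover have "L (mult_i x) = mult_i (L x)" "L' (mult_i x) = mult_i (L' x)" for x
    proof -
      have "(\<lambda>n. mult_i (T n x)) \<longlonglongrightarrow> mult_i (L x)" "(\<lambda>n. mult_i (T' n x)) \<longlonglongrightarrow> mult_i (L' x)"
        by (intro bounded_linear.tendsto[OF bounded_linear_mult_i] lx)+
      then show "L (mult_i x) = mult_i (L x)" "L' (mult_i x) = mult_i (L' x)"
        using lx[of "mult_i x"] unfolding com by (auto intro: LIMSEQ_unique)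
    qed
    ultimately have "(L, L') \<in> carrier oper_struct" by (rule oper_carrierI)
    moreover have "(\<lambda>n. cdist oper_struct (u n) (L, L')) \<longlonglongrightarrow> 0"
      using L(1) by (simp add: u oper_diff tendsto_norm_zero_iff LIM_zero_iff)
    ultimately show ?case by blast
  next
    case (6 x c)
    obtain T T' where x: "x = (T, T')" by (cases x)
    have a: "inner (T y) z = inner y (T' z)" "T (mult_i y) = mult_i (T y)"
      "T' (mult_i y) = mult_i (T' y)" for y z
      using 6 by (auto simp: x oper_struct_def Let_def)
    have J: "inner (mult_i (T y)) z = - inner y (mult_i (T' z))" for y z
      by (simp add: inner_mult_i a(1) a(3)[symmetric])
    show ?case using a
      by (auto simp: x oper_struct_def Let_def bl J inner_add_left inner_diff_right mult_i_mult_i)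
  next
    case (20 x c)
    then show ?case using norm_scale_oper[of "fst x" "Re c" "Im c"]
      by (auto simp: oper_struct_def Let_def)
  next
    case (22 x)
    then show ?case using norm_adjoint_mult[of "fst x" "snd x"]
      by (auto simp: oper_struct_def Let_def)
  next
    case (18 x)
    show ?case
    proof (cases x)
      case (Pair T T')
      then have "norm T' \<le> norm T" using 18 by (intro norm_adjoint_le) (auto simp: oper_struct_def Let_def)
      then show ?thesis using Pair by (auto simp: oper_struct_def Let_def zero_prod_def)
    qed
  next
    case 19 then show ?case by (auto simp: oper_struct_def Let_def norm_triangle_ineq)
  next
    case 21 then show ?case by (auto simp: oper_struct_def Let_def norm_blinfun_compose)
  qed (auto simp: oper_struct_def Let_def bl inner_add_left inner_add_right inner_diff_left
      inner_diff_right inner_mult_i mult_i_mult_i inner_commute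
      intro!: blinfun_eqI simp: algebra_simps)
qed

section \<open>A family on the space of infinite paths\<close>

lemma summable_partial_comp:
  assumes "inj_on s A" "(\<lambda>i. (cmod (f i))\<^sup>2) summable_on UNIV"
  shows "(\<lambda>i. (cmod (if i \<in> A then f (s i) else 0))\<^sup>2) summable_on UNIV"
proof -
  have "(\<lambda>i. (cmod (f i))\<^sup>2) summable_on s ` A"
    using assms(2) by (rule summable_on_subset_banach) simp
  then have "(\<lambda>i. (cmod (f (s i)))\<^sup>2) summable_on A"
    using summable_on_reindex[OF assms(1), of "\<lambda>i. (cmod (f i))\<^sup>2"] by (simp add: o_def)
  then show ?thesis
    by (rule summable_on_cong_neutral[THEN iffD1, rotated -1]) auto
qed

text \<open>If \<open>s\<close> is injective on \<open>A\<close>, this is the partial isometry that sends the basis vector at \<open>s i\<close> to the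
  one at \<open>i\<close>, for \<open>i \<in> A\<close>, and kills the other basis vectors.  Its adjoint belongs to the inverse
  injection.\<close>

definition partial_comp :: "'i set \<Rightarrow> ('i \<Rightarrow> 'i) \<Rightarrow> 'i ell2 \<Rightarrow>\<^sub>L 'i ell2" where
  "partial_comp A s = Blinfun (\<lambda>x. Abs_ell2 (\<lambda>i. if i \<in> A then coord x (s i) else 0))"

lemma coord_partial_comp:
  assumes s: "inj_on s A"
  shows "coord (partial_comp A s x) i = (if i \<in> A then coord x (s i) else 0)"
proof -
  have c: "coord (Abs_ell2 (\<lambda>i. if i \<in> A then coord x (s i) else 0)) =
      (\<lambda>i. if i \<in> A then coord x (s i) else 0)" for x
    using summable_partial_comp[OF s summable_coord[of x]] by (simp add: Abs_ell2_inverse)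
  have "bounded_linear (\<lambda>x. Abs_ell2 (\<lambda>i. if i \<in> A then coord x (s i) else 0))"
  proof (rule bounded_linear_intro[of _ 1])
    fix x
    have "(norm (Abs_ell2 (\<lambda>i. if i \<in> A then coord x (s i) else 0)))\<^sup>2 =
        (\<Sum>\<^sub>\<infinity>i\<in>A. (cmod (coord x (s i)))\<^sup>2)"
      unfolding norm_ell2_square c by (rule infsum_cong_neutral) auto
    also have "\<dots> = (\<Sum>\<^sub>\<infinity>i\<in>s ` A. (cmod (coord x i))\<^sup>2)"
      using infsum_reindex[OF s, of "\<lambda>i. (cmod (coord x i))\<^sup>2"] by (simp add: o_def)
    also have "\<dots> \<le> (norm x)\<^sup>2" unfolding norm_ell2_square
      by (intro infsum_mono_neutral summable_coord summable_on_subset_banach[OF summable_coord]) auto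
    finally show "norm (Abs_ell2 (\<lambda>i. if i \<in> A then coord x (s i) else 0)) \<le> norm x * 1"
      by (simp add: power2_le_iff_abs_le)
  qed (auto intro!: ell2_eqI simp: c)
  then show ?thesis by (simp add: partial_comp_def bounded_linear_Blinfun_apply c)
qed

lemma partial_comp_carrier:
  assumes s: "bij_betw s A B" and t: "\<And>i. i \<in> A \<Longrightarrow> t (s i) = i"
  shows "(partial_comp A s, partial_comp B t) \<in> carrier oper_struct"
proof (rule oper_carrierI)
  have js: "inj_on s A" using s by (simp add: bij_betw_def)
  have jt: "inj_on t B" using s t by (auto simp: bij_betw_def inj_on_def)
  show "partial_comp A s (mult_i x) = mult_i (partial_comp A s x)"
    "partial_comp B t (mult_i x) = mult_i (partial_comp B t x)" for x
    by (auto intro!: ell2_eqI simp: coord_partial_comp js jt)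
  show "inner (partial_comp A s x) y = inner x (partial_comp B t y)" for x y
  proof -
    have "inner (partial_comp A s x) y = (\<Sum>\<^sub>\<infinity>i\<in>A. inner (coord x (s i)) (coord y (t (s i))))"
      unfolding inner_ell2.rep_eq
      by (rule infsum_cong_neutral) (auto simp: coord_partial_comp js t)
    also have "\<dots> = (\<Sum>\<^sub>\<infinity>i\<in>B. inner (coord x i) (coord y (t i)))"
      by (rule infsum_reindex_bij_betw[OF s])
    also have "\<dots> = inner x (partial_comp B t y)"
      unfolding inner_ell2.rep_eq
      by (rule infsum_cong_neutral) (auto simp: coord_partial_comp jt)
    finally show ?thesis .
  qed
qed

lemma partial_comp_0 [simp]: "partial_comp {} s = 0"
  by (auto intro!: blinfun_eqI ell2_eqI simp: coord_partial_comp)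

lemma partial_comp_mult:
  assumes "inj_on s A" "inj_on t B" "C = {i \<in> A. s i \<in> B}" "\<And>i. i \<in> C \<Longrightarrow> u i = t (s i)"
  shows "partial_comp A s o\<^sub>L partial_comp B t = partial_comp C u"
proof -
  have "inj_on u C" using assms by (auto simp: inj_on_def)
  then show ?thesis using assms by (auto intro!: blinfun_eqI ell2_eqI simp: coord_partial_comp)
qed

lemma partial_comp_add:
  assumes "inj_on s (A \<union> B)" "A \<inter> B = {}"
  shows "partial_comp A s + partial_comp B s = partial_comp (A \<union> B) s"
proof -
  have "inj_on s A" "inj_on s B" using assms by (auto simp: inj_on_def)
  then show ?thesis using assms
    by (auto intro!: blinfun_eqI ell2_eqI simp: coord_partial_comp plus_blinfun.rep_eq)
qed

lemma partial_comp_nonzero: "A \<noteq> {} \<Longrightarrow> partial_comp A id \<noteq> 0"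
proof -
  assume "A \<noteq> {}" then obtain i where i: "i \<in> A" by blast
  let ?f = "\<lambda>j. if j = i then 1 else (0::complex)"
  have "(\<lambda>j. (cmod (?f j))\<^sup>2) summable_on UNIV"
  proof (rule summable_square_if_bounded)
    fix F :: "'a set" assume "finite F"
    then have "(\<Sum>j\<in>F. (cmod (?f j))\<^sup>2) = (\<Sum>j\<in>F. if j = i then 1 else 0)" by (intro sum.cong) auto
    then show "(\<Sum>j\<in>F. (cmod (?f j))\<^sup>2) \<le> 1" using \<open>finite F\<close> by simp
  qed
  then have "coord (Abs_ell2 ?f) = ?f" by (simp add: Abs_ell2_inverse)
  then have "coord (partial_comp A id (Abs_ell2 ?f)) i \<noteq> 0" using i by (simp add: coord_partial_comp)
  then show ?thesis by auto
qed

context wf_digraph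
begin

definition inf_paths :: "(nat \<Rightarrow> 'b) set" where
  "inf_paths = {x. \<forall>i. x i \<in> arcs G \<and> head G (x i) = tail G (x (Suc i))}"

definition diag_oper :: "(nat \<Rightarrow> 'b) set \<Rightarrow> (nat \<Rightarrow> 'b) oper" where
  "diag_oper A = (partial_comp A id, partial_comp A id)"

definition path_proj :: "'a \<Rightarrow> (nat \<Rightarrow> 'b) oper" where
  "path_proj v = diag_oper {x \<in> inf_paths. tail G (x 0) = v}"

text \<open>The first component sends the basis vector at a path \<open>x\<close> starting at the head of \<open>e\<close> to the one at the
  path \<open>e x\<close>.\<close>

definition path_shift :: "'b \<Rightarrow> (nat \<Rightarrow> 'b) oper" where
  "path_shift e = (partial_comp {x \<in> inf_paths. x 0 = e} (\<lambda>x i. x (Suc i)),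
     partial_comp {x \<in> inf_paths. tail G (x 0) = head G e} (case_nat e))"

lemma oper_simps:
  "cadd oper_struct = (+)" "czero oper_struct = 0"
  "cmult oper_struct (T, T') (U, U') = (T o\<^sub>L U, U' o\<^sub>L T')" "cadj oper_struct (T, T') = (T', T)"
  by (simp_all add: oper_struct_def Let_def)

lemma diag_oper_carrier: "diag_oper A \<in> carrier oper_struct"
  unfolding diag_oper_def by (rule partial_comp_carrier) auto

lemma diag_oper_mult: "cmult oper_struct (diag_oper A) (diag_oper B) = diag_oper (A \<inter> B)"
  unfolding diag_oper_def oper_simps
  by (intro arg_cong2[of _ _ _ _ Pair] partial_comp_mult) auto

lemma diag_oper_adj: "cadj oper_struct (diag_oper A) = diag_oper A"
  by (simp add: diag_oper_def oper_simps)

lemma diag_oper_empty: "diag_oper {} = czero oper_struct"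
  by (simp add: diag_oper_def oper_simps zero_prod_def)

lemma diag_oper_add: "A \<inter> B = {} \<Longrightarrow> cadd oper_struct (diag_oper A) (diag_oper B) = diag_oper (A \<union> B)"
  by (simp add: diag_oper_def oper_simps partial_comp_add)

lemma case_nat_inf_path:
  "x \<in> inf_paths \<Longrightarrow> e \<in> arcs G \<Longrightarrow> tail G (x 0) = head G e \<Longrightarrow> case_nat e x \<in> inf_paths"
  by (auto simp: inf_paths_def split: nat.split)

lemma case_nat_shift: "x 0 = e \<Longrightarrow> case_nat e (\<lambda>i. x (Suc i)) = x"
  by (auto simp: fun_eq_iff split: nat.split)

lemma inj_shift: "inj_on (\<lambda>x i. x (Suc i)) {x \<in> inf_paths. x 0 = e}"
  by (rule inj_on_inverseI[of _ "case_nat e"]) (simp add: case_nat_shift)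

lemma inj_case_nat: "inj_on (case_nat e) A"
  by (rule inj_on_inverseI[of _ "\<lambda>x i. x (Suc i)"]) simp

lemma path_shift_carrier: "e \<in> arcs G \<Longrightarrow> path_shift e \<in> carrier oper_struct"
  unfolding path_shift_def
proof (rule partial_comp_carrier)
  assume e: "e \<in> arcs G"
  show "bij_betw (\<lambda>x i. x (Suc i)) {x \<in> inf_paths. x 0 = e} {x \<in> inf_paths. tail G (x 0) = head G e}"
    by (rule bij_betwI[of _ _ _ "case_nat e"])
      (use e in \<open>auto simp: case_nat_shift case_nat_inf_path\<close>, auto simp: inf_paths_def)
qed (simp add: case_nat_shift)

lemma path_shift_adj_mult:
  assumes e: "e \<in> arcs G" 
  shows "cmult oper_struct (cadj oper_struct (path_shift e)) (path_shift f) =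
    (if e = f then path_proj (head G e) else czero oper_struct)"
proof -
  have "partial_comp {x \<in> inf_paths. tail G (x 0) = head G e} (case_nat e) o\<^sub>L
      partial_comp {x \<in> inf_paths. x 0 = f} (\<lambda>x i. x (Suc i)) =
      partial_comp (if e = f then {x \<in> inf_paths. tail G (x 0) = head G e} else {}) id"
    by (rule partial_comp_mult) (use e in \<open>auto simp: inj_shift inj_case_nat case_nat_inf_path\<close>)
  moreover have "partial_comp {x \<in> inf_paths. tail G (x 0) = head G f} (case_nat f) o\<^sub>L
      partial_comp {x \<in> inf_paths. x 0 = e} (\<lambda>x i. x (Suc i)) =
      partial_comp (if e = f then {x \<in> inf_paths. tail G (x 0) = head G e} else {}) id"
    by (rule partial_comp_mult) (use e in \<open>auto simp: inj_shift inj_case_nat case_nat_inf_path\<close>)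
  ultimately show ?thesis
    by (simp add: path_shift_def path_proj_def diag_oper_def oper_simps zero_prod_def)
qed

lemma path_shift_mult_adj:
  "cmult oper_struct (path_shift e) (cadj oper_struct (path_shift e)) = diag_oper {x \<in> inf_paths. x 0 = e}"
proof -
  have "partial_comp {x \<in> inf_paths. x 0 = e} (\<lambda>x i. x (Suc i)) o\<^sub>L
      partial_comp {x \<in> inf_paths. tail G (x 0) = head G e} (case_nat e) =
      partial_comp {x \<in> inf_paths. x 0 = e} id"
    by (rule partial_comp_mult)
      (auto simp: inj_shift inj_case_nat case_nat_shift, auto simp: inf_paths_def)
  then show ?thesis by (simp add: path_shift_def diag_oper_def oper_simps)
qed

lemma finprod_diag_oper:
  assumes "finite F"
  shows "finprod (add_group oper_struct) (\<lambda>e. diag_oper {x \<in> inf_paths. x 0 = e}) F =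
    diag_oper {x \<in> inf_paths. x 0 \<in> F}"
proof -
  interpret comm_group "add_group (oper_struct :: (nat \<Rightarrow> 'b) oper cstar_struct)"
    by (rule cstar_structure.add_group[OF cstar_structure_oper])
  show ?thesis using assms
  proof (induction F rule: finite_induct)
    case empty show ?case by (simp add: diag_oper_empty[unfolded oper_simps]) (simp add: add_group_def oper_simps)
  next
    case (insert e F)
    have m: "x \<otimes>\<^bsub>add_group oper_struct\<^esub> y = cadd oper_struct x y" for x y :: "(nat \<Rightarrow> 'b) oper"
      by (simp add: add_group_def)
    have c: "diag_oper A \<in> carrier (add_group oper_struct)" for A
      using diag_oper_carrier by (simp add: add_group_def)
    have "diag_oper ({x \<in> inf_paths. x 0 = e} \<union> {x \<in> inf_paths. x 0 \<in> F}) =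
      diag_oper {x \<in> inf_paths. x 0 \<in> insert e F}" by (rule arg_cong[of _ _ diag_oper]) auto
    moreover have "{x \<in> inf_paths. x 0 = e} \<inter> {x \<in> inf_paths. x 0 \<in> F} = {}" using insert.hyps by auto
    ultimately show ?case
      using insert by (subst finprod_insert) (auto simp: c m diag_oper_add)
  qed
qed

lemma CK_family_inf_paths: "CK_family G oper_struct path_proj path_shift"
  unfolding CK_family_def
proof (intro conjI ballI impI)
  fix v assume "v \<in> verts G"
  show "projection oper_struct (path_proj v)"
    by (simp add: projection_def path_proj_def diag_oper_carrier diag_oper_mult diag_oper_adj)
  fix w assume "v \<noteq> w"
  then have "{x \<in> inf_paths. tail G (x 0) = v} \<inter> {x \<in> inf_paths. tail G (x 0) = w} = {}" by auto
  then show "cmult oper_struct (path_proj v) (path_proj w) = czero oper_struct"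
    by (simp add: path_proj_def diag_oper_mult diag_oper_empty)
next
  fix e assume e: "e \<in> arcs G"
  show "cmult oper_struct (cadj oper_struct (path_shift e)) (path_shift e) = path_proj (head G e)"
    using path_shift_adj_mult[OF e] by simp
  have "partial_comp {x \<in> inf_paths. x 0 = e} id o\<^sub>L
     partial_comp {x \<in> inf_paths. x 0 = e} (\<lambda>x i. x (Suc i)) =
     partial_comp {x \<in> inf_paths. x 0 = e} (\<lambda>x i. x (Suc i))"
    by (rule partial_comp_mult) (auto simp: inj_shift)
  moreover have "partial_comp {x \<in> inf_paths. tail G (x 0) = head G e} (case_nat e) o\<^sub>L
     partial_comp {x \<in> inf_paths. x 0 = e} id =
     partial_comp {x \<in> inf_paths. tail G (x 0) = head G e} (case_nat e)"
    by (rule partial_comp_mult) (use e in \<open>auto simp: inj_case_nat case_nat_inf_path\<close>)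
  ultimately show "partial_isometry oper_struct (path_shift e)"
    using path_shift_carrier[OF e] unfolding partial_isometry_def path_shift_mult_adj
    by (simp add: path_shift_def diag_oper_def oper_simps)
  let ?A = "{x \<in> inf_paths. tail G (x 0) = tail G e \<and> x 0 \<noteq> e}"
  have "diag_oper ({x \<in> inf_paths. x 0 = e} \<union> ?A) = path_proj (tail G e)"
    unfolding path_proj_def by (rule arg_cong[of _ _ diag_oper]) auto
  then have "path_proj (tail G e) = cadd oper_struct (diag_oper {x \<in> inf_paths. x 0 = e})
      (cmult oper_struct (cadj oper_struct (diag_oper ?A)) (diag_oper ?A))"
    by (subst diag_oper_adj, subst diag_oper_mult, subst diag_oper_add) auto
  then show "cle oper_struct (cmult oper_struct (path_shift e) (cadj oper_struct (path_shift e))) (path_proj (tail G e))"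
    unfolding path_shift_mult_adj cle_def using diag_oper_carrier by blast
  fix f assume "f \<in> arcs G" "e \<noteq> f"
  then show "cmult oper_struct (cadj oper_struct (path_shift e)) (path_shift f) = czero oper_struct"
    using path_shift_adj_mult[OF e, of f] by simp
next
  fix v assume v: "v \<in> verts G" "finite (out_arcs G v) \<and> out_arcs G v \<noteq> {}"
  have "{x \<in> inf_paths. tail G (x 0) = v} = {x \<in> inf_paths. x 0 \<in> out_arcs G v}"
    by (auto simp: inf_paths_def)
  then show "path_proj v = finprod (add_group oper_struct)
      (\<lambda>e. cmult oper_struct (path_shift e) (cadj oper_struct (path_shift e))) (out_arcs G v)"
    using finprod_diag_oper[of "out_arcs G v"] v by (simp add: path_shift_mult_adj path_proj_def)
qed

text \<open>Without sinks, every vertex starts an infinite path.\<close>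

lemma path_proj_nonzero:
  assumes ns: "no_sinks G" and v: "v \<in> verts G"
  shows "path_proj v \<noteq> czero oper_struct"
proof -
  define nxt where "nxt w = (SOME e. e \<in> out_arcs G w)" for w
  have "nxt w \<in> out_arcs G w" if "w \<in> verts G" for w
    unfolding nxt_def by (rule someI_ex) (use ns that in \<open>simp add: no_sinks_def ex_in_conv del: in_out_arcs_conv\<close>)
  then have nx: "nxt w \<in> arcs G" "tail G (nxt w) = w" if "w \<in> verts G" for w
    using that by auto
  define y where "y = rec_nat (nxt v) (\<lambda>_ e. nxt (head G e))"
  have y: "y i \<in> arcs G" "tail G (y (Suc i)) = head G (y i)" for i
  proof -
    show *: "y i \<in> arcs G" by (induction i) (auto simp: y_def nx v)
    show "tail G (y (Suc i)) = head G (y i)" using nx(2)[of "head G (y i)"] * by (simp add: y_def)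
  qed
  have "y \<in> {x \<in> inf_paths. tail G (x 0) = v}"
    using y nx(2)[OF v] by (simp add: inf_paths_def) (simp add: y_def)
  then show ?thesis using partial_comp_nonzero[of "{x \<in> inf_paths. tail G (x 0) = v}"]
    by (auto simp: path_proj_def diag_oper_def oper_simps zero_prod_def)
qed

end

text \<open>The family on infinite paths is the image of the universal one under a homomorphism, which would
  send a vanishing vertex projection to zero.\<close>

lemma vertex_projection_nonzero:
  assumes E: "fin_digraph E" and ns: "no_sinks E" and U: "graph_cstar_algebra E P S"
    and v: "v \<in> verts E"
  shows "P v \<noteq> 0"
proof
  interpret E: fin_digraph E by (rule E)
  assume 0: "P v = 0"
  obtain \<phi> where h: "star_hom type_struct oper_struct \<phi>" and \<phi>: "\<And>v. v \<in> verts E \<Longrightarrow> \<phi> (P v) = E.path_proj v"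
    using graph_cstar_algebra_universal[OF E U cstar_structure_oper E.CK_family_inf_paths] by blast
  have "\<phi> (P v + P v) = \<phi> (P v) + \<phi> (P v)"
    using h by (simp add: star_hom_def type_struct_def E.oper_simps)
  then have "E.path_proj v = czero oper_struct" using 0 \<phi>[OF v] by (simp add: E.oper_simps)
  then show False using E.path_proj_nonzero[OF ns v] by simp
qed

section \<open>Toeplitz polynomials in a proper isometry\<close>

text \<open>Here \<open>u\<close> is the unit of a corner and \<open>W\<close> is an isometry of that corner which is not unitary.\<close>

locale proper_isometry =
  fixes u W :: "'a::cstar_algebra"
  assumes adj_u: "adj u = u" and u_u: "u * u = u"
    and adj_W_W: "adj W * W = u" and u_W: "u * W = W" and W_u: "W * u = W"
    and proper: "W * adj W \<noteq> u"
begin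

primrec wpow :: "nat \<Rightarrow> 'a" where
  "wpow 0 = u"
| "wpow (Suc k) = W * wpow k"

definition defect :: 'a where "defect = u - W * adj W"
definition truncation :: "nat \<Rightarrow> 'a" where "truncation M = u - wpow M * adj (wpow M)"
definition layer :: "nat \<Rightarrow> 'a" where "layer i = wpow i * defect * adj (wpow i)"

lemma u_adj_W: "u * adj W = adj W" "adj W * u = adj W"
  using arg_cong[OF W_u, of adj] arg_cong[OF u_W, of adj] by (simp_all add: adj_mult adj_u)

lemma u_wpow [simp]: "u * wpow k = wpow k" 
  by (cases k) (simp_all add: u_u u_W mult.assoc[symmetric])

lemma wpow_u [simp]: "wpow k * u = wpow k"
  by (induction k) (simp_all add: u_u mult.assoc)

lemma u_adj_wpow [simp]: "u * adj (wpow k) = adj (wpow k)" "adj (wpow k) * u = adj (wpow k)"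
  by (metis adj_mult adj_u wpow_u) (metis adj_mult adj_u u_wpow)

lemma wpow_add: "wpow (j + k) = wpow j * wpow k"
  by (induction j) (simp_all add: mult.assoc)

lemma adj_wpow_wpow [simp]: "adj (wpow k) * wpow k = u"
proof (induction k)
  case (Suc k)
  have "adj (wpow (Suc k)) * wpow (Suc k) = adj (wpow k) * (adj W * W) * wpow k"
    by (simp add: adj_mult mult.assoc)
  then show ?case using Suc by (simp add: adj_W_W)
qed (simp add: adj_u u_u)

lemma adj_wpow_wpow_add: "adj (wpow j) * wpow (j + k) = wpow k"
  by (simp add: wpow_add mult.assoc[symmetric])

lemma adj_wpow_add_wpow: "adj (wpow (j + k)) * wpow j = adj (wpow k)"
  using arg_cong[OF adj_wpow_wpow_add[of j k], of adj] by (simp add: adj_mult)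

lemma adj_defect: "adj defect = defect" by (simp add: defect_def adj_diff adj_u adj_mult)

lemma defect_W: "defect * W = 0"
  by (simp add: defect_def left_diff_distrib u_W mult.assoc adj_W_W W_u)

lemma u_defect: "u * defect = defect" "defect * u = defect"
  by (simp_all add: defect_def left_diff_distrib right_diff_distrib u_u mult.assoc u_adj_W)
    (simp add: mult.assoc[symmetric] u_W)

lemma defect_defect: "defect * defect = defect"
proof -
  have "defect * defect = defect * u - defect * W * adj W" by (simp add: defect_def right_diff_distrib mult.assoc)
  then show ?thesis by (simp add: defect_W u_defect)
qed

lemma norm_defect: "norm defect = 1"
  using proper by (intro norm_projection_eq_1 adj_defect defect_defect) (simp add: defect_def)

lemma defect_wpow: "k > 0 \<Longrightarrow> defect * wpow k = 0"
  by (cases k) (simp_all add: mult.assoc[symmetric] defect_W)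

lemma adj_wpow_defect: "k > 0 \<Longrightarrow> adj (wpow k) * defect = 0"
  using arg_cong[OF defect_wpow[of k], of adj] by (simp add: adj_mult adj_defect)

lemma norm_wpow: "norm (wpow k) \<le> 1"
proof -
  have "(norm (wpow k))\<^sup>2 = norm u" using norm_adj_mult[of "wpow k"] by simp
  then show ?thesis using norm_projection_le_1[OF adj_u u_u] power_le_one_iff[of "norm (wpow k)" 2] by simp
qed

lemma layer_eq: "layer i = wpow i * adj (wpow i) - wpow (Suc i) * adj (wpow (Suc i))"
proof -
  have "layer i = wpow i * u * adj (wpow i) - wpow i * W * (adj W * adj (wpow i))"
    by (simp add: layer_def defect_def left_diff_distrib right_diff_distrib mult.assoc)
  moreover have "wpow i * W = wpow (Suc i)" using wpow_add[of i 1] by (simp add: W_u)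
  moreover have "adj W * adj (wpow i) = adj (wpow i * W)" by (simp add: adj_mult)
  ultimately show ?thesis by simp
qed

lemma truncation_eq_sum: "truncation M = (\<Sum>i<M. layer i)"
  using sum_lessThan_telescope'[of "\<lambda>i. wpow i * adj (wpow i)" M] by (simp add: layer_eq truncation_def adj_u u_u)

lemma adj_layer: "adj (layer i) = layer i" by (simp add: layer_def adj_mult adj_defect mult.assoc)

lemma defect_adj_wpow_wpow_defect: "defect * (adj (wpow i) * wpow j) * defect = (if i = j then defect else 0)"
proof (cases i j rule: linorder_cases)
  case less
  then have "defect * (adj (wpow i) * wpow j) * defect = defect * wpow (j - i) * defect"
    using adj_wpow_wpow_add[of i "j - i"] by simp
  then show ?thesis using less by (simp add: defect_wpow)
next
  case greater
  then have "defect * (adj (wpow i) * wpow j) * defect = defect * (adj (wpow (i - j)) * defect)"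
    using adj_wpow_add_wpow[of j "i - j"] by (simp add: mult.assoc)
  then show ?thesis using greater by (simp add: adj_wpow_defect)
qed (simp add: u_defect defect_defect mult.assoc)

lemma layer_layer: "layer i * layer j = (if i = j then layer i else 0)"
proof -
  have "layer i * layer j = wpow i * (defect * (adj (wpow i) * wpow j) * defect) * adj (wpow j)"
    by (simp add: layer_def mult.assoc)
  then show ?thesis by (simp only: defect_adj_wpow_wpow_defect) (simp add: layer_def)
qed

lemma norm_layer: "norm (layer i) \<le> 1"
  using layer_layer[of i i] by (intro norm_projection_le_1 adj_layer) simp

lemma adj_truncation: "adj (truncation M) = truncation M" by (simp add: truncation_def adj_diff adj_mult adj_u)

lemma adj_wpow_truncation: "M \<le> k \<Longrightarrow> adj (wpow k) * truncation M = 0"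
proof -
  assume "M \<le> k"
  then have "adj (wpow k) * wpow M = adj (wpow (k - M))" using adj_wpow_add_wpow[of M "k - M"] by simp
  moreover have "adj (wpow (k - M)) * adj (wpow M) = adj (wpow k)"
    using \<open>M \<le> k\<close> wpow_add[of M "k - M"] by (simp add: adj_mult[symmetric])
  ultimately show ?thesis by (simp add: truncation_def right_diff_distrib mult.assoc[symmetric])
qed

lemma truncation_absorb: "u * x = x \<Longrightarrow> adj (wpow M) * x = 0 \<Longrightarrow> truncation M * x = x"
  by (simp add: truncation_def left_diff_distrib mult.assoc)

lemma truncation_truncation: "truncation M * truncation M = truncation M"
  by (rule truncation_absorb) (simp_all add: adj_wpow_truncation, simp add: truncation_def right_diff_distrib u_u mult.assoc[symmetric])

lemma norm_truncation: "norm (truncation M) \<le> 1" by (intro norm_projection_le_1 adj_truncation truncation_truncation)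

text \<open>
  Evaluation of polynomials at the isometry.  The constant term multiplies the unit of the corner.
\<close>

definition ev :: "complex poly \<Rightarrow> 'a" where
  "ev q = (\<Sum>k\<le>degree q. coeff q k *\<^sub>C wpow k)"

lemma ev_eq: "degree q \<le> n \<Longrightarrow> ev q = (\<Sum>k\<le>n. coeff q k *\<^sub>C wpow k)"
  unfolding ev_def by (rule sum.mono_neutral_left) (auto simp: coeff_eq_0)

lemma ev_0 [simp]: "ev 0 = 0" by (simp add: ev_def)

lemma ev_add: "ev (q + s) = ev q + ev s"
proof -
  let ?n = "max (degree q) (degree s)"
  have "degree (q + s) \<le> ?n" by (rule degree_add_le_max)
  then show ?thesis
    using ev_eq[of q ?n] ev_eq[of s ?n] ev_eq[of "q + s" ?n] by (simp add: scaleC_add_left sum.distrib)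
qed

lemma ev_smult: "ev (smult c q) = c *\<^sub>C ev q"
  using ev_eq[of "smult c q" "degree q"] degree_smult_le[of c q]
  by (simp add: ev_def scaleC_sum_right scaleC_scaleC)

lemma ev_pCons: "ev (pCons a q) = a *\<^sub>C u + W * ev q"
proof -
  have "ev (pCons a q) = (\<Sum>k\<le>Suc (degree q). coeff (pCons a q) k *\<^sub>C wpow k)"
    by (rule ev_eq) (simp add: degree_pCons_le)
  also have "\<dots> = a *\<^sub>C u + (\<Sum>k\<le>degree q. coeff q k *\<^sub>C (W * wpow k))"
    by (simp add: sum.atMost_Suc_shift del: sum.atMost_Suc)
  finally show ?thesis by (simp add: ev_def sum_distrib_left mult_scaleC_right)
qed

lemma u_ev: "u * ev q = ev q"
  by (simp add: ev_def sum_distrib_left mult_scaleC_right)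

lemma ev_mult: "ev (q * s) = ev q * ev s"
  by (induction q) (simp_all add: ev_add ev_smult ev_pCons distrib_right mult_scaleC_left u_ev mult.assoc)

lemma ev_monom: "ev (monom 1 k) = wpow k"
  by (simp add: ev_eq[OF degree_monom_le, of 1 k] if_distrib[of "\<lambda>c. c *\<^sub>C _"] cong: if_cong)

text \<open>The elements \<open>wpow k * defect\<close> have orthogonal ranges, so multiplication by the defect projection on the
  right lets one read off the coefficients.\<close>

lemma norm_coeff_le: "cmod (coeff q k) \<le> norm (ev q * defect)"
proof (cases "k \<le> degree q")
  case True
  have "defect * adj (wpow k) * (ev q * defect) =
      (\<Sum>j\<le>degree q. coeff q j *\<^sub>C (defect * (adj (wpow k) * wpow j) * defect))"
    by (simp add: ev_def sum_distrib_left sum_distrib_right mult_scaleC_left mult_scaleC_right mult.assoc)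
  also have "\<dots> = coeff q k *\<^sub>C defect"
    using True by (simp add: defect_adj_wpow_wpow_defect if_distrib[of "\<lambda>x. _ *\<^sub>C x"] cong: if_cong)
  finally have "cmod (coeff q k) = norm (defect * adj (wpow k) * (ev q * defect))"
    by (simp add: norm_scaleC norm_defect)
  also have "\<dots> \<le> norm (defect * adj (wpow k)) * norm (ev q * defect)" by (rule norm_mult_ineq)
  also have "\<dots> \<le> (norm defect * norm (adj (wpow k))) * norm (ev q * defect)"
    by (intro mult_right_mono norm_mult_ineq) simp
  also have "\<dots> \<le> 1 * norm (ev q * defect)"
    using norm_wpow[of k] by (intro mult_right_mono) (simp_all add: norm_defect)
  finally show ?thesis by simp
qed (simp add: coeff_eq_0)

lemma norm_ev_le: "norm (ev q) \<le> (degree q + 1) * norm (ev q * defect)"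
proof -
  have "norm (ev q) \<le> (\<Sum>k\<le>degree q. norm (ev q * defect))"
    unfolding ev_def[of q]
  proof (rule sum_norm_le)
    fix k show "norm (coeff q k *\<^sub>C wpow k) \<le> norm ((\<Sum>k\<le>degree q. coeff q k *\<^sub>C wpow k) * defect)"
      using norm_coeff_le[of q k] mult_left_mono[OF norm_wpow[of k], of "cmod (coeff q k)"]
      by (simp add: norm_scaleC ev_def)
  qed
  then show ?thesis by simp
qed

text \<open>
  The Toeplitz polynomials without constant term: relative to the projections \<open>layer i\<close> they are
  matrices of finite bandwidth with vanishing diagonal.
\<close>

inductive offdiag :: "'a \<Rightarrow> bool" where
  zero: "offdiag 0"
| up: "k > 0 \<Longrightarrow> offdiag (c *\<^sub>C wpow k)"
| down: "k > 0 \<Longrightarrow> offdiag (c *\<^sub>C adj (wpow k))"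
| add: "offdiag x \<Longrightarrow> offdiag y \<Longrightarrow> offdiag (x + y)"

lemma offdiag_adj: "offdiag z \<Longrightarrow> offdiag (adj z)"
  by (induction rule: offdiag.induct) (auto simp: adj_scaleC adj_add intro: offdiag.intros)

lemma offdiag_u: "offdiag z \<Longrightarrow> z * u = z"
  by (induction rule: offdiag.induct) (auto simp: mult_scaleC_left distrib_right)

lemma defect_wpow_defect: "k > 0 \<Longrightarrow> defect * wpow k * defect = 0" "k > 0 \<Longrightarrow> defect * adj (wpow k) * defect = 0"
  by (simp_all add: defect_wpow adj_wpow_defect mult.assoc)

lemma adj_wpow_wpow_wpow: "adj (wpow i) * wpow k * wpow i = wpow k"
  using adj_wpow_wpow_add[of i k] wpow_add[of k i] by (simp add: mult.assoc add.commute)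

lemma adj_wpow_adj_wpow_wpow: "adj (wpow i) * adj (wpow k) * wpow i = adj (wpow k)"
  using arg_cong[OF adj_wpow_wpow_wpow[of i k], of adj] by (simp add: adj_mult mult.assoc)

lemma layer_offdiag_layer: "offdiag z \<Longrightarrow> layer i * z * layer i = 0"
proof (induction rule: offdiag.induct)
  case (up k c)
  have "layer i * wpow k * layer i = wpow i * (defect * (adj (wpow i) * wpow k * wpow i) * defect) * adj (wpow i)"
    by (simp add: layer_def mult.assoc)
  then show ?case using up by (simp add: adj_wpow_wpow_wpow defect_wpow_defect mult_scaleC_left mult_scaleC_right)
next
  case (down k c)
  have "layer i * adj (wpow k) * layer i = wpow i * (defect * (adj (wpow i) * adj (wpow k) * wpow i) * defect) * adj (wpow i)"
    by (simp add: layer_def mult.assoc)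
  then show ?case using down by (simp add: adj_wpow_adj_wpow_wpow defect_wpow_defect mult_scaleC_left mult_scaleC_right)
qed (simp_all add: distrib_left distrib_right)

lemma offdiag_band: "offdiag z \<Longrightarrow> \<exists>d. \<forall>M M'. M + d \<le> M' \<longrightarrow> truncation M' * (z * truncation M) = z * truncation M"
proof (induction rule: offdiag.induct)
  case zero show ?case by simp
next
  case (up k c)
  have "truncation M' * (wpow k * truncation M) = wpow k * truncation M" if "M + k \<le> M'" for M M'
  proof (rule truncation_absorb)
    have "adj (wpow M') * wpow k = adj (wpow (M' - k))"
      using that adj_wpow_add_wpow[of k "M' - k"] by simp
    then show "adj (wpow M') * (wpow k * truncation M) = 0"
      using that by (simp add: mult.assoc[symmetric] adj_wpow_truncation)
  qed (simp add: mult.assoc[symmetric])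
  then show ?case by (intro exI[of _ k]) (simp add: mult_scaleC_left mult_scaleC_right)
next
  case (down k c)
  have "truncation M' * (adj (wpow k) * truncation M) = adj (wpow k) * truncation M" if "M \<le> M'" for M M'
  proof (rule truncation_absorb)
    have "adj (wpow M') * adj (wpow k) = adj (wpow (k + M'))" by (simp add: wpow_add adj_mult)
    then show "adj (wpow M') * (adj (wpow k) * truncation M) = 0"
      using that by (simp add: mult.assoc[symmetric] adj_wpow_truncation)
  qed (simp add: mult.assoc[symmetric])
  then show ?case by (auto simp: mult_scaleC_left mult_scaleC_right intro!: exI[of _ 0])
next
  case (add x y)
  then obtain d d' where d: "\<And>M M'. M + d \<le> M' \<Longrightarrow> truncation M' * (x * truncation M) = x * truncation M"
    "\<And>M M'. M + d' \<le> M' \<Longrightarrow> truncation M' * (y * truncation M) = y * truncation M" by blast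
  then show ?case by (intro exI[of _ "d + d'"]) (simp add: distrib_left distrib_right)
qed

text \<open>Multiplication by a high power of the isometry on the right cancels all adjoints.\<close>

lemma offdiag_ev: "offdiag z \<Longrightarrow> \<exists>d q. z * wpow d = ev q"
proof (induction rule: offdiag.induct)
  case zero show ?case by (intro exI[of _ 0]) simp
next
  case (up k c)
  have "c *\<^sub>C wpow k * wpow 0 = ev (smult c (monom 1 k))" by (simp add: ev_smult ev_monom mult_scaleC_left)
  then show ?case by blast
next
  case (down k c)
  have "c *\<^sub>C adj (wpow k) * wpow k = ev (smult c (monom 1 0))"
    unfolding ev_smult ev_monom by (simp add: mult_scaleC_left)
  then show ?case by blast
next
  case (add x y)
  then obtain d q d' q' where d: "x * wpow d = ev q" "y * wpow d' = ev q'" by blast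
  have "x * wpow (d + d') = ev (q * monom 1 d')" by (simp add: wpow_add ev_mult ev_monom d(1)[symmetric] mult.assoc)
  moreover have "y * wpow (d + d') = ev (q' * monom 1 d)"
    by (subst add.commute) (simp add: wpow_add ev_mult ev_monom d(2)[symmetric] mult.assoc)
  ultimately have "(x + y) * wpow (d + d') = ev (q * monom 1 d' + q' * monom 1 d)"
    by (simp add: distrib_right ev_add)
  then show ?case by blast
qed

definition supported :: "'a \<Rightarrow> bool" where "supported x \<longleftrightarrow> (\<exists>M. truncation M * x = x)"

lemma supported_offdiag_mult:
  assumes z: "offdiag z" and le: "\<And>M. norm (z * truncation M) \<le> d" and x: "supported x"
  shows "supported (z * x) \<and> norm (z * x) \<le> d * norm x"
proof -
  obtain M where M: "truncation M * x = x" using x by (auto simp: supported_def)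
  obtain M' where M': "truncation M' * (z * truncation M) = z * truncation M" using offdiag_band[OF z] by blast
  have zx: "z * x = z * truncation M * x" by (simp add: mult.assoc M)
  have "truncation M' * (z * x) = z * x" unfolding zx by (simp add: mult.assoc[symmetric] M'[unfolded mult.assoc[symmetric]])
  moreover have "norm (z * x) \<le> norm (z * truncation M) * norm x" unfolding zx by (rule norm_mult_ineq)
  moreover have "\<dots> \<le> d * norm x" by (intro mult_right_mono le) simp
  ultimately show ?thesis by (auto simp: supported_def)
qed

text \<open>On vectors supported in finite truncations, \<open>h = z\<^sup>* z\<close> is bounded by \<open>d\<^sup>2\<close>, hence its \<open>2\<^sup>k\<close>-th power by
  the corresponding power of \<open>d\<^sup>2\<close>.  Multiplied on the right by \<open>W\<^sup>N\<close>, with \<open>N\<close> a fixed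
  multiple of \<open>2\<^sup>k\<close>, this power becomes a polynomial in \<open>W\<close> of degree at most a constant times \<open>2\<^sup>k\<close>.  The coefficients of that polynomial are visible
  on the defect projection, so its norm exceeds the bound at most by its number of terms.  That
  factor is linear in \<open>2\<^sup>k\<close>, so \<open>le_if_power_le_linear_growth\<close> removes it.\<close>

lemma norm_offdiag_le:
  assumes z: "offdiag z" and d: "0 < d"
    and le: "\<And>M. norm (z * truncation M) \<le> d" "\<And>M. norm (adj z * truncation M) \<le> d"
  shows "norm z \<le> d"
proof -
  define h where "h = adj z * z"
  have adj_h: "adj h = h" by (simp add: h_def adj_mult)
  have sq: "supported x \<Longrightarrow> supported (square_iter k h * x) \<and> norm (square_iter k h * x) \<le> (d\<^sup>2) ^ 2 ^ k * norm x"
    for k x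
  proof (induction k arbitrary: x)
    case 0
    have 1: "supported (z * x)" "norm (z * x) \<le> d * norm x"
      using supported_offdiag_mult[OF z le(1) 0] by auto
    then have "supported (h * x)" "norm (h * x) \<le> d * norm (z * x)"
      using supported_offdiag_mult[OF offdiag_adj[OF z] le(2) 1(1)] by (auto simp: h_def mult.assoc)
    moreover have "d * norm (z * x) \<le> d * (d * norm x)" using 1 d by (intro mult_left_mono) auto
    ultimately show ?case by (simp add: power2_eq_square mult.assoc)
  next
    case (Suc k)
    have "norm (square_iter k h * (square_iter k h * x)) \<le> (d\<^sup>2) ^ 2 ^ k * norm (square_iter k h * x)"
      using Suc.IH[OF conjunct1[OF Suc.IH[OF Suc.prems]]] by simp
    also have "\<dots> \<le> (d\<^sup>2) ^ 2 ^ k * ((d\<^sup>2) ^ 2 ^ k * norm x)"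
      using Suc.IH[OF Suc.prems] by (intro mult_left_mono) auto
    finally show ?case using Suc.IH[OF conjunct1[OF Suc.IH[OF Suc.prems]]]
      by (simp add: mult.assoc power_add mult_2)
  qed
  obtain a q b q' where q: "z * wpow a = ev q" "adj z * wpow b = ev q'"
    using offdiag_ev[OF z] offdiag_ev[OF offdiag_adj[OF z]] by blast
  define D where "D = a + b"
  define q0 where "q0 = q' * q"
  have comm: "ev q * ev s = ev s * ev q" for q s by (metis ev_mult mult.commute)
  have "h * wpow D = adj z * (ev q * wpow b)" by (simp add: h_def D_def wpow_add mult.assoc q(1)[symmetric])
  also have "ev q * wpow b = wpow b * ev q" using comm[of q "monom 1 b"] by (simp add: ev_monom)
  finally have h0: "h * wpow D = ev q0" by (simp add: mult.assoc[symmetric] q(2) q0_def ev_mult)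
  have hk: "square_iter k h * wpow (2 ^ k * D) = ev (q0 ^ 2 ^ k)" for k
  proof (induction k)
    case (Suc k)
    let ?h = "square_iter k h" and ?w = "wpow (2 ^ k * D)"
    have "square_iter (Suc k) h * wpow (2 ^ Suc k * D) = ?h * (?h * ?w) * ?w"
      by (simp add: mult.assoc mult_2 distrib_right wpow_add)
    also have "\<dots> = ?h * (ev (q0 ^ 2 ^ k) * ?w)" by (simp add: Suc mult.assoc)
    also have "ev (q0 ^ 2 ^ k) * ?w = ?w * ev (q0 ^ 2 ^ k)"
      using comm[of _ "monom 1 (2 ^ k * D)"] by (simp add: ev_monom)
    finally show ?case by (simp add: mult.assoc[symmetric] Suc ev_mult[symmetric] power_add[symmetric] mult_2)
  qed (simp add: h0)
  have hu: "square_iter k h * u = square_iter k h" for k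
    by (induction k) (simp_all add: mult.assoc, simp add: h_def mult.assoc offdiag_u[OF z])
  have "norm h ^ 2 ^ k \<le> (real (degree q0) * 2 ^ k + 2) * (d\<^sup>2) ^ 2 ^ k" for k
  proof -
    let ?h = "square_iter k h" and ?N = "2 ^ k * D" and ?d = "(d\<^sup>2) ^ 2 ^ k"
    have "truncation (Suc ?N) * (wpow ?N * defect) = wpow ?N * defect"
      by (rule truncation_absorb)
        (use adj_wpow_add_wpow[of ?N 1] adj_wpow_defect[of 1] in \<open>simp_all add: mult.assoc[symmetric]\<close>)
    then have "norm (?h * (wpow ?N * defect)) \<le> ?d * norm (wpow ?N * defect)"
      using sq unfolding supported_def by blast
    also have "\<dots> \<le> ?d * 1"
    proof (rule mult_left_mono)
      show "norm (wpow ?N * defect) \<le> 1"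
        using norm_mult_ineq[of "wpow ?N" defect] norm_wpow[of ?N] by (simp add: norm_defect)
    qed simp
    finally have 1: "norm (ev (q0 ^ 2 ^ k) * defect) \<le> ?d" by (simp add: hk[symmetric] mult.assoc)
    have "norm (?h * wpow ?N * adj (wpow ?N)) \<le> norm (?h * wpow ?N) * norm (adj (wpow ?N))"
      by (rule norm_mult_ineq)
    also have "\<dots> \<le> norm (ev (q0 ^ 2 ^ k)) * 1"
      unfolding hk using norm_wpow[of ?N] by (intro mult_left_mono) auto
    also have "\<dots> \<le> (degree (q0 ^ 2 ^ k) + 1) * norm (ev (q0 ^ 2 ^ k) * defect)" using norm_ev_le by simp
    also have "\<dots> \<le> (real (degree q0) * 2 ^ k + 1) * ?d"
    proof (intro mult_mono 1)
      show "real (degree (q0 ^ 2 ^ k) + 1) \<le> real (degree q0) * 2 ^ k + 1"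
        using of_nat_mono[OF degree_power_le[of q0 "2 ^ k"], where 'a = real] by simp
    qed auto
    finally have 2: "norm (?h * wpow ?N * adj (wpow ?N)) \<le> (real (degree q0) * 2 ^ k + 1) * ?d" by simp
    have "supported (truncation ?N)" unfolding supported_def using truncation_truncation by blast
    then have "norm (?h * truncation ?N) \<le> ?d * norm (truncation ?N)" using sq by blast
    also have "\<dots> \<le> ?d * 1" by (intro mult_left_mono norm_truncation) simp
    finally have 3: "norm (?h * truncation ?N) \<le> ?d" by simp
    have "?h = ?h * truncation ?N + ?h * wpow ?N * adj (wpow ?N)"
      by (simp add: truncation_def right_diff_distrib hu mult.assoc)
    then have "norm ?h \<le> norm (?h * truncation ?N) + norm (?h * wpow ?N * adj (wpow ?N))"
      using norm_triangle_ineq by metis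
    also have "\<dots> \<le> (real (degree q0) * 2 ^ k + 2) * ?d" using 2 3 by (simp add: algebra_simps)
    finally show ?thesis by (simp add: norm_square_iter adj_h)
  qed
  then have "norm h \<le> d\<^sup>2" using d by (intro le_if_power_le_linear_growth[of "d\<^sup>2" _ "degree q0" 2]) auto
  then show ?thesis using d by (simp add: h_def norm_adj_mult power2_le_iff_abs_le)
qed

text \<open>An element commuting with the projections \<open>layer i\<close> is block diagonal, and the diagonal blocks of \<open>z\<close>
  vanish.  So the blocks of \<open>y\<close> in finite truncations have norm at most \<open>e\<close>, those of \<open>z\<close> at most \<open>2 e\<close>,
  and \<open>norm_offdiag_le\<close> extends the latter bound to all of \<open>z\<close>.\<close>

lemma norm_le_if_commutes_near_offdiag:
  assumes z: "offdiag z" and e: "0 < e" and yz: "norm (y - z) \<le> e"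
    and comm: "\<And>k. y * (wpow k * adj (wpow k)) = wpow k * adj (wpow k) * y"
  shows "norm y \<le> 3 * e"
proof -
  have yf: "norm (y * truncation M) \<le> e"
    if z: "offdiag z" and yz: "norm (y - z) \<le> e"
    and comm: "\<And>k. y * (wpow k * adj (wpow k)) = wpow k * adj (wpow k) * y" for y z M
  proof -
    have c: "y * layer i = layer i * y" for i
      unfolding layer_eq right_diff_distrib left_diff_distrib comm ..
    have 1: "layer i * y * layer i = layer i * (y - z) * layer i" for i
      using layer_offdiag_layer[OF z, of i] by (simp add: left_diff_distrib right_diff_distrib)
    have "norm (layer i * (y - z) * layer i) \<le> e" for i
    proof -
      have "norm (layer i * (y - z) * layer i) \<le> norm (layer i * (y - z)) * norm (layer i)" by (rule norm_mult_ineq)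
      also have "\<dots> \<le> (norm (layer i) * norm (y - z)) * norm (layer i)"
        by (intro mult_right_mono norm_mult_ineq) simp
      also have "\<dots> \<le> (1 * e) * 1" using e yz norm_layer by (intro mult_mono) auto
      finally show ?thesis by simp
    qed
    moreover have "y * truncation M = (\<Sum>i<M. layer i * y * layer i)"
      unfolding truncation_eq_sum sum_distrib_left by (rule sum.cong) (simp_all add: c layer_layer mult.assoc flip: c)
    moreover have "norm (\<Sum>i<M. layer i * y * layer i) \<le> e"
    proof (rule norm_sum_orthogonal_le)
      fix i j :: nat assume "i \<noteq> j"
      then have 0: "layer i * layer j = 0" by (simp add: layer_layer)
      have "adj (layer i * y * layer i) * (layer j * y * layer j) = layer i * adj y * (layer i * layer j) * y * layer j"
        by (simp add: adj_mult adj_layer mult.assoc)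
      then show "adj (layer i * y * layer i) * (layer j * y * layer j) = 0" using 0 by simp
      have "layer i * y * layer i * adj (layer j * y * layer j) = layer i * y * (layer i * layer j) * adj y * layer j"
        by (simp add: adj_mult adj_layer mult.assoc)
      then show "layer i * y * layer i * adj (layer j * y * layer j) = 0" using 0 by simp
    qed (use e calculation(1) 1 in auto)
    ultimately show ?thesis by simp
  qed
  have zf: "norm (z * truncation M) \<le> 2 * e"
    if "norm (y * truncation M) \<le> e" and "norm (y - z) \<le> e" for y z M
  proof -
    have "norm ((y - z) * truncation M) \<le> norm (y - z) * norm (truncation M)" by (rule norm_mult_ineq)
    also have "\<dots> \<le> e * 1" using that e by (intro mult_mono norm_truncation) auto
    moreover have "z * truncation M = y * truncation M - (y - z) * truncation M" by (simp add: left_diff_distrib)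
    ultimately show ?thesis using norm_triangle_ineq4[of "y * truncation M" "(y - z) * truncation M"] that by simp
  qed
  have yz': "norm (adj y - adj z) \<le> e" using yz norm_adj[of "y - z"] by (simp add: adj_diff)
  have comm': "adj y * (wpow k * adj (wpow k)) = wpow k * adj (wpow k) * adj y" for k
    using arg_cong[OF comm[of k], of adj] by (simp add: adj_mult mult.assoc)
  have "norm z \<le> 2 * e"
  proof (rule norm_offdiag_le[OF z])
    show "norm (z * truncation M) \<le> 2 * e" for M using yf[OF z yz comm] yz by (rule zf)
    show "norm (adj z * truncation M) \<le> 2 * e" for M using yf[OF offdiag_adj[OF z] yz' comm'] yz' by (rule zf)
  qed (use e in simp)
  then show ?thesis using yz norm_triangle_ineq[of "y - z" z] by simp
qed

end

section \<open>Commuting words\<close>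

lemma append_replicate_commute:
  "w @ x = x @ w \<Longrightarrow> w @ concat (replicate n x) = concat (replicate n x) @ w"
proof (induction n)
  case (Suc n)
  have "w @ concat (replicate (Suc n) x) = x @ w @ concat (replicate n x)"
    using Suc.prems by (metis append_assoc concat.simps(2) replicate_Suc)
  then show ?case using Suc by simp
qed simp

lemma length_concat_replicate: "length (concat (replicate n x)) = n * length x"
  by (induction n) auto

lemma commuting_prefix:
  assumes "x \<noteq> []" "w @ x = x @ w" "length w \<le> n"
  shows "prefix w (concat (replicate n x))"
proof -
  have "length w \<le> length (concat (replicate n x))"
    using assms(1,3) mult_le_mono[of "length w" n 1 "length x"]
    by (simp add: length_concat_replicate Suc_le_eq)
  moreover have "prefix w (concat (replicate n x) @ w)"
    using append_replicate_commute[OF assms(2), of n] by (metis prefixI)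
  ultimately show ?thesis using prefix_length_prefix by fastforce
qed

text \<open>All words commuting with \<open>x\<close> are prefixes of powers of \<open>x\<close>, so any two of them are comparable.  The
  shortest nonempty one can therefore be split off repeatedly from each of the others.\<close>

lemma commuting_root:
  assumes x: "x \<noteq> []"
  obtains r where "r \<noteq> []" "\<And>w. w @ x = x @ w \<Longrightarrow> \<exists>k. w = concat (replicate k r)"
proof -
  define r where "r = (ARG_MIN length w. w \<noteq> [] \<and> w @ x = x @ w)"
  have r: "r \<noteq> []" "r @ x = x @ r"
    using arg_min_natI[of "\<lambda>w. w \<noteq> [] \<and> w @ x = x @ w" x length] x by (auto simp: r_def)
  have least: "length r \<le> length w" if "w \<noteq> []" "w @ x = x @ w" for w
    unfolding r_def using that by (intro arg_min_nat_le conjI)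
  have "\<exists>k. w = concat (replicate k r)" if "w @ x = x @ w" for w
    using that
  proof (induction "length w" arbitrary: w rule: less_induct)
    case less
    show ?case
    proof (cases "w = []")
      case True then show ?thesis by (intro exI[of _ 0]) simp
    next
      case False
      have "prefix r w"
        using least[OF False less.prems] commuting_prefix[OF x r(2)] commuting_prefix[OF x less.prems]
        by (meson le_refl prefix_length_prefix)
      then obtain w' where w: "w = r @ w'" by (auto simp: prefix_def)
      have "r @ w' @ x = r @ x @ w'" using less.prems r(2) unfolding w by (metis append_assoc)
      then obtain k where "w' = concat (replicate k r)" using less.hyps[of w'] r(1) by (auto simp: w)
      then show ?thesis by (intro exI[of _ "Suc k"]) (simp add: w)
    qed
  qed
  then show ?thesis using that r(1) by blast
qed

text \<open>The hypothesis on \<open>x\<close> says that \<open>length x\<close> is a period of the end of \<open>l\<close>, and similarly for \<open>y\<close>.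
  Both \<open>x @ y\<close> and \<open>y @ x\<close> are then the suffix of \<open>l\<close> of their common length.\<close>

lemma commuting_suffixes:
  assumes "suffix t l" "suffix (t @ x) l" "suffix s l" "suffix (s @ y) l"
    and "length x \<le> length s" "length y \<le> length t"
  shows "x @ y = y @ x"
proof -
  have "suffix (x @ y) l" if "suffix (t @ x) l" "suffix s l" "suffix (s @ y) l" "length x \<le> length s" for t s x y
  proof -
    have "suffix x l" using that(1) by (metis suffix_appendI suffix_def append_assoc)
    then have "suffix x s" using that suffix_length_suffix by blast
    then have "suffix (x @ y) (s @ y)" by simp
    then show ?thesis using that(3) suffix_order.trans by blast
  qed
  from this[OF assms(2,3,4,5)] this[OF assms(4,1,2,6)]
  have "suffix (x @ y) (y @ x)" by (rule suffix_length_suffix) simp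
  then obtain zs where z: "y @ x = zs @ x @ y" by (auto simp: suffix_def)
  have "zs = []" using arg_cong[OF z, of length] by simp
  then show ?thesis using z by simp
qed

section \<open>Paths in a Cuntz-Krieger family\<close>

text \<open>The relations of a Cuntz-Krieger family without singular vertices, written in the type \<open>'a\<close>.  The
  condition that the vertex projections are nonzero stands for the universal property.\<close>

locale graph_algebra = fin_digraph E for E :: "('v, 'e) pre_digraph" +
  fixes P :: "'v \<Rightarrow> 'a::cstar_algebra" and S :: "'e \<Rightarrow> 'a"
  assumes adj_P: "v \<in> verts E \<Longrightarrow> adj (P v) = P v"
    and P_P: "v \<in> verts E \<Longrightarrow> P v * P v = P v"
    and P_orth: "\<lbrakk>v \<in> verts E; w \<in> verts E; v \<noteq> w\<rbrakk> \<Longrightarrow> P v * P w = 0"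
    and adj_S_S: "e \<in> arcs E \<Longrightarrow> adj (S e) * S e = P (head E e)"
    and adj_S_S_orth: "\<lbrakk>e \<in> arcs E; f \<in> arcs E; e \<noteq> f\<rbrakk> \<Longrightarrow> adj (S e) * S f = 0"
    and S_adj_S_S: "e \<in> arcs E \<Longrightarrow> S e * adj (S e) * S e = S e"
    and P_eq_sum: "v \<in> verts E \<Longrightarrow> P v = (\<Sum>e\<in>out_arcs E v. S e * adj (S e))"
    and P_nonzero: "v \<in> verts E \<Longrightarrow> P v \<noteq> 0"
    and generated: "cstar_generated (P ` verts E \<union> S ` arcs E) = UNIV"
    and exits: "every_loop_has_exit E"
begin

lemma S_P: "e \<in> arcs E \<Longrightarrow> S e * P (head E e) = S e"
  using S_adj_S_S[of e] by (simp add: adj_S_S mult.assoc)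

lemma P_S: assumes e: "e \<in> arcs E" shows "P (tail E e) * S e = S e"
proof -
  have "P (tail E e) * S e = (\<Sum>f\<in>out_arcs E (tail E e). S f * adj (S f) * S e)"
    using e by (simp add: P_eq_sum sum_distrib_right)
  also have "\<dots> = (\<Sum>f\<in>out_arcs E (tail E e). if f = e then S e else 0)"
    using e adj_S_S_orth[of _ e] by (intro sum.cong) (auto simp: S_adj_S_S[unfolded mult.assoc] mult.assoc)
  also have "\<dots> = S e" using e by (simp add: finite_out_arcs)
  finally show ?thesis .
qed

text \<open>The element \<open>S\<^sub>\<mu>\<close>, ending with a vertex projection: this makes the recursion uniform and agrees with
  \<open>path_op\<close> since \<open>S\<^sub>e P\<^bsub>r(e)\<^esub> = S\<^sub>e\<close>.\<close>

primrec path_elem :: "'v \<Rightarrow> 'e list \<Rightarrow> 'a" where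
  "path_elem v [] = P v"
| "path_elem v (e # m) = S e * path_elem (head E e) m"

lemma path_op_start: "m \<noteq> [] \<Longrightarrow> path_op P S v m = path_op P S v' m"
proof (induction m)
  case (Cons e m) then show ?case by (cases m) auto
qed simp

lemma path_op_eq: "awalk v m w \<Longrightarrow> path_op P S v m = path_elem v m"
proof (induction m arbitrary: v)
  case (Cons e m)
  then have e: "e \<in> arcs E" "awalk (head E e) m w" by (simp_all add: awalk_Cons_iff)
  show ?case
  proof (cases m)
    case Nil then show ?thesis using e by (simp add: S_P)
  next
    case (Cons f n) 
    then show ?thesis using e Cons.IH[OF e(2)] path_op_start[of m v "head E e"] by simp
  qed
qed simp

lemma P_path_elem: "awalk v m w \<Longrightarrow> P v * path_elem v m = path_elem v m"
  by (cases m) (auto simp: awalk_simps P_P P_S mult.assoc[symmetric])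

lemma path_elem_P: "awalk v m w \<Longrightarrow> path_elem v m * P w = path_elem v m"
  by (induction m arbitrary: v) (auto simp: awalk_simps P_P mult.assoc)

lemma path_elem_append:
  "awalk v m w \<Longrightarrow> awalk w n x \<Longrightarrow> path_elem v (m @ n) = path_elem v m * path_elem w n"
  by (induction m arbitrary: v) (auto simp: awalk_simps P_path_elem mult.assoc)

lemma adj_path_elem_P: "awalk v m w \<Longrightarrow> P w * adj (path_elem v m) = adj (path_elem v m)"
  "awalk v m w \<Longrightarrow> adj (path_elem v m) * P v = adj (path_elem v m)"
  using arg_cong[OF path_elem_P[of v m w], of adj] arg_cong[OF P_path_elem[of v m w], of adj]
  by (auto simp: adj_mult adj_P)

lemma adj_path_elem_path_elem: "awalk v m w \<Longrightarrow> adj (path_elem v m) * path_elem v m = P w"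
proof (induction m arbitrary: v)
  case (Cons e m)
  then have e: "e \<in> arcs E" "awalk (head E e) m w" by (simp_all add: awalk_Cons_iff)
  have "adj (path_elem v (e # m)) * path_elem v (e # m) =
      adj (path_elem (head E e) m) * (adj (S e) * S e * path_elem (head E e) m)"
    by (simp add: adj_mult mult.assoc)
  then show ?case using e Cons.IH by (simp add: adj_S_S P_path_elem)
qed (auto simp: awalk_simps adj_P P_P)

lemma adj_path_elem_mult_cases:
  assumes "awalk v m w" "awalk v' n w'"
  shows "adj (path_elem v m) * path_elem v' n = 0 \<or>
    v = v' \<and> (\<exists>k. n = m @ k \<and> awalk w k w' \<and> adj (path_elem v m) * path_elem v' n = path_elem w k) \<or>
    v = v' \<and> (\<exists>k. m = n @ k \<and> awalk w' k w \<and> adj (path_elem v m) * path_elem v' n = adj (path_elem w' k))"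
  using assms
proof (induction m arbitrary: v v' n)
  case Nil
  then have v: "v = w" "v \<in> verts E" by (auto simp: awalk_simps)
  show ?case
  proof (cases "v = v'")
    case True then show ?thesis using Nil v by (simp add: adj_P P_path_elem)
  next
    case False
    have "P v * path_elem v' n = P v * P v' * path_elem v' n"
      using Nil by (simp add: mult.assoc P_path_elem)
    then show ?thesis using False v awalk_hd_in_verts[OF Nil(2)] by (simp add: adj_P P_orth)
  qed
next
  case (Cons e m)
  note em = Cons.prems(1)
  show ?case
  proof (cases n)
    case Nil
    then have v': "v' = w'" "v' \<in> verts E" using Cons.prems by (auto simp: awalk_simps)
    have ad: "adj (path_elem v (e # m)) * P v = adj (path_elem v (e # m))" by (rule adj_path_elem_P(2)[OF em])
    show ?thesis
    proof (cases "v = v'")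
      case True
      then show ?thesis using ad em v' Nil by simp
    next
      case False
      have "adj (path_elem v (e # m)) * P v' = adj (path_elem v (e # m)) * (P v * P v')"
        unfolding mult.assoc[symmetric] ad ..
      then show ?thesis using False v' awalk_hd_in_verts[OF em] Nil by (simp add: P_orth)
    qed
  next
    case (Cons f n')
    then have e: "e \<in> arcs E" "v = tail E e" "awalk (head E e) m w"
      and f: "f \<in> arcs E" "v' = tail E f" "awalk (head E f) n' w'"
      using Cons.prems by (simp_all add: awalk_Cons_iff)
    have eq: "adj (path_elem v (e # m)) * path_elem v' n =
        adj (path_elem (head E e) m) * (adj (S e) * S f * path_elem (head E f) n')"
      by (simp add: Cons adj_mult mult.assoc)
    show ?thesis
    proof (cases "e = f")
      case True
      then have "adj (path_elem v (e # m)) * path_elem v' n =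
          adj (path_elem (head E e) m) * path_elem (head E e) n'"
        using eq e f by (simp add: adj_S_S P_path_elem)
      then show ?thesis using Cons.IH[OF e(3), of "head E e" n'] f e True Cons by auto
    next
      case False then show ?thesis using eq e f by (simp add: adj_S_S_orth)
    qed
  qed
qed

definition path_projection :: "'v \<Rightarrow> 'e list \<Rightarrow> 'a" where
  "path_projection v m = path_elem v m * adj (path_elem v m)"

lemma adj_path_projection: "adj (path_projection v m) = path_projection v m"
  by (simp add: path_projection_def adj_mult)

lemma path_projection_path_elem: "awalk v m w \<Longrightarrow> path_projection v m * path_elem v m = path_elem v m"
  by (simp add: path_projection_def mult.assoc adj_path_elem_path_elem path_elem_P)

lemma path_projection_idem: "awalk v m w \<Longrightarrow> path_projection v m * path_projection v m = path_projection v m"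
  by (subst (2 3) path_projection_def) (simp add: mult.assoc[symmetric] path_projection_path_elem)

lemma diagonal_eq: "diagonal E P S = cstar_generated {path_projection v m | v m w. awalk v m w}"
proof -
  have "x = path_op P S v m * adj (path_op P S v m) \<and> awalk v m w \<longleftrightarrow>
    x = path_projection v m \<and> awalk v m w" for x v m w
    by (auto simp: path_op_eq path_projection_def)
  then show ?thesis unfolding diagonal_def by (simp only:)
qed

abbreviation D where "D \<equiv> diagonal E P S"

lemma path_projection_in_D: "awalk v m w \<Longrightarrow> path_projection v m \<in> D"
  unfolding diagonal_eq by (rule subsetD[OF subset_cstar_generated]) blast

definition paths_of_length :: "nat \<Rightarrow> ('v \<times> 'e list) set" where
  "paths_of_length n = {(v, m). length m = n \<and> (\<exists>w. awalk v m w)}"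

lemma paths_of_length_Suc: 
  "paths_of_length (Suc n) = (\<lambda>(e, m). (tail E e, e # m)) ` 
     (SIGMA e:arcs E. {m. (head E e, m) \<in> paths_of_length n})"
  by (auto simp: paths_of_length_def length_Suc_conv awalk_Cons_iff image_iff)

lemma finite_paths_of_length: "finite (paths_of_length n)"
proof (rule finite_subset)
  show "paths_of_length n \<subseteq> verts E \<times> {m. set m \<subseteq> arcs E \<and> length m = n}"
    by (auto simp: paths_of_length_def awalk_def)
  show "finite (verts E \<times> {m. set m \<subseteq> arcs E \<and> length m = n})"
    using finite_lists_length_eq[OF finite_arcs] by simp
qed

lemma sum_path_projection:
  "v \<in> verts E \<Longrightarrow> (\<Sum>m | (v, m) \<in> paths_of_length n. path_projection v m) = P v"
proof (induction n arbitrary: v)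
  case 0
  then have "{m. (v, m) \<in> paths_of_length 0} = {[]}" by (auto simp: paths_of_length_def awalk_simps)
  then show ?case using 0 by (simp add: path_projection_def adj_P P_P)
next
  case (Suc n)
  let ?N = "\<lambda>v n. {m. (v, m) \<in> paths_of_length n}"
  have fin: "finite (?N v n)" for v n
    by (rule finite_subset[OF _ finite_imageI[OF finite_paths_of_length[of n], of snd]]) force
  have "?N v (Suc n) = (\<lambda>(e, m). e # m) ` (SIGMA e:out_arcs E v. ?N (head E e) n)"
    by (auto simp: paths_of_length_Suc)
  moreover have "inj_on (\<lambda>(e, m). e # m) (SIGMA e:out_arcs E v. ?N (head E e) n)"
    by (auto simp: inj_on_def)
  ultimately have "(\<Sum>m\<in>?N v (Suc n). path_projection v m) =
      (\<Sum>(e, m)\<in>(SIGMA e:out_arcs E v. ?N (head E e) n). path_projection v (e # m))"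
    by (simp add: sum.reindex case_prod_unfold)
  also have "\<dots> = (\<Sum>e\<in>out_arcs E v. \<Sum>m\<in>?N (head E e) n. path_projection v (e # m))"
    using fin by (subst sum.Sigma) auto
  also have "\<dots> = (\<Sum>e\<in>out_arcs E v. S e * (\<Sum>m\<in>?N (head E e) n. path_projection (head E e) m) * adj (S e))"
    by (simp add: path_projection_def adj_mult mult.assoc sum_distrib_left sum_distrib_right)
  also have "\<dots> = (\<Sum>e\<in>out_arcs E v. S e * adj (S e))"
    by (intro sum.cong) (auto simp: Suc.IH S_P)
  finally show ?case using Suc.prems by (simp add: P_eq_sum)
qed

definition unit :: 'a where "unit = (\<Sum>v\<in>verts E. P v)"

lemma unit_eq_sum: "unit = (\<Sum>(v, m)\<in>paths_of_length n. path_projection v m)"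
proof -
  have "paths_of_length n = (SIGMA v:verts E. {m. (v, m) \<in> paths_of_length n})"
    by (auto simp: paths_of_length_def)
  moreover have "finite {m. (v, m) \<in> paths_of_length n}" for v
    by (rule finite_subset[OF _ finite_imageI[OF finite_paths_of_length[of n], of snd]]) force
  ultimately have "(\<Sum>(v, m)\<in>paths_of_length n. path_projection v m) =
      (\<Sum>v\<in>verts E. \<Sum>m | (v, m) \<in> paths_of_length n. path_projection v m)"
    by (simp add: sum.Sigma)
  then show ?thesis by (simp add: unit_def sum_path_projection)
qed

lemma adj_unit: "adj unit = unit" by (simp add: unit_def adj_sum adj_P)

lemma unit_P: assumes v: "v \<in> verts E" shows "unit * P v = P v"
proof -
  have "unit * P v = (\<Sum>w\<in>verts E. if w = v then P v else 0)"
    unfolding unit_def sum_distrib_right using v P_orth P_P by (intro sum.cong) auto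
  then show ?thesis using v by simp
qed

lemma P_unit: "v \<in> verts E \<Longrightarrow> P v * unit = P v"
  using arg_cong[OF unit_P[of v], of adj] by (simp add: adj_mult adj_P adj_unit)

lemma unit_S: assumes e: "e \<in> arcs E" shows "unit * S e = S e"
proof -
  have "unit * (P (tail E e) * S e) = P (tail E e) * S e"
    using e by (simp only: mult.assoc[symmetric] unit_P tail_in_verts)
  then show ?thesis using e by (simp add: P_S)
qed

lemma S_unit: assumes e: "e \<in> arcs E" shows "S e * unit = S e"
proof -
  have "S e * P (head E e) * unit = S e * P (head E e)"
    using e by (simp only: mult.assoc P_unit head_in_verts)
  then show ?thesis using e by (simp add: S_P)
qed

lemma generator_induct:
  assumes "cstar_subalgebra X" "\<And>v. v \<in> verts E \<Longrightarrow> P v \<in> X" "\<And>e. e \<in> arcs E \<Longrightarrow> S e \<in> X"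
  shows "x \<in> X"
  using cstar_generated_minimal[of "P ` verts E \<union> S ` arcs E" X] assms generated by blast

lemma unit_mult: "unit * x = x" "x * unit = x"
proof -
  let ?X = "{x. unit * x = x} \<inter> {x. x * unit = x}"
  have "closed ?X" by (intro closed_Int closed_Collect_eq continuous_intros)
  moreover have "unit * adj x = adj x" if "x * unit = x" for x
    using arg_cong[OF that, of adj] by (simp add: adj_mult adj_unit)
  moreover have "adj x * unit = adj x" if "unit * x = x" for x
    using arg_cong[OF that, of adj] by (simp add: adj_mult adj_unit)
  moreover have "unit * (x * y) = x * y" if "unit * x = x" for x y
    using that by (simp add: mult.assoc[symmetric])
  moreover have "(x * y) * unit = x * y" if "y * unit = y" for x y
    using that by (simp add: mult.assoc)
  ultimately have "cstar_subalgebra ?X" unfolding cstar_subalgebra_def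
    by (simp add: distrib_left distrib_right mult_scaleC_left mult_scaleC_right)
  then have "x \<in> ?X" by (rule generator_induct) (simp_all add: unit_P P_unit unit_S S_unit)
  then show "unit * x = x" "x * unit = x" by auto
qed

lemma path_projections_commute:
  assumes "awalk v m w" "awalk v' n w'"
  shows "path_projection v m * path_projection v' n = path_projection v' n * path_projection v m"
proof -
  have 1: "path_projection v m * path_projection v (m @ k) = path_projection v (m @ k)"
    if "awalk v m w" "awalk w k w'" for v m w k w'
    unfolding path_projection_def[of v "m @ k"] path_elem_append[OF that]
    by (simp add: mult.assoc[symmetric] path_projection_path_elem[OF that(1)])
  have 2: "path_projection v (m @ k) * path_projection v m = path_projection v (m @ k)"
    if "awalk v m w" "awalk w k w'" for v m w k w'
    using arg_cong[OF 1[OF that], of adj] by (simp add: adj_mult adj_path_projection)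
  have 3: "path_projection v m * path_projection v' n = path_elem v m * (adj (path_elem v m) * path_elem v' n) * adj (path_elem v' n)"
    by (simp add: path_projection_def mult.assoc)
  have 4: "path_projection v' n * path_projection v m = adj (path_projection v m * path_projection v' n)"
    by (simp add: adj_mult adj_path_projection)
  from adj_path_elem_mult_cases[OF assms] show ?thesis
    using 1 2 assms unfolding 4 by (elim disjE conjE exE) (auto simp: 3, auto simp: 3[symmetric] adj_mult adj_path_projection)
qed

lemma D_commutes: assumes x: "x \<in> D" and y: "y \<in> D" shows "x * y = y * x"
proof -
  let ?G = "{path_projection v m | v m w. awalk v m w}"
  have g: "x * g = g * x" if "x \<in> D" "g \<in> ?G" for x g
  proof -
    have "D \<subseteq> {x. \<forall>g\<in>?G. x * g = g * x}" unfolding diagonal_eq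
      by (intro cstar_generated_minimal cstar_subalgebra_commutant)
        (use path_projections_commute adj_path_projection in \<open>force+\<close>)
    then show ?thesis using that by blast
  qed
  have "cstar_subalgebra D" unfolding diagonal_eq by (rule cstar_subalgebra_generated)
  then have "cstar_subalgebra {y. \<forall>x\<in>D. y * x = x * y}"
    by (intro cstar_subalgebra_commutant) (simp add: cstar_subalgebra_def)
  moreover have "?G \<subseteq> {y. \<forall>x\<in>D. y * x = x * y}" using g[symmetric] by blast
  ultimately have "D \<subseteq> {y. \<forall>x\<in>D. y * x = x * y}"
    unfolding diagonal_eq by (intro cstar_generated_minimal) (simp_all only: diagonal_eq)
  then show ?thesis using x y by blast
qed

lemma commutes_with_D_if:
  assumes "\<And>v m w. awalk v m w \<Longrightarrow> x * path_projection v m = path_projection v m * x" "y \<in> D"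
  shows "x * y = y * x"
proof -
  let ?X = "{y. \<forall>g\<in>{x, adj x}. y * g = g * y}"
  have "path_projection v m * adj x = adj x * path_projection v m" if "awalk v m w" for v m w
    using arg_cong[OF assms(1)[OF that], of adj] by (simp add: adj_mult adj_path_projection)
  then have "D \<subseteq> ?X" unfolding diagonal_eq
    by (intro cstar_generated_minimal cstar_subalgebra_commutant) (use assms(1) in auto)
  then show ?thesis using assms(2) by auto
qed

text \<open>The products of a path and an adjoint path span a dense subspace.\<close>

definition monomials :: "'a set" where
  "monomials = {c *\<^sub>C (path_elem v m * adj (path_elem v' n)) | c v m v' n w. awalk v m w \<and> awalk v' n w}"

lemma monomialsI: "awalk v m w \<Longrightarrow> awalk v' n w \<Longrightarrow> c *\<^sub>C (path_elem v m * adj (path_elem v' n)) \<in> monomials"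
  unfolding monomials_def by blast

text \<open>The inner product of two path elements is zero or again a path element or its adjoint, by
  \<open>adj_path_elem_mult_cases\<close>.\<close>

lemma monomials_mult: assumes "x \<in> monomials" "y \<in> monomials" shows "x * y \<in> span monomials"
proof -
  obtain c v m v' n w where x: "x = c *\<^sub>C (path_elem v m * adj (path_elem v' n))"
    "awalk v m w" "awalk v' n w" using assms(1) by (auto simp: monomials_def)
  obtain d a q a' s b where y: "y = d *\<^sub>C (path_elem a q * adj (path_elem a' s))"
    "awalk a q b" "awalk a' s b" using assms(2) by (auto simp: monomials_def)
  have eq: "x * y = (c * d) *\<^sub>C (path_elem v m * (adj (path_elem v' n) * path_elem a q) * adj (path_elem a' s))"
    by (simp add: x y mult_scaleC_left mult_scaleC_right scaleC_scaleC mult.assoc mult.commute[of d])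
  consider "adj (path_elem v' n) * path_elem a q = 0"
    | k where "awalk w k b" "adj (path_elem v' n) * path_elem a q = path_elem w k"
    | k where "awalk b k w" "adj (path_elem v' n) * path_elem a q = adj (path_elem b k)"
    using adj_path_elem_mult_cases[OF x(3) y(2)] by blast
  then show ?thesis
  proof cases
    case 1 then show ?thesis unfolding eq 1 by (simp add: span_zero)
  next
    case 2
    have "x * y = (c * d) *\<^sub>C (path_elem v (m @ k) * adj (path_elem a' s))"
      by (simp add: eq 2 path_elem_append[OF x(2) 2(1)])
    then show ?thesis using x(2) y(3) 2(1) by (auto intro!: span_base monomialsI)
  next
    case 3
    have "x * y = (c * d) *\<^sub>C (path_elem v m * adj (path_elem a' (s @ k)))"
      by (simp add: eq 3 path_elem_append[OF y(3) 3(1)] adj_mult mult.assoc)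
    then show ?thesis using x(2) y(3) 3(1) by (auto intro!: span_base monomialsI)
  qed
qed

lemma span_mult:
  assumes "x \<in> span monomials" "y \<in> span monomials" shows "x * y \<in> span monomials"
  using assms(1)
proof (induction rule: span_induct_alt)
  case (step c x z)
  have "x * y \<in> span monomials" using assms(2)
  proof (induction rule: span_induct_alt)
    case (step c y z)
    then show ?case using monomials_mult[OF \<open>x \<in> monomials\<close>, of y]
      by (simp add: distrib_left span_add span_scale)
  qed (simp add: span_zero)
  then show ?case using step by (simp add: distrib_right span_add span_scale)
qed (simp add: span_zero)

lemma span_adj: "x \<in> span monomials \<Longrightarrow> adj x \<in> span monomials"
proof (induction rule: span_induct_alt)
  case (step c x z)
  obtain d v m v' n w where "x = d *\<^sub>C (path_elem v m * adj (path_elem v' n))" "awalk v m w" "awalk v' n w"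
    using step(1) by (auto simp: monomials_def)
  then have "adj x \<in> monomials" using monomialsI[of v' n w v m "cnj d"] by (simp add: adj_scaleC adj_mult)
  then show ?case using step by (simp add: adj_add adj_scaleR span_add span_scale span_base)
qed (simp add: span_zero)

lemma span_scaleC: "x \<in> span monomials \<Longrightarrow> c *\<^sub>C x \<in> span monomials"
proof (induction rule: span_induct_alt)
  case (step r x z)
  obtain d v m v' n w where "x = d *\<^sub>C (path_elem v m * adj (path_elem v' n))" "awalk v m w" "awalk v' n w"
    using step(1) by (auto simp: monomials_def)
  then have "c *\<^sub>C x \<in> monomials" using monomialsI[of v m w v' n "c * d"] by (simp add: scaleC_scaleC)
  then show ?case using step by (simp add: scaleC_add_right scaleC_scaleR_commute span_add span_scale span_base)
qed (simp add: span_zero)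

lemma monomials_dense: "closure (span monomials) = UNIV"
proof -
  let ?M = "closure (span monomials)"
  have im: "g x \<in> ?M" if "continuous_on UNIV g" "\<And>y. y \<in> span monomials \<Longrightarrow> g y \<in> ?M" "x \<in> ?M" for g x
  proof -
    have "g ` ?M \<subseteq> ?M"
      using that(1,2) by (intro image_closure_subset) (auto intro: continuous_on_subset)
    then show ?thesis using that(3) by blast
  qed
  note cs = subsetD[OF closure_subset]
  have add1: "x + y \<in> ?M" if "x \<in> ?M" "y \<in> span monomials" for x y
    by (rule im[of "\<lambda>x. x + y"]) (use that in \<open>auto intro!: continuous_intros cs span_add\<close>)
  have add: "x + y \<in> ?M" if "x \<in> ?M" "y \<in> ?M" for x y
    by (rule im[of "\<lambda>y. x + y"]) (use that add1 in \<open>auto intro!: continuous_intros\<close>)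
  have mult1: "x * y \<in> ?M" if "x \<in> ?M" "y \<in> span monomials" for x y
    by (rule im[of "\<lambda>x. x * y"]) (use that in \<open>auto intro!: continuous_intros cs span_mult\<close>)
  have mult: "x * y \<in> ?M" if "x \<in> ?M" "y \<in> ?M" for x y
    by (rule im[of "\<lambda>y. x * y"]) (use that mult1 in \<open>auto intro!: continuous_intros\<close>)
  have ad: "adj x \<in> ?M" if "x \<in> ?M" for x
    by (rule im[of adj]) (use that in \<open>auto intro!: linear_continuous_on bounded_linear_adj cs span_adj\<close>)
  have sc: "c *\<^sub>C x \<in> ?M" if "x \<in> ?M" for c x
    by (rule im[of "\<lambda>x. c *\<^sub>C x"])
      (use that in \<open>auto intro!: linear_continuous_on bounded_linear_scaleC cs span_scaleC\<close>)
  have "cstar_subalgebra ?M"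
    unfolding cstar_subalgebra_def using add mult ad sc by (auto intro: cs span_zero)
  moreover have "P v \<in> ?M" if "v \<in> verts E" for v
    using monomialsI[of v "[]" v v "[]" 1] that
    by (intro cs span_base) (simp add: awalk_simps adj_P P_P)
  moreover have "S e \<in> ?M" if "e \<in> arcs E" for e
    using monomialsI[of "tail E e" "[e]" "head E e" "head E e" "[]" 1] that
    by (intro cs span_base) (simp add: awalk_simps adj_P S_P)
  ultimately show ?thesis using generator_induct by blast
qed

end

section \<open>The diagonal is maximal abelian\<close>

context graph_algebra
begin

lemma awalk_concat_replicate: "awalk w r w \<Longrightarrow> awalk w (concat (replicate k r)) w"
  by (induction k) (auto simp: awalk_simps awalk_hd_in_verts intro: awalk_appendI)

lemma awalk_root:
  assumes "awalk w (concat (replicate k r)) w" "concat (replicate k r) \<noteq> []"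
  shows "awalk w r w"
proof -
  obtain j where k: "k = Suc j" using assms(2) by (cases k) auto
  have r: "r \<noteq> []" using assms(2) by auto
  have "awalk w (r @ concat (replicate j r)) w" using assms(1) k by simp
  then have x: "awalk w r (awlast w r)" "awalk (awlast w r) (concat (replicate j r)) w"
    by (auto simp: awalk_append_iff)
  have "awlast w r = w"
  proof (cases j)
    case 0 then show ?thesis using x(2) by (simp add: awalk_simps)
  next
    case (Suc i)
    then show ?thesis using x r by (cases r) (auto simp: awalk_simps)
  qed
  then show ?thesis using x(1) by simp
qed

text \<open>The loops of length at most \<open>l\<close> at the end \<open>w\<close> of a path \<open>m\<close> that repeat along \<open>m\<close>, except possibly in
  its first \<open>l\<close> edges.\<close>

definition loops_along :: "nat \<Rightarrow> 'e list \<Rightarrow> 'v \<Rightarrow> 'e list set" where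
  "loops_along l m w = {k. k \<noteq> [] \<and> awalk w k w \<and> length k \<le> l \<and>
     (\<exists>t. suffix t m \<and> suffix (t @ k) m \<and> length m \<le> length t + l)}"

text \<open>What remains of a monomial with paths of length at most \<open>l\<close> after compression with a long path \<open>m\<close>.\<close>

definition compressions :: "nat \<Rightarrow> 'e list \<Rightarrow> 'v \<Rightarrow> 'a set" where
  "compressions l m w = {c *\<^sub>C x | c x. x \<in> insert (P w)
     (path_elem w ` loops_along l m w \<union> adj ` path_elem w ` loops_along l m w)}"

lemma loops_along_mono: assumes "l \<le> l'" shows "loops_along l m w \<subseteq> loops_along l' m w"
proof
  fix k assume "k \<in> loops_along l m w"
  then obtain t where "k \<noteq> []" "awalk w k w" "length k \<le> l" "suffix t m" "suffix (t @ k) m" "length m \<le> length t + l"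
    by (auto simp: loops_along_def)
  then show "k \<in> loops_along l' m w" using assms by (auto simp: loops_along_def intro!: exI[of _ t])
qed

lemma compressions_mono: "l \<le> l' \<Longrightarrow> compressions l m w \<subseteq> compressions l' m w"
  unfolding compressions_def using loops_along_mono[of l l' m w] by blast

text \<open>A nonzero compression needs \<open>s = m @ k = n @ k'\<close>, and is then the scalar \<open>c\<close> times \<open>S\<^sub>k\<^sup>* S\<^sub>k\<^sub>'\<close>.  So \<open>k\<close> and \<open>k'\<close> are comparable,
  and the difference \<open>t\<close> is a loop with both \<open>k\<close> and, say, \<open>k @ t\<close> being suffixes of \<open>s\<close>.\<close>

lemma compress_monomial:
  assumes x: "awalk v m z" "awalk v' n z" and l: "length m \<le> l" "length n \<le> l"
    and s: "awalk a s w" "2 * l \<le> length s"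
  shows "adj (path_elem a s) * (c *\<^sub>C (path_elem v m * adj (path_elem v' n))) * path_elem a s \<in>
    span (compressions l s w)"
proof -
  define X where "X = adj (path_elem a s) * path_elem v m"
  define Y where "Y = adj (path_elem v' n) * path_elem a s"
  have eq: "adj (path_elem a s) * (c *\<^sub>C (path_elem v m * adj (path_elem v' n))) * path_elem a s = c *\<^sub>C (X * Y)"
    by (simp add: X_def Y_def mult_scaleC_left mult_scaleC_right mult.assoc)
  have pre: "adj (path_elem v m) * path_elem a s = 0 \<or>
      (\<exists>k. s = m @ k \<and> awalk z k w \<and> adj (path_elem v m) * path_elem a s = path_elem z k)"
    if "awalk v m z" "length m \<le> l" for v m
  proof -
    have sk: "s = []" "k = []" if "m = s @ k" for k
    proof -
      have "length s + length k \<le> l" using that \<open>length m \<le> l\<close> by simp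
      then have "length s = 0" "length k = 0" using s(2) by linarith+
      then show "s = []" "k = []" by simp_all
    qed
    then show ?thesis using adj_path_elem_mult_cases[OF that(1) s(1)] s(1) that(1)
      by (auto simp: awalk_simps adj_P)
  qed
  have X: "X = adj (adj (path_elem v m) * path_elem a s)" by (simp add: X_def adj_mult)
  show ?thesis
  proof (cases "X = 0 \<or> Y = 0")
    case True then show ?thesis unfolding eq by (auto simp: span_zero)
  next
    case False
    obtain k where k: "s = m @ k" "awalk z k w" "X = adj (path_elem z k)"
      using pre[OF x(1) l(1)] False X by auto
    obtain k' where k': "s = n @ k'" "awalk z k' w" "Y = path_elem z k'"
      using pre[OF x(2) l(2)] False unfolding Y_def by blast
    note 2 = k(1) k'(1) k(2) k'(2) k(3) k'(3)
    have mem: "c *\<^sub>C y \<in> span (compressions l s w)"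
      if "y = P w \<or> (\<exists>t. t \<in> loops_along l s w \<and> (y = path_elem w t \<or> y = adj (path_elem w t)))" for y
    proof (rule span_base)
      have "y \<in> insert (P w) (path_elem w ` loops_along l s w \<union> adj ` path_elem w ` loops_along l s w)"
        using that by auto
      then show "c *\<^sub>C y \<in> compressions l s w" unfolding compressions_def by blast
    qed
    have loop: "t = [] \<or> t \<in> loops_along l s w"
      if t: "k' = k @ t" and k: "s = m @ k" "s = n @ k'" "awalk w t w" "length m \<le> l" for k k' t m n
    proof -
      have "length t \<le> l" using arg_cong[OF k(1), of length] k(2,4) t by (simp only: length_append)
      moreover have "suffix k s" using k(1) by (rule suffixI)
      moreover have "suffix (k @ t) s" using k(2) unfolding t by (rule suffixI)
      moreover have "length s \<le> length k + l" using arg_cong[OF k(1), of length] k(4) by simp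
      ultimately show ?thesis using k(3) unfolding loops_along_def by blast
    qed
    have P0: "y = P w" if "t = []" "y = path_elem w t \<or> y = adj (path_elem w t)" for y t
      using that s(1) by (auto simp: adj_P awalk_last_in_verts)
    have result: "c *\<^sub>C (X * Y) \<in> span (compressions l s w)"
      if "t = [] \<or> t \<in> loops_along l s w" "X * Y = path_elem w t \<or> X * Y = adj (path_elem w t)" for t
      using that mem[of "X * Y"] P0[of t "X * Y"] by blast
    from adj_path_elem_mult_cases[OF 2(3,4)] show ?thesis unfolding eq 2(5,6)[symmetric]
    proof (elim disjE exE conjE)
      assume "X * Y = 0" then show "c *\<^sub>C (X * Y) \<in> span (compressions l s w)" by (simp add: span_zero)
    next
      fix t assume t: "k' = k @ t" "awalk w t w" "X * Y = path_elem w t"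
      then show "c *\<^sub>C (X * Y) \<in> span (compressions l s w)"
        using loop[OF t(1) 2(1,2) t(2) l(1)] result by blast
    next
      fix t assume t: "k = k' @ t" "awalk w t w" "X * Y = adj (path_elem w t)"
      then show "c *\<^sub>C (X * Y) \<in> span (compressions l s w)"
        using loop[OF t(1) 2(2,1) t(2) l(2)] result by blast
    qed
  qed
qed

lemma compress_span:
  assumes "b \<in> span monomials"
  shows "\<exists>l. \<forall>a s w. awalk a s w \<and> 2 * l \<le> length s \<longrightarrow>
    adj (path_elem a s) * b * path_elem a s \<in> span (compressions l s w)"
  using assms
proof (induction rule: span_induct_alt)
  case base show ?case by (simp add: span_zero)
next
  case (step r x y)
  obtain c v m v' n z where x: "x = c *\<^sub>C (path_elem v m * adj (path_elem v' n))" "awalk v m z" "awalk v' n z"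
    using step(1) by (auto simp: monomials_def)
  obtain l where l: "\<And>a s w. awalk a s w \<Longrightarrow> 2 * l \<le> length s \<Longrightarrow>
      adj (path_elem a s) * y * path_elem a s \<in> span (compressions l s w)" using step(2) by blast
  define l' where "l' = l + length m + length n"
  show ?case
  proof (intro exI[of _ l'] allI impI)
    fix a s w assume s: "awalk a s w \<and> 2 * l' \<le> length s"
    have "adj (path_elem a s) * x * path_elem a s \<in> span (compressions l' s w)"
      unfolding x(1) using s x(2,3) by (intro compress_monomial) (auto simp: l'_def)
    moreover have "adj (path_elem a s) * y * path_elem a s \<in> span (compressions l' s w)"
      using l[of a s w] s span_mono[OF compressions_mono[of l l' s w]] by (auto simp: l'_def)
    ultimately show "adj (path_elem a s) * (r *\<^sub>R x + y) * path_elem a s \<in> span (compressions l' s w)"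
      by (simp add: distrib_left distrib_right span_add span_scale)
  qed
qed

lemma loops_along_commute:
  assumes "k \<in> loops_along l s w" "k' \<in> loops_along l s w" "2 * l \<le> length s"
  shows "k @ k' = k' @ k"
proof -
  obtain t t' where "suffix t s" "suffix (t @ k) s" "length s \<le> length t + l" "length k \<le> l"
    and "suffix t' s" "suffix (t' @ k') s" "length s \<le> length t' + l" "length k' \<le> l"
    using assms by (auto simp: loops_along_def)
  then show ?thesis using assms(3) by (intro commuting_suffixes[of t s k t' k']) auto
qed

text \<open>The path that follows the loop up to its exit \<open>f\<close> and leaves there has range orthogonal to that of
  the loop, and is nonzero because the vertex projection at the head of \<open>f\<close> is.\<close>

lemma loop_not_unitary:
  assumes r: "awalk w r w" "r \<noteq> []"
  shows "path_elem w r * adj (path_elem w r) \<noteq> P w"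
proof
  assume eq: "path_elem w r * adj (path_elem w r) = P w"
  have "closed_w r" using r by (auto simp: closed_w_def)
  then obtain e f g where e: "e \<in> set r" and fg: "f \<in> out_arcs E (tail E e)" "g \<in> out_arcs E (tail E e)" "f \<noteq> g"
    using exits unfolding every_loop_has_exit_def by blast
  then have "\<exists>h\<in>arcs E. tail E h = tail E e \<and> h \<noteq> e" by (cases "f = e") auto
  then obtain f where f: "f \<in> arcs E" "tail E f = tail E e" "f \<noteq> e" by blast
  obtain q q' where q: "r = q @ e # q'" using split_list[OF e] by blast
  have walks: "awalk w q (tail E e)" "e \<in> arcs E" "awalk (head E e) q' w"
    using r(1) unfolding q by (auto simp: awalk_append_iff awalk_simps)
  have wf: "awalk (tail E e) [f] (head E f)" using f by (simp add: awalk_simps)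
  have we: "awalk (tail E e) (e # q') w" using walks by (simp add: awalk_simps)
  let ?x = "path_elem w (q @ [f])"
  have awx: "awalk w (q @ [f]) (head E f)" using walks(1) wf by (rule awalk_appendI)
  have "adj (path_elem w r) * ?x = adj (path_elem (tail E e) (e # q')) *
      (adj (path_elem w q) * path_elem w q * path_elem (tail E e) [f])"
    by (simp only: q path_elem_append[OF walks(1) we] path_elem_append[OF walks(1) wf] adj_mult mult.assoc)
  also have "\<dots> = adj (path_elem (head E e) q') * (adj (S e) * S f) * P (head E f)"
    by (simp only: adj_path_elem_path_elem[OF walks(1)] P_path_elem[OF wf])
      (simp add: adj_mult mult.assoc)
  also have "\<dots> = 0" using f walks by (simp add: adj_S_S_orth)
  finally have 0: "adj (path_elem w r) * ?x = 0" .
  have "?x = path_elem w r * (adj (path_elem w r) * ?x)"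
    using P_path_elem[OF awx] by (simp only: mult.assoc[symmetric] eq)
  then have "?x = 0" using 0 by simp
  then have "P (head E f) = 0" using adj_path_elem_path_elem[OF awx] by simp
  then show False using P_nonzero f by simp
qed

text \<open>All loops along \<open>s\<close> commute, so they are powers of one loop \<open>r\<close>.  In the corner at \<open>w\<close>, the element
  \<open>x\<close> is thus a scalar plus an off-diagonal Toeplitz polynomial in a proper isometry.\<close>

lemma near_scalar:
  assumes s: "awalk a s w" "2 * l \<le> length s" and x: "x \<in> span (compressions l s w)"
    and e: "0 < e" and yx: "norm (y - x) \<le> e"
    and comm: "\<And>m. awalk w m w \<Longrightarrow> y * path_projection w m = path_projection w m * y"
  shows "\<exists>t. norm (y - t *\<^sub>C P w) \<le> 3 * e"
proof (cases "loops_along l s w = {}")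
  case True
  have "\<exists>t. x = t *\<^sub>C P w" using x
  proof (induction rule: span_induct_alt)
    case base show ?case by (intro exI[of _ 0]) simp
  next
    case (step r x z)
    then obtain c d where "x = c *\<^sub>C P w" "z = d *\<^sub>C P w" using True by (auto simp: compressions_def)
    then have "r *\<^sub>R x + z = (complex_of_real r * c + d) *\<^sub>C P w"
      by (simp add: scaleR_scaleC scaleC_scaleC scaleC_add_left)
    then show ?case by blast
  qed
  then show ?thesis using yx e by (smt (verit))
next
  case False
  then obtain k0 where k0: "k0 \<in> loops_along l s w" by blast
  obtain r where r: "r \<noteq> []" "\<And>v. v @ k0 = k0 @ v \<Longrightarrow> \<exists>k. v = concat (replicate k r)"
    using commuting_root[of k0] k0 by (auto simp: loops_along_def)
  have pow: "\<exists>n>0. k = concat (replicate n r)" if k: "k \<in> loops_along l s w" for k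
  proof -
    obtain n where n: "k = concat (replicate n r)" using r(2) loops_along_commute[OF k k0 s(2)] by blast
    then have "n > 0" using k by (cases n) (auto simp: loops_along_def)
    then show ?thesis using n by blast
  qed
  have awr: "awalk w r w" using pow[OF k0] k0 by (auto simp: loops_along_def intro: awalk_root)
  have w: "w \<in> verts E" using awr by (rule awalk_hd_in_verts)
  interpret I: proper_isometry "P w" "path_elem w r"
    using w awr loop_not_unitary[OF awr r(1)]
    by unfold_locales (simp_all add: adj_P P_P adj_path_elem_path_elem P_path_elem path_elem_P)
  have wpow: "I.wpow k = path_elem w (concat (replicate k r))" for k
    by (induction k) (simp_all add: path_elem_append[OF awr awalk_concat_replicate[OF awr]])
  have "\<exists>t z. x = t *\<^sub>C P w + z \<and> I.offdiag z" using x
  proof (induction rule: span_induct_alt)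
    case base show ?case by (intro exI[of _ 0]) (simp add: I.offdiag.zero)
  next
    case (step r x y)
    obtain t z where y: "y = t *\<^sub>C P w + z" "I.offdiag z" using step(2) by blast
    obtain c u where x: "x = c *\<^sub>C u" "u \<in> insert (P w)
        (path_elem w ` loops_along l s w \<union> adj ` path_elem w ` loops_along l s w)"
      using step(1) by (auto simp: compressions_def)
    have rx: "r *\<^sub>R x = (complex_of_real r * c) *\<^sub>C u" by (simp add: x scaleR_scaleC scaleC_scaleC)
    consider "u = P w" | n where "n > 0" "u = I.wpow n \<or> u = adj (I.wpow n)"
      using x(2) pow unfolding wpow by blast
    then show ?case
    proof cases
      case 1
      then have "r *\<^sub>R x + y = (complex_of_real r * c + t) *\<^sub>C P w + z"
        by (simp add: rx y scaleC_add_left)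
      then show ?thesis using y by blast
    next
      case 2
      then have "I.offdiag ((complex_of_real r * c) *\<^sub>C u)" by (auto intro: I.offdiag.intros)
      then have "I.offdiag (r *\<^sub>R x + z)" unfolding rx using y(2) by (rule I.offdiag.add)
      moreover have "r *\<^sub>R x + y = t *\<^sub>C P w + (r *\<^sub>R x + z)" by (simp add: y)
      ultimately show ?thesis by blast
    qed
  qed
  then obtain t z where z: "x = t *\<^sub>C P w + z" "I.offdiag z" by blast
  have "norm (y - t *\<^sub>C P w) \<le> 3 * e"
  proof (rule I.norm_le_if_commutes_near_offdiag[OF z(2) e])
    show "norm (y - t *\<^sub>C P w - z) \<le> e" using yx by (simp add: z(1) diff_diff_eq)
    fix k
    let ?q = "path_projection w (concat (replicate k r))"
    have "P w * ?q = ?q" "?q * P w = ?q"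
      using awalk_concat_replicate[OF awr, of k]
      by (simp_all add: path_projection_def mult.assoc adj_path_elem_P) 
        (simp add: mult.assoc[symmetric] P_path_elem)
    then show "(y - t *\<^sub>C P w) * (I.wpow k * adj (I.wpow k)) = I.wpow k * adj (I.wpow k) * (y - t *\<^sub>C P w)"
      using comm[OF awalk_concat_replicate[OF awr], of k]
      unfolding wpow path_projection_def[symmetric]
      by (simp add: left_diff_distrib right_diff_distrib mult_scaleC_left mult_scaleC_right)
  qed
  then show ?thesis by blast
qed

text \<open>Conjugation by \<open>S\<^sub>s\<close> turns the projection of the path \<open>m\<close> into that of \<open>s @ m\<close>, with which \<open>y\<close>
  commutes.\<close>

lemma compression_commutes:
  assumes y: "\<And>x. x \<in> D \<Longrightarrow> y * x = x * y" and s: "awalk a s w" and m: "awalk w m w'"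
  shows "adj (path_elem a s) * y * path_elem a s * path_projection w m =
    path_projection w m * (adj (path_elem a s) * y * path_elem a s)"
proof -
  let ?s = "path_elem a s" and ?q = "path_projection w m" and ?p = "path_projection a (s @ m)"
  have aw: "awalk a (s @ m) w'" using s m by (rule awalk_appendI)
  have p: "?p = ?s * ?q * adj ?s"
    by (simp add: path_projection_def path_elem_append[OF s m] adj_mult mult.assoc)
  have "P w * ?q = ?q" by (simp add: path_projection_def mult.assoc[symmetric] P_path_elem[OF m])
  moreover have "?q * P w = ?q" by (simp add: path_projection_def mult.assoc adj_path_elem_P[OF m])
  ultimately have ps: "?p * ?s = ?s * ?q" "adj ?s * ?p = ?q * adj ?s"
    unfolding p using adj_path_elem_path_elem[OF s] by (simp_all add: mult.assoc) (simp add: mult.assoc[symmetric])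
  have "adj ?s * y * ?s * ?q = adj ?s * (y * ?p) * ?s" by (simp add: mult.assoc ps)
  also have "y * ?p = ?p * y" using path_projection_in_D[OF aw] by (rule y)
  also have "adj ?s * (?p * y) * ?s = ?q * (adj ?s * y * ?s)"
    by (simp add: mult.assoc[symmetric] ps)
  finally show ?thesis .
qed

lemma path_elem_orth:
  assumes "awalk v m w" "awalk v' n w'" "length m = length n" "(v, m) \<noteq> (v', n)"
  shows "adj (path_elem v m) * path_elem v' n = 0"
  using adj_path_elem_mult_cases[OF assms(1,2)] assms(3,4) by auto

text \<open>The compressions of \<open>y\<close> with all paths of a fixed large length are nearly scalar, and \<open>y\<close> is the
  orthogonal sum of its blocks at these paths.\<close>

theorem diagonal_maximal_abelian:
  assumes y: "\<And>x. x \<in> D \<Longrightarrow> y * x = x * y"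
  shows "y \<in> D"
proof -
  have subD: "cstar_subalgebra D" unfolding diagonal_eq by (rule cstar_subalgebra_generated)
  have "\<exists>d\<in>D. dist d y < e" if e: "0 < e" for e
  proof -
    \<comment> \<open>The off-diagonal estimate costs a factor \<open>3\<close>, and \<open>3 / 4 < 1\<close>.\<close>
    let ?e = "e / 4"
    have "y \<in> closure (span monomials)" by (simp add: monomials_dense)
    then obtain b where b: "b \<in> span monomials" "norm (y - b) < ?e"
      using e unfolding closure_approachable by (metis dist_commute dist_norm divide_pos_pos zero_less_numeral)
    obtain l where l: "\<And>a s w. awalk a s w \<Longrightarrow> 2 * l \<le> length s \<Longrightarrow>
        adj (path_elem a s) * b * path_elem a s \<in> span (compressions l s w)"
      using compress_span[OF b(1)] by blast
    let ?N = "paths_of_length (2 * l)"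
    have "\<exists>t. norm (path_elem a s * (adj (path_elem a s) * y * path_elem a s) * adj (path_elem a s) -
        t *\<^sub>C path_projection a s) \<le> 3 * ?e" if as: "(a, s) \<in> ?N" for a s
    proof -
      obtain w where s: "awalk a s w" "2 * l \<le> length s" using as by (auto simp: paths_of_length_def)
      let ?s = "path_elem a s"
      have ns: "norm ?s \<le> 1"
        using norm_adj_mult[of ?s] adj_path_elem_path_elem[OF s(1)] awalk_last_in_verts[OF s(1)]
          norm_projection_le_1[of "P w"] power_le_one_iff[of "norm ?s" 2] by (simp add: adj_P P_P)
      have n3: "norm (?s * x * adj ?s) \<le> norm x" for x
      proof -
        have "norm (?s * x * adj ?s) \<le> (norm ?s * norm x) * norm (adj ?s)"
          using norm_mult_ineq[of "?s * x" "adj ?s"] mult_right_mono[OF norm_mult_ineq[of ?s x], of "norm (adj ?s)"]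
          by simp
        also have "\<dots> \<le> (1 * norm x) * 1" using ns by (intro mult_mono) auto
        finally show ?thesis by simp
      qed
      have n4: "norm (adj ?s * x * ?s) \<le> norm x" for x
      proof -
        have "norm (adj ?s * x * ?s) \<le> (norm (adj ?s) * norm x) * norm ?s"
          using norm_mult_ineq[of "adj ?s * x" ?s] mult_right_mono[OF norm_mult_ineq[of "adj ?s" x], of "norm ?s"]
          by simp
        also have "\<dots> \<le> (1 * norm x) * 1" using ns by (intro mult_mono) auto
        finally show ?thesis by simp
      qed
      have "norm (adj ?s * y * ?s - adj ?s * b * ?s) \<le> ?e"
        using n4[of "y - b"] b(2) by (simp add: left_diff_distrib right_diff_distrib)
      then obtain t where t: "norm (adj ?s * y * ?s - t *\<^sub>C P w) \<le> 3 * ?e"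
        using near_scalar[OF s l[OF s], of ?e "adj ?s * y * ?s"] e compression_commutes[OF y s(1)] by auto
      have "?s * (adj ?s * y * ?s) * adj ?s - t *\<^sub>C path_projection a s =
          ?s * (adj ?s * y * ?s - t *\<^sub>C P w) * adj ?s"
        by (simp add: left_diff_distrib right_diff_distrib mult_scaleC_left mult_scaleC_right
            path_projection_def path_elem_P[OF s(1)])
      then show ?thesis using n3[of "adj ?s * y * ?s - t *\<^sub>C P w"] t by (intro exI[of _ t]) simp
    qed
    then obtain t where t: "\<And>a s. (a, s) \<in> ?N \<Longrightarrow> norm (path_elem a s * (adj (path_elem a s) * y * path_elem a s) *
        adj (path_elem a s) - t a s *\<^sub>C path_projection a s) \<le> 3 * ?e" by metis
    define x where "x = (\<lambda>(a, s). path_elem a s * (adj (path_elem a s) * y * path_elem a s) *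
        adj (path_elem a s) - t a s *\<^sub>C path_projection a s)"
    define d where "d = (\<Sum>(a, s)\<in>?N. t a s *\<^sub>C path_projection a s)"
    have "d \<in> D" unfolding d_def
      by (intro sum_in_cstar_subalgebra[OF subD])
        (use subD path_projection_in_D in \<open>auto simp: paths_of_length_def cstar_subalgebra_def\<close>)
    moreover have "norm (\<Sum>i\<in>?N. x i) \<le> 3 * ?e"
    proof (rule norm_sum_orthogonal_le[OF finite_paths_of_length])
      have x: "\<exists>z. x (a, s) = path_elem a s * z * adj (path_elem a s)" if as: "(a, s) \<in> ?N" for a s
      proof -
        obtain w where s: "awalk a s w" using as by (auto simp: paths_of_length_def)
        have "x (a, s) = path_elem a s * (adj (path_elem a s) * y * path_elem a s - t a s *\<^sub>C P w) * adj (path_elem a s)"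
          by (simp add: x_def left_diff_distrib right_diff_distrib mult_scaleC_left mult_scaleC_right
            path_projection_def path_elem_P[OF s])
        then show ?thesis by blast
      qed
      fix i j assume ij: "i \<in> ?N" "j \<in> ?N" "i \<noteq> j"
      obtain a s a' s' where i: "i = (a, s)" and j: "j = (a', s')" by (cases i, cases j)
      obtain z z' where z: "x i = path_elem a s * z * adj (path_elem a s)"
        "x j = path_elem a' s' * z' * adj (path_elem a' s')" using x ij i j by metis
      have 0: "adj (path_elem a s) * path_elem a' s' = 0"
        using ij path_elem_orth[of a s _ a' s'] by (auto simp: i j paths_of_length_def)
      have "adj (x i) * x j = path_elem a s * adj z * (adj (path_elem a s) * path_elem a' s') * z' * adj (path_elem a' s')"
        by (simp add: z adj_mult mult.assoc)
      then show "adj (x i) * x j = 0" using 0 by simp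
      have "x i * adj (x j) = path_elem a s * z * (adj (path_elem a s) * path_elem a' s') * adj z' * adj (path_elem a' s')"
        by (simp add: z adj_mult mult.assoc)
      then show "x i * adj (x j) = 0" using 0 by simp
    qed (use e t in \<open>auto simp: x_def\<close>)
    moreover have "(\<Sum>i\<in>?N. x i) = y - d"
    proof -
      have "path_elem a s * (adj (path_elem a s) * y * path_elem a s) * adj (path_elem a s) = path_projection a s * y"
        if as: "(a, s) \<in> ?N" for a s
      proof -
        obtain w where s: "awalk a s w" using as by (auto simp: paths_of_length_def)
        have "path_elem a s * (adj (path_elem a s) * y * path_elem a s) * adj (path_elem a s) =
            path_projection a s * (y * path_projection a s)" by (simp add: path_projection_def mult.assoc)
        also have "y * path_projection a s = path_projection a s * y" using path_projection_in_D[OF s] by (rule y)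
        also have "path_projection a s * (path_projection a s * y) = path_projection a s * y"
          using path_projection_idem[OF s] by (simp add: mult.assoc[symmetric])
        finally show ?thesis .
      qed
      then have "(\<Sum>i\<in>?N. x i) = (\<Sum>i\<in>?N. (case i of (a, s) \<Rightarrow> path_projection a s) * y -
          (case i of (a, s) \<Rightarrow> t a s *\<^sub>C path_projection a s))"
        by (intro sum.cong) (auto simp: x_def)
      then show ?thesis
        by (simp add: sum_subtractf d_def sum_distrib_right[symmetric] unit_eq_sum[symmetric] unit_mult)
    qed
    ultimately show ?thesis using e by (intro bexI[of _ d]) (simp_all add: dist_norm norm_minus_commute[of d])
  qed
  then have "y \<in> closure D" by (simp add: closure_approachable)
  moreover have "closed D" using subD by (simp add: cstar_subalgebra_def)
  ultimately show ?thesis by simp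
qed

end

section \<open>Automorphisms fixing the diagonal\<close>

lemma inv_cstar_Aut:
  assumes "\<alpha> \<in> carrier cstar_Aut" shows "inv\<^bsub>cstar_Aut\<^esub> \<alpha> = inv_into UNIV \<alpha>"
proof -
  interpret group cstar_Aut by (rule group_cstar_Aut)
  have "inv\<^bsub>cstar_Aut\<^esub> \<alpha> \<circ> \<alpha> = id" using l_inv[OF assms] by (simp add: cstar_Aut_def)
  moreover have "\<alpha> \<circ> inv_into UNIV \<alpha> = id"
    using assms by (auto simp: cstar_Aut_def fun_eq_iff bij_is_surj surj_f_inv_f)
  ultimately show ?thesis by (metis comp_assoc comp_id id_comp)
qed

lemma cstar_Aut_closed:
  "\<alpha> \<in> carrier cstar_Aut \<Longrightarrow> \<beta> \<in> carrier cstar_Aut \<Longrightarrow> \<alpha> \<circ> \<beta> \<in> carrier cstar_Aut"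
  "\<alpha> \<in> carrier cstar_Aut \<Longrightarrow> inv_into UNIV \<alpha> \<in> carrier cstar_Aut"
proof -
  interpret group "cstar_Aut :: ('a \<Rightarrow> 'a) monoid" by (rule group_cstar_Aut)
  show "\<alpha> \<in> carrier cstar_Aut \<Longrightarrow> \<beta> \<in> carrier cstar_Aut \<Longrightarrow> \<alpha> \<circ> \<beta> \<in> carrier cstar_Aut"
    using m_closed[of \<alpha> \<beta>] by (simp add: cstar_Aut_def)
  show "\<alpha> \<in> carrier cstar_Aut \<Longrightarrow> inv_into UNIV \<alpha> \<in> carrier cstar_Aut"
    using inv_closed[of \<alpha>] by (simp add: inv_cstar_Aut)
qed

lemma cstar_Aut_inv_apply:
  assumes "\<alpha> \<in> carrier cstar_Aut"
  shows "\<alpha> (inv_into UNIV \<alpha> x) = x" "inv_into UNIV \<alpha> (\<alpha> x) = x"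
  using assms by (auto simp: cstar_Aut_def bij_is_surj surj_f_inv_f bij_is_inj)

lemma in_normalizer_iff:
  assumes "H \<subseteq> carrier cstar_Aut"
  shows "\<alpha> \<in> normalizer cstar_Aut H \<longleftrightarrow>
    \<alpha> \<in> carrier cstar_Aut \<and> (\<lambda>h. \<alpha> \<circ> h \<circ> inv_into UNIV \<alpha>) ` H = H"
proof -
  have "\<alpha> <#\<^bsub>cstar_Aut\<^esub> H #>\<^bsub>cstar_Aut\<^esub> (inv\<^bsub>cstar_Aut\<^esub> \<alpha>) = (\<lambda>h. \<alpha> \<circ> h \<circ> inv_into UNIV \<alpha>) ` H"
    if "\<alpha> \<in> carrier cstar_Aut"
    using that by (auto simp: l_coset_def r_coset_def inv_cstar_Aut) (auto simp: cstar_Aut_def)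
  then show ?thesis using assms by (auto simp: normalizer_def stabilizer_def)
qed

text \<open>If \<open>X\<close> is the set of common fixed points of the group \<open>H\<close> of automorphisms fixing \<open>X\<close>, then
  \<open>\<alpha> H \<alpha>\<inverse>\<close> has \<open>\<alpha>(X)\<close> as its set of common fixed points.\<close>

lemma normalizer_eq_Aut_preserving:
  fixes X :: "'a::cstar_algebra set"
  assumes fixed: "\<And>x. (\<And>h. h \<in> Aut_fixing X \<Longrightarrow> h x = x) \<Longrightarrow> x \<in> X"
  shows "normalizer cstar_Aut (Aut_fixing X) = Aut_preserving X"
proof (rule Set.set_eqI)
  fix \<alpha> :: "'a \<Rightarrow> 'a"
  let ?H = "Aut_fixing X" and ?\<beta> = "inv_into UNIV \<alpha>"
  have H: "?H \<subseteq> carrier cstar_Aut" by (auto simp: Aut_fixing_def)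
  show "\<alpha> \<in> normalizer cstar_Aut ?H \<longleftrightarrow> \<alpha> \<in> Aut_preserving X"
  proof (cases "\<alpha> \<in> carrier cstar_Aut")
    case True
    note i = cstar_Aut_inv_apply[OF True]
    have "(\<lambda>h. \<alpha> \<circ> h \<circ> ?\<beta>) ` ?H = ?H \<longleftrightarrow> \<alpha> ` X = X"
    proof
      assume eq: "(\<lambda>h. \<alpha> \<circ> h \<circ> ?\<beta>) ` ?H = ?H"
      have "\<alpha> x \<in> X" if x: "x \<in> X" for x
      proof (rule fixed)
        fix h assume "h \<in> ?H"
        then obtain k where "k \<in> ?H" "h = \<alpha> \<circ> k \<circ> ?\<beta>" using eq by blast
        then show "h (\<alpha> x) = \<alpha> x" using x by (simp add: i Aut_fixing_def)
      qed
      moreover have "?\<beta> x \<in> X" if x: "x \<in> X" for x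
      proof (rule fixed)
        fix h assume "h \<in> ?H"
        then have "\<alpha> \<circ> h \<circ> ?\<beta> \<in> ?H" using eq by blast
        then have "\<alpha> (h (?\<beta> x)) = x" using x by (simp add: Aut_fixing_def)
        then show "h (?\<beta> x) = ?\<beta> x" by (metis i(2))
      qed
      ultimately show "\<alpha> ` X = X" by (metis i(1) image_eqI image_subsetI subsetI subset_antisym)
    next
      assume X: "\<alpha> ` X = X"
      then have \<alpha>X: "\<alpha> x \<in> X" "?\<beta> x \<in> X" if "x \<in> X" for x using that i(2) by (auto, metis imageE)
      have "\<alpha> \<circ> h \<circ> ?\<beta> \<in> ?H" if "h \<in> ?H" for h
        using that \<alpha>X True by (auto simp: Aut_fixing_def i intro!: cstar_Aut_closed)
      moreover have "h \<in> (\<lambda>h. \<alpha> \<circ> h \<circ> ?\<beta>) ` ?H" if "h \<in> ?H" for h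
      proof (rule image_eqI)
        show "?\<beta> \<circ> h \<circ> \<alpha> \<in> ?H" using that \<alpha>X True by (auto simp: Aut_fixing_def i intro!: cstar_Aut_closed)
        show "h = \<alpha> \<circ> (?\<beta> \<circ> h \<circ> \<alpha>) \<circ> ?\<beta>" by (simp add: fun_eq_iff i)
      qed
      ultimately show "(\<lambda>h. \<alpha> \<circ> h \<circ> ?\<beta>) ` ?H = ?H" by blast
    qed
    then show ?thesis using True by (simp add: in_normalizer_iff[OF H] Aut_preserving_def)
  qed (simp add: in_normalizer_iff[OF H] Aut_preserving_def)
qed

lemma subgroup_Aut_fixing: "subgroup (Aut_fixing X) cstar_Aut"
proof (rule group.subgroupI[OF group_cstar_Aut])
  show "Aut_fixing X \<subseteq> carrier cstar_Aut" by (auto simp: Aut_fixing_def)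
  have "id \<in> carrier (cstar_Aut :: ('a \<Rightarrow> 'a) monoid)"
    using monoid.one_closed[OF group.is_monoid[OF group_cstar_Aut]] by (simp add: cstar_Aut_def)
  then show "Aut_fixing X \<noteq> {}" by (auto simp: Aut_fixing_def)
next
  fix \<alpha> assume a: "\<alpha> \<in> Aut_fixing X"
  then have c: "\<alpha> \<in> carrier cstar_Aut" by (simp add: Aut_fixing_def)
  have "inv_into UNIV \<alpha> x = x" if "x \<in> X" for x
    using cstar_Aut_inv_apply(2)[OF c, of x] a that by (simp add: Aut_fixing_def)
  then show "inv\<^bsub>cstar_Aut\<^esub> \<alpha> \<in> Aut_fixing X"
    using c cstar_Aut_closed(2)[OF c] by (simp add: inv_cstar_Aut Aut_fixing_def)
next
  fix \<alpha> \<beta> assume "\<alpha> \<in> Aut_fixing X" "\<beta> \<in> Aut_fixing X"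
  then have "\<alpha> \<circ> \<beta> \<in> Aut_fixing X" by (auto simp: Aut_fixing_def intro!: cstar_Aut_closed)
  then show "\<alpha> \<otimes>\<^bsub>cstar_Aut\<^esub> \<beta> \<in> Aut_fixing X" by (simp add: cstar_Aut_def)
qed

lemma abelian_subgroup_cstar_Aut_iff:
  "abelian_subgroup K cstar_Aut \<longleftrightarrow> subgroup K cstar_Aut \<and> (\<forall>\<alpha>\<in>K. \<forall>\<beta>\<in>K. \<alpha> \<circ> \<beta> = \<beta> \<circ> \<alpha>)"
proof -
  have m: "\<alpha> \<otimes>\<^bsub>cstar_Aut\<lparr>carrier := K\<rparr>\<^esub> \<beta> = \<alpha> \<circ> \<beta>" for \<alpha> \<beta> by (simp add: cstar_Aut_def)
  show ?thesis
  proof (cases "subgroup K cstar_Aut")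
    case True
    then have g: "group (cstar_Aut\<lparr>carrier := K\<rparr>)"
      by (rule group.subgroup_imp_group[OF group_cstar_Aut])
    have "comm_group (cstar_Aut\<lparr>carrier := K\<rparr>) \<longleftrightarrow> (\<forall>\<alpha>\<in>K. \<forall>\<beta>\<in>K. \<alpha> \<circ> \<beta> = \<beta> \<circ> \<alpha>)"
    proof
      assume "comm_group (cstar_Aut\<lparr>carrier := K\<rparr>)"
      then interpret comm_group "cstar_Aut\<lparr>carrier := K\<rparr>" .
      show "\<forall>\<alpha>\<in>K. \<forall>\<beta>\<in>K. \<alpha> \<circ> \<beta> = \<beta> \<circ> \<alpha>" using m_comm unfolding m by simp
    next
      assume "\<forall>\<alpha>\<in>K. \<forall>\<beta>\<in>K. \<alpha> \<circ> \<beta> = \<beta> \<circ> \<alpha>"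
      then show "comm_group (cstar_Aut\<lparr>carrier := K\<rparr>)"
        using g by (intro group.group_comm_groupI) (auto simp: cstar_Aut_def)
    qed
    then show ?thesis using True by (simp add: abelian_subgroup_def)
  qed (simp add: abelian_subgroup_def)
qed

context graph_algebra
begin

lemma star_aut_bounded_linear: "star_aut \<alpha> \<Longrightarrow> bounded_linear \<alpha>" for \<alpha> :: "'a \<Rightarrow> 'a"
  by (rule star_aut.bounded_linear[of \<alpha> unit]) (simp_all add: unit_mult)

lemma star_aut_unit: assumes "star_aut \<alpha>" shows "\<alpha> unit = unit"
proof -
  interpret star_aut \<alpha> by (rule assms)
  obtain y where y: "unit = \<alpha> y" by (rule surjE)
  have "\<alpha> unit * \<alpha> y = \<alpha> y" by (simp only: mult[symmetric] unit_mult)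
  then have "\<alpha> unit * unit = unit" by (simp only: y[symmetric])
  then show ?thesis by (simp only: unit_mult)
qed

lemma cstar_subalgebra_equalizer:
  assumes "star_aut \<alpha>" "star_aut \<beta>" shows "cstar_subalgebra {x::'a. \<alpha> x = \<beta> x}"
proof -
  interpret a: star_aut \<alpha> by fact
  interpret b: star_aut \<beta> by fact
  have "closed {x. \<alpha> x = \<beta> x}"
    using assms by (intro closed_Collect_eq linear_continuous_on star_aut_bounded_linear)
  then show ?thesis
    by (simp add: cstar_subalgebra_def a.add b.add a.mult b.mult a.scaleC b.scaleC a.adj b.adj)
qed

lemma star_aut_conj:
  assumes w: "w * adj w = unit" "adj w * w = unit"
  shows "star_aut (\<lambda>y. w * y * adj w)"
proof
  show "bij (\<lambda>y. w * y * adj w)"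
  proof (rule bijI')
    show "w * x * adj w = w * y * adj w \<longleftrightarrow> x = y" for x y
    proof
      assume "w * x * adj w = w * y * adj w"
      then have "adj w * (w * x * adj w) * w = adj w * (w * y * adj w) * w" by simp
      moreover have "adj w * (w * z * adj w) * w = z" for z
      proof -
        have "adj w * (w * z * adj w) * w = (adj w * w) * z * (adj w * w)" by (simp only: mult.assoc)
        then show ?thesis by (simp add: w unit_mult)
      qed
      ultimately show "x = y" by simp
    qed simp
    show "\<exists>x. y = w * x * adj w" for y
    proof (rule exI[of _ "adj w * y * w"])
      have "w * (adj w * y * w) * adj w = (w * adj w) * y * (w * adj w)" by (simp only: mult.assoc)
      then show "y = w * (adj w * y * w) * adj w" by (simp add: w unit_mult)
    qed
  qed
  fix x y :: 'a and c
  have "w * x * adj w * (w * y * adj w) = w * x * (adj w * w) * y * adj w" by (simp only: mult.assoc)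
  then show "w * (x * y) * adj w = w * x * adj w * (w * y * adj w)" by (simp add: w unit_mult mult.assoc)
qed (simp_all add: distrib_left distrib_right mult_scaleC_left mult_scaleC_right adj_mult mult.assoc)

text \<open>This is the unitary \<open>1 - q + \<i> q\<close>.  The eigenvalues \<open>1\<close> and \<open>\<i>\<close> are not interchanged by any scalar,
  unlike those of \<open>1 - 2 q\<close>, which would only determine \<open>q\<close> up to \<open>q \<leftrightarrow> 1 - q\<close>.\<close>

definition phase :: "'a \<Rightarrow> 'a" where "phase q = unit + (\<i> - 1) *\<^sub>C q"

lemma phase_unitary:
  assumes "adj q = q" "q * q = q"
  shows "phase q * adj (phase q) = unit" "adj (phase q) * phase q = unit"
proof -
  have a: "adj (phase q) = unit + (- \<i> - 1) *\<^sub>C q"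
    using assms by (simp add: phase_def adj_add adj_scaleC adj_unit)
  have product: "(unit + c *\<^sub>C q) * (unit + d *\<^sub>C q) = unit + (c + d + c * d) *\<^sub>C q" for c d
    by (simp add: distrib_left distrib_right unit_mult mult_scaleC_left mult_scaleC_right
        scaleC_scaleC scaleC_add_left scaleC_add_right assms(2) add_ac mult.commute[of d])
  have "\<i> - 1 + (- \<i> - 1) + (\<i> - 1) * (- \<i> - 1) = 0" "- \<i> - 1 + (\<i> - 1) + (- \<i> - 1) * (\<i> - 1) = 0"
    by (simp_all add: complex_eq_iff)
  then show "phase q * adj (phase q) = unit" "adj (phase q) * phase q = unit"
    unfolding a unfolding phase_def product by simp_all
qed

lemma phase_commutes_iff: "phase q * y = y * phase q \<longleftrightarrow> q * y = y * q"
proof -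
  have "\<i> - 1 \<noteq> 0" by (simp add: complex_eq_iff)
  then show ?thesis
    by (simp add: phase_def distrib_left distrib_right unit_mult mult_scaleC_left mult_scaleC_right
        scaleC_left_cancel)
qed

lemma D_subalgebra: "cstar_subalgebra D"
  unfolding diagonal_eq by (rule cstar_subalgebra_generated)

lemma P_in_D: "v \<in> verts E \<Longrightarrow> P v \<in> D"
  using path_projection_in_D[of v "[]" v] by (simp add: awalk_simps path_projection_def adj_P P_P)

lemma phase_in_D: assumes "awalk v m w" shows "phase (path_projection v m) \<in> D"
  unfolding phase_def unit_def using D_subalgebra path_projection_in_D[OF assms]
    sum_in_cstar_subalgebra[OF D_subalgebra, of "verts E" P] P_in_D
  by (simp add: cstar_subalgebra_def)

lemma conj_phase_in_Aut_fixing: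
  assumes "awalk v m w"
  shows "(\<lambda>y. phase (path_projection v m) * y * adj (phase (path_projection v m))) \<in> Aut_fixing D"
proof -
  let ?w = "phase (path_projection v m)"
  note u = phase_unitary[OF adj_path_projection path_projection_idem[OF assms]]
  have "?w * y * adj ?w = y" if "y \<in> D" for y
    using D_commutes[OF phase_in_D[OF assms] that] by (simp add: mult.assoc u unit_mult)
  then show ?thesis using star_aut_conj[OF u] by (simp add: Aut_fixing_def cstar_Aut_iff)
qed

lemma fixed_points_Aut_fixing_D:
  assumes "\<And>h. h \<in> Aut_fixing D \<Longrightarrow> h y = y" shows "y \<in> D"
proof (rule diagonal_maximal_abelian, rule commutes_with_D_if)
  fix v m w assume a: "awalk v m w"
  let ?w = "phase (path_projection v m)"
  have "?w * y * adj ?w * ?w = y * ?w" using assms[OF conj_phase_in_Aut_fixing[OF a]] by simp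
  then have "?w * y = y * ?w"
    by (simp add: mult.assoc phase_unitary[OF adj_path_projection path_projection_idem[OF a]] unit_mult)
  then show "y * path_projection v m = path_projection v m * y" by (simp add: phase_commutes_iff)
qed

lemma adj_S_D_S:
  assumes e: "e \<in> arcs E" and m: "awalk v m w"
  shows "adj (S e) * path_projection v m * S e \<in> D"
proof -
  have 0: "0 \<in> D" using D_subalgebra by (simp add: cstar_subalgebra_def)
  show ?thesis
  proof (cases m)
    case Nil
    then have v: "v \<in> verts E" using awalk_hd_in_verts[OF m] by simp
    have "adj (S e) * P v * S e = (if v = tail E e then P (head E e) else 0)"
    proof (cases "v = tail E e")
      case True then show ?thesis using e by (simp add: mult.assoc P_S adj_S_S)
    next
      case False
      have "P v * S e = P v * P (tail E e) * S e" using e by (simp add: mult.assoc P_S)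
      then show ?thesis using e v False by (simp add: mult.assoc P_orth)
    qed
    then show ?thesis using Nil v e 0 P_in_D by (simp add: path_projection_def adj_P P_P)
  next
    case (Cons f n)
    then have f: "f \<in> arcs E" "awalk (head E f) n w" using m by (simp_all add: awalk_Cons_iff)
    have eq: "adj (S e) * path_projection v m * S e =
        (adj (S e) * S f * path_elem (head E f) n) * adj (adj (S e) * S f * path_elem (head E f) n)"
      by (simp add: Cons path_projection_def adj_mult mult.assoc)
    show ?thesis
    proof (cases "e = f")
      case True
      then show ?thesis unfolding eq using e path_projection_in_D[OF f(2)]
        by (simp add: adj_S_S P_path_elem[OF f(2)] path_projection_def)
    next
      case False then show ?thesis unfolding eq using e f 0 by (simp add: adj_S_S_orth)
    qed
  qed
qed

text \<open>For a path projection \<open>x\<close> the element \<open>S\<^sub>e\<^sup>* x S\<^sub>e\<close> lies in \<open>D\<close> and is fixed by \<open>\<alpha>\<close>; moving \<open>x\<close> through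
  \<open>\<alpha>(S\<^sub>e) S\<^sub>e\<^sup>*\<close> by means of it shows that the two commute, and \<open>D\<close> is maximal abelian.\<close>

lemma Aut_fixing_S:
  assumes \<alpha>: "\<alpha> \<in> Aut_fixing D" and e: "e \<in> arcs E"
  shows "\<alpha> (S e) * adj (S e) \<in> D" "\<alpha> (S e) = \<alpha> (S e) * adj (S e) * S e"
proof -
  interpret star_aut \<alpha> using \<alpha> by (simp add: Aut_fixing_def cstar_Aut_iff)
  have fix_D: "\<alpha> x = x" if "x \<in> D" for x using \<alpha> that by (simp add: Aut_fixing_def)
  have "\<alpha> (S e) * P (head E e) = \<alpha> (S e * P (head E e))"
    using e fix_D[OF P_in_D[of "head E e"]] by (simp add: mult)
  then show "\<alpha> (S e) = \<alpha> (S e) * adj (S e) * S e" using e by (simp add: mult.assoc adj_S_S S_P)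
  show "\<alpha> (S e) * adj (S e) \<in> D"
  proof (rule diagonal_maximal_abelian, rule commutes_with_D_if)
    fix v m w assume m: "awalk v m w"
    let ?q = "path_projection v m" and ?s = "S e"
    have "awalk (tail E e) [e] (head E e)" using e by (simp add: awalk_simps)
    from path_projection_in_D[OF this] have "?s * adj ?s \<in> D" using e by (simp add: path_projection_def S_P)
    then have c: "?q * (?s * adj ?s) = ?s * adj ?s * ?q" using path_projection_in_D[OF m] by (intro D_commutes)
    have sss: "?s * adj ?s * ?s = ?s" by (rule S_adj_S_S[OF e])
    have sss': "adj ?s * (?s * adj ?s) = adj ?s" using arg_cong[OF sss, of adj] by (simp add: adj_mult mult.assoc)
    have sd: "?s * (adj ?s * ?q * ?s) = ?q * ?s"
    proof -
      have "?s * (adj ?s * ?q * ?s) = (?s * adj ?s * ?q) * ?s" by (simp only: mult.assoc)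
      also have "\<dots> = ?q * (?s * adj ?s) * ?s" by (simp only: c)
      also have "\<dots> = ?q * (?s * adj ?s * ?s)" by (simp only: mult.assoc)
      finally show ?thesis by (simp only: sss)
    qed
    have ds: "adj ?s * ?q = (adj ?s * ?q * ?s) * adj ?s"
    proof -
      have "(adj ?s * ?q * ?s) * adj ?s = adj ?s * (?q * (?s * adj ?s))" by (simp only: mult.assoc)
      also have "\<dots> = adj ?s * (?s * adj ?s * ?q)" by (simp only: c)
      also have "\<dots> = adj ?s * (?s * adj ?s) * ?q" by (simp only: mult.assoc)
      finally show ?thesis by (simp only: sss')
    qed
    have "\<alpha> ?s * adj ?s * ?q = \<alpha> ?s * \<alpha> (adj ?s * ?q * ?s) * adj ?s"
      unfolding fix_D[OF adj_S_D_S[OF e m]] by (subst mult.assoc, subst ds) (simp only: mult.assoc)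
    also have "\<dots> = \<alpha> (?q * ?s) * adj ?s" by (simp only: mult[symmetric] sd)
    also have "\<dots> = ?q * (\<alpha> ?s * adj ?s)" by (simp add: mult fix_D[OF path_projection_in_D[OF m]] mult.assoc)
    finally show "\<alpha> ?s * adj ?s * ?q = ?q * (\<alpha> ?s * adj ?s)" .
  qed
qed

lemma Aut_fixing_D_commute:
  assumes \<alpha>: "\<alpha> \<in> Aut_fixing D" and \<beta>: "\<beta> \<in> Aut_fixing D"
  shows "\<alpha> \<circ> \<beta> = \<beta> \<circ> \<alpha>"
proof
  fix x
  have aut: "\<alpha> \<in> carrier cstar_Aut" "\<beta> \<in> carrier cstar_Aut" using \<alpha> \<beta> by (auto simp: Aut_fixing_def)
  have fix_D: "\<alpha> x = x" "\<beta> x = x" if "x \<in> D" for x using \<alpha> \<beta> that by (auto simp: Aut_fixing_def)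
  interpret a: star_aut \<alpha> using aut by (simp add: cstar_Aut_iff)
  interpret b: star_aut \<beta> using aut by (simp add: cstar_Aut_iff)
  have "cstar_subalgebra {x. (\<alpha> \<circ> \<beta>) x = (\<beta> \<circ> \<alpha>) x}"
    using cstar_Aut_closed(1)[OF aut] cstar_Aut_closed(1)[OF aut(2,1)]
    unfolding cstar_Aut_iff by (rule cstar_subalgebra_equalizer)
  moreover have "P v \<in> {x. (\<alpha> \<circ> \<beta>) x = (\<beta> \<circ> \<alpha>) x}" if "v \<in> verts E" for v
    using fix_D P_in_D[OF that] by simp
  moreover have "S e \<in> {x. (\<alpha> \<circ> \<beta>) x = (\<beta> \<circ> \<alpha>) x}" if e: "e \<in> arcs E" for e
  proof -
    obtain a b where a: "a \<in> D" "\<alpha> (S e) = a * S e" and b: "b \<in> D" "\<beta> (S e) = b * S e"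
      using Aut_fixing_S[OF \<alpha> e] Aut_fixing_S[OF \<beta> e] by blast
    have "\<alpha> (\<beta> (S e)) = b * a * S e" by (simp only: b(2) a.mult fix_D(1)[OF b(1)] a(2) mult.assoc)
    moreover have "\<beta> (\<alpha> (S e)) = a * b * S e" by (simp only: a(2) b.mult fix_D(2)[OF a(1)] b(2) mult.assoc)
    ultimately show ?thesis using D_commutes[OF a(1) b(1)] by simp
  qed
  ultimately have "x \<in> {x. (\<alpha> \<circ> \<beta>) x = (\<beta> \<circ> \<alpha>) x}" by (rule generator_induct)
  then show "(\<alpha> \<circ> \<beta>) x = (\<beta> \<circ> \<alpha>) x" by simp
qed

text \<open>Commuting with the conjugation by \<open>w = phase q\<close> makes \<open>w\<^sup>* \<beta>(w)\<close> central, so \<open>\<beta>(w) = c w\<close>.  Both \<open>w\<close> and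
  \<open>c w\<close> are roots of \<open>(X - 1) (X - \<i>)\<close>.  If \<open>q\<close> is neither \<open>0\<close> nor the unit, then \<open>w\<close> has both
  eigenvalues, so \<open>{c, c \<i>} \<subseteq> {1, \<i>}\<close>, which leaves \<open>c = 1\<close>.\<close>

lemma commutes_with_inner_fixes_projection:
  assumes center: "\<And>z. (\<And>y. z * y = y * z) \<Longrightarrow> \<exists>c. z = c *\<^sub>C unit"
    and \<beta>: "star_aut \<beta>" and q: "adj q = q" "q * q = q"
    and comm: "\<And>y. \<beta> (phase q * y * adj (phase q)) = phase q * \<beta> y * adj (phase q)"
  shows "\<beta> q = q"
proof -
  interpret star_aut \<beta> by fact
  let ?w = "phase q"
  note w = phase_unitary[OF q]
  have \<beta>w: "\<beta> ?w * adj (\<beta> ?w) = unit" "adj (\<beta> ?w) * \<beta> ?w = unit"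
    using w by (simp_all add: adj[symmetric] mult[symmetric] star_aut_unit[OF \<beta>])
  have "adj ?w * \<beta> ?w * z = z * (adj ?w * \<beta> ?w)" for z
  proof -
    obtain y where y: "z = \<beta> y" by (rule surjE)
    have "\<beta> ?w * z * adj (\<beta> ?w) = ?w * z * adj ?w" using comm[of y] by (simp add: mult adj y)
    then have "adj ?w * (\<beta> ?w * z * adj (\<beta> ?w)) * \<beta> ?w = adj ?w * (?w * z * adj ?w) * \<beta> ?w" by simp
    moreover have "adj ?w * (\<beta> ?w * z * adj (\<beta> ?w)) * \<beta> ?w = adj ?w * \<beta> ?w * z"
      by (simp add: mult.assoc \<beta>w unit_mult)
    moreover have "adj ?w * (?w * z * adj ?w) * \<beta> ?w = (adj ?w * ?w) * z * (adj ?w * \<beta> ?w)"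
      by (simp only: mult.assoc)
    ultimately show ?thesis by (simp add: w unit_mult)
  qed
  then obtain c where "adj ?w * \<beta> ?w = c *\<^sub>C unit" using center by blast
  then have "?w * (adj ?w * \<beta> ?w) = c *\<^sub>C ?w" by (simp add: mult_scaleC_right unit_mult)
  then have c: "\<beta> ?w = c *\<^sub>C ?w" by (simp add: mult.assoc[symmetric] w unit_mult)
  show ?thesis
  proof (cases "q = 0 \<or> q = unit")
    case True then show ?thesis using star_aut_unit[OF \<beta>] by auto
  next
    case False
    have "c = 1"
    proof -
      have wq: "?w * q = \<i> *\<^sub>C q" "?w * (unit - q) = unit - q"
        using q by (simp_all add: phase_def distrib_right left_diff_distrib right_diff_distrib unit_mult
            mult_scaleC_left scaleC_diff_left)
      have "(?w - unit) * (?w - \<i> *\<^sub>C unit) = 0"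
      proof -
        have "?w - unit = (\<i> - 1) *\<^sub>C q" by (simp add: phase_def)
        moreover have "q * ?w = \<i> *\<^sub>C q"
          using q by (simp add: phase_def distrib_left right_diff_distrib unit_mult mult_scaleC_right scaleC_diff_left)
        ultimately show ?thesis
          by (simp add: mult_scaleC_left right_diff_distrib mult_scaleC_right unit_mult scaleC_scaleC
              mult.commute)
      qed
      then have "\<beta> ((?w - unit) * (?w - \<i> *\<^sub>C unit)) = 0" by simp
      then have 0: "(c *\<^sub>C ?w - unit) * (c *\<^sub>C ?w - \<i> *\<^sub>C unit) = 0"
        by (simp add: mult diff c scaleC star_aut_unit[OF \<beta>])
      have s: "(c *\<^sub>C ?w - unit) * ((c *\<^sub>C ?w - \<i> *\<^sub>C unit) * x) = ((c * d - 1) * (c * d - \<i>)) *\<^sub>C x"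
        if "?w * x = d *\<^sub>C x" for d x
        by (simp add: left_diff_distrib right_diff_distrib mult_scaleC_left mult_scaleC_right unit_mult that
            scaleC_scaleC scaleC_diff_left scaleC_diff_right scaleC_add_left algebra_simps)
      have z: "k = 0" if "k *\<^sub>C x = 0" "x \<noteq> 0" for k and x :: 'a
        using that norm_scaleC[of k x] by simp
      have ci: "(c * \<i> - 1) * (c * \<i> - \<i>) = 0"
        using s[OF wq(1)] 0 False by (intro z[of _ q]) (simp_all add: mult.assoc[symmetric])
      have "(c * 1 - 1) * (c * 1 - \<i>) = 0"
        using s[of "unit - q" 1] wq(2) 0 False[unfolded eq_commute[of q unit]] by (intro z[of _ "unit - q"]) (simp_all add: mult.assoc[symmetric])
      then have "c = 1 \<or> c = \<i>" by simp
      moreover have "c \<noteq> \<i>" using ci by (auto simp: complex_eq_iff)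
      ultimately show ?thesis by blast
    qed
    then have "\<beta> ?w = ?w" using c by simp
    then have "(\<i> - 1) *\<^sub>C \<beta> q = (\<i> - 1) *\<^sub>C q" by (simp add: phase_def add scaleC star_aut_unit[OF \<beta>])
    moreover have "\<i> - 1 \<noteq> 0" by (simp add: complex_eq_iff)
    ultimately show ?thesis using scaleC_left_cancel by blast
  qed
qed

lemma maximal_abelian_Aut_fixing_D:
  assumes "trivial_center TYPE('a)"
  shows "maximal_abelian_subgroup (Aut_fixing D) cstar_Aut"
  unfolding maximal_abelian_subgroup_def
proof (intro conjI allI impI)
  show "abelian_subgroup (Aut_fixing D) cstar_Aut"
    using subgroup_Aut_fixing Aut_fixing_D_commute by (auto simp: abelian_subgroup_cstar_Aut_iff)
next
  fix K assume K: "abelian_subgroup K cstar_Aut \<and> Aut_fixing D \<subseteq> K"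
  then have comm: "\<And>\<alpha> \<beta>. \<alpha> \<in> K \<Longrightarrow> \<beta> \<in> K \<Longrightarrow> \<alpha> \<circ> \<beta> = \<beta> \<circ> \<alpha>" and "subgroup K cstar_Aut"
    by (auto simp: abelian_subgroup_cstar_Aut_iff)
  then have Kc: "K \<subseteq> carrier cstar_Aut" by (simp add: subgroup.subset)
  obtain u :: 'a where u: "\<And>x. u * x = x" "\<And>x. x * u = x" "algebra_center = range (\<lambda>c. c *\<^sub>C u)"
    using assms by (auto simp: trivial_center_def)
  have "u = unit" using u(1)[of unit] unit_mult(2)[of u] by simp
  have center: "\<exists>c. z = c *\<^sub>C unit" if "\<And>y. z * y = y * z" for z
  proof -
    have "z \<in> algebra_center" using that by (simp add: algebra_center_def)
    then show ?thesis using u(3) \<open>u = unit\<close> by auto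
  qed
  have "\<beta> \<in> Aut_fixing D" if \<beta>: "\<beta> \<in> K" for \<beta>
  proof -
    have aut: "star_aut \<beta>" "star_aut id" using \<beta> Kc by (auto simp: cstar_Aut_iff star_aut_def)
    have "path_projection v m \<in> {x. \<beta> x = id x}" if "awalk v m w" for v m w
    proof -
      let ?w = "phase (path_projection v m)"
      have "(\<lambda>y. ?w * y * adj ?w) \<in> K" using conj_phase_in_Aut_fixing[OF that] K by blast
      from comm[OF \<beta> this] have "\<beta> (?w * y * adj ?w) = ?w * \<beta> y * adj ?w" for y
        by (simp add: fun_eq_iff)
      then show ?thesis
        using commutes_with_inner_fixes_projection[OF center aut(1) adj_path_projection path_projection_idem[OF that]]
        by simp
    qed
    then have "D \<subseteq> {x. \<beta> x = id x}" unfolding diagonal_eq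
      by (intro cstar_generated_minimal cstar_subalgebra_equalizer aut) blast
    then show ?thesis using \<beta> Kc by (auto simp: Aut_fixing_def)
  qed
  then show "K = Aut_fixing D" using K by blast
qed

end

lemma finprod_type_struct:
  fixes f :: "'i \<Rightarrow> 'a::cstar_algebra"
  shows "finite F \<Longrightarrow> finprod (add_group type_struct) f F = sum f F"
proof (induction F rule: finite_induct)
  interpret comm_group "add_group (type_struct :: 'a cstar_struct)"
    by (rule cstar_structure.add_group[OF cstar_structure_type_struct])
  case empty
  have "finprod (add_group type_struct) f {} = \<one>\<^bsub>add_group (type_struct :: 'a cstar_struct)\<^esub>" by simp
  then show ?case by (simp add: add_group_def type_struct_def)
next
  interpret comm_group "add_group (type_struct :: 'a cstar_struct)"
    by (rule cstar_structure.add_group[OF cstar_structure_type_struct])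
  case (insert x F)
  have c: "y \<in> carrier (add_group type_struct)" for y :: 'a by (simp add: add_group_def type_struct_def)
  have m: "y \<otimes>\<^bsub>add_group type_struct\<^esub> z = y + z" for y z :: 'a by (simp add: add_group_def type_struct_def)
  show ?case using insert by (subst finprod_insert) (auto simp: c m)
qed

lemma graph_algebraI:
  assumes E: "fin_digraph E" and ns: "no_sinks E" and ex: "every_loop_has_exit E"
    and U: "graph_cstar_algebra E P S"
  shows "graph_algebra E P S"
proof -
  interpret fin_digraph E by (rule E)
  have CK: "CK_family E type_struct P S" and gen: "cstar_generated (P ` verts E \<union> S ` arcs E) = UNIV"
    using U by (auto simp: graph_cstar_algebra_def)
  have t: "cmult type_struct = (*)" "cadj type_struct = adj" "czero type_struct = 0"
    by (simp_all add: type_struct_def)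
  have "P v = (\<Sum>e\<in>out_arcs E v. S e * adj (S e))" if "v \<in> verts E" for v
    using CK ns that finprod_type_struct[of "out_arcs E v" "\<lambda>e. S e * adj (S e)"]
    by (auto simp: CK_family_def no_sinks_def t finite_out_arcs simp del: in_out_arcs_conv)
  then show ?thesis
    using CK gen ex vertex_projection_nonzero[OF E ns U]
    by unfold_locales (simp_all add: CK_family_def t projection_def partial_isometry_def)
qed

theorem proposition3p3:
  fixes E :: "('v, 'e) pre_digraph"
    and P :: "'v \<Rightarrow> 'a::cstar_algebra"
    and S :: "'e \<Rightarrow> 'a"
  assumes "fin_digraph E"
    and "no_sinks E"
    and "every_loop_has_exit E"
    and "graph_cstar_algebra E P S"
  shows "normalizer cstar_Aut (Aut_fixing (diagonal E P S)) = Aut_preserving (diagonal E P S) \<and>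
    (trivial_center TYPE('a) \<longrightarrow>
      maximal_abelian_subgroup (Aut_fixing (diagonal E P S)) cstar_Aut)"
proof -
  interpret graph_algebra E P S using assms by (rule graph_algebraI)
  show ?thesis
    using normalizer_eq_Aut_preserving[OF fixed_points_Aut_fixing_D] maximal_abelian_Aut_fixing_D
    by blast
qed

end
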